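(* Let $G$ be a 2-connected graph on $n$ vertices with $\delta(G)\geq k$, and let $C$ be a locally maximal cycle in $G$ of length $c\in[6,n-1]$. If $e(G)>\max\{f(n,k+1,c),f(n,\lfloor c/2\rfloor-1,c)\}$ and $e(G[V(C)])>h(c+1,\lfloor c/2\rfloor-1)$, then either $G$ is isomorphic to a subgraph of $W_{n,\lfloor c/2\rfloor,c}$, or the $C$-closure $\overline{G}$ of $G$ is isomorphic to $W_{n,k,c}$ or to $Z_{n,k,c}$.
   Context: Graphs are simple and finite. A cycle $C$ in $G$ is locally maximal if there is no cycle $C'$ in $G$ with $|E(C')|>|E(C)|$ and $|E(C')\cap E(C,G-C)|\leq 2$, where $E(C,G-C)$ is the set of edges with exactly one endpoint in $V(C)$. $h(n,k)=\binom{n-k}{2}+k(k-1)$. $f(n,k,c)=\binom{c-k+1}{2}+k(n-c+k-1)$. $W_{n,k,c}$: a clique $K_{c-k+1}$ plus $n-(c-k+1)$ new vertices each joined exactly to the same $k$ vertices of the clique. $Z_{n,k,c}$: union of a clique $K_{c-k+1}$ and $\frac{n-(c-k+1)}{k-1}$ cliques $K_{k+1}$ such that any two of these cliques share exactly the same two vertices. The $m$-closure of a graph is obtained by recursively joining pairs of nonadjacent vertices whose degree sum (in the current graph) is at least $m$ until no such pair remains. The $C$-closure $\overline{G}$ is obtained from $G$ by replacing $G[V(C)]$ by its $(c+1)$-closure. *)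

theory Defs
  imports "Graph_Theory.Graph_Theory"
begin

text \<open>
  A finite simple graph is a \<open>pair_graph\<close> of \<open>Graph_Theory\<close>, i.e. a finite, loop-free, symmetric
  digraph whose arcs are vertex pairs. An undirected edge is the pair of opposite arcs
  \<open>(u, v)\<close>, \<open>(v, u)\<close>; edges are counted as the two-element sets \<open>{u, v}\<close>, and the degree of a
  vertex is its out-degree.
\<close>

definition edge_of :: "'a \<times> 'a \<Rightarrow> 'a set" where
  "edge_of a = {fst a, snd a}"

definition edges :: "'a pair_pre_digraph \<Rightarrow> 'a set set" where
  "edges G = edge_of ` parcs G"

definition num_edges :: "'a pair_pre_digraph \<Rightarrow> nat" where
  "num_edges G = card (edges G)"

definition min_degree :: "'a pair_pre_digraph \<Rightarrow> nat" where
  "min_degree G = Min (out_degree G ` pverts G)"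

definition two_connected :: "'a pair_pre_digraph \<Rightarrow> bool" where
  "two_connected G \<longleftrightarrow> 3 \<le> card (pverts G) \<and> Digraph_Component.connected (with_proj G) \<and>
     (\<forall>v \<in> pverts G. Digraph_Component.connected (pre_digraph.del_vert (with_proj G) v))"

text \<open>The library's \<open>induce_subgraph\<close>, repackaged as a pair digraph.\<close>

definition induced :: "'a pair_pre_digraph \<Rightarrow> 'a set \<Rightarrow> 'a pair_pre_digraph" where
  "induced G S = \<lparr>pverts = verts (with_proj G \<restriction> S), parcs = arcs (with_proj G \<restriction> S)\<rparr>"

text \<open>
  Cycles are given by their list of arcs. The library's \<open>cycle\<close> also admits the closed walk
  \<open>u, v, u\<close>, which is not a cycle of the undirected graph, hence the length condition.
\<close>

definition graph_cycle :: "'a pair_pre_digraph \<Rightarrow> ('a \<times> 'a) awalk \<Rightarrow> bool" where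
  "graph_cycle G C \<longleftrightarrow> pre_digraph.cycle (with_proj G) C \<and> 3 \<le> length C"

definition cycle_verts :: "('a \<times> 'a) awalk \<Rightarrow> 'a set" where
  "cycle_verts C = fst ` set C"

definition cycle_edges :: "('a \<times> 'a) awalk \<Rightarrow> 'a set set" where
  "cycle_edges C = edge_of ` set C"

definition boundary :: "'a pair_pre_digraph \<Rightarrow> 'a set \<Rightarrow> 'a set set" where
  "boundary G S = {e \<in> edges G. card (e \<inter> S) = 1}"

definition locally_maximal_cycle :: "'a pair_pre_digraph \<Rightarrow> ('a \<times> 'a) awalk \<Rightarrow> bool" where
  "locally_maximal_cycle G C \<longleftrightarrow> graph_cycle G C \<and>
     \<not> (\<exists>C'. graph_cycle G C' \<and> card (cycle_edges C) < card (cycle_edges C') \<and>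
            card (cycle_edges C' \<inter> boundary G (cycle_verts C)) \<le> 2)"

text \<open>
  The truncated subtractions are exact for \<open>k \<le> n\<close> in \<open>h_fun\<close>, and for \<open>k \<le> c + 1\<close> and
  \<open>c < n\<close> in \<open>f_fun\<close>.
\<close>

definition h_fun :: "nat \<Rightarrow> nat \<Rightarrow> nat" where
  "h_fun n k = ((n - k) choose 2) + k * (k - 1)"

definition f_fun :: "nat \<Rightarrow> nat \<Rightarrow> nat \<Rightarrow> nat" where
  "f_fun n k c = ((c + 1 - k) choose 2) + k * (n + k - c - 1)"

text \<open>
  The graphs \<open>W\<close> and \<open>Z\<close> are specified up to isomorphism. No graph satisfies the specification
  for parameters for which the construction makes no sense (such as \<open>k > c - k + 1\<close> for \<open>W\<close>,
  or \<open>k - 1\<close> not dividing \<open>n - (c - k + 1)\<close> for \<open>Z\<close>).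
\<close>

definition is_W :: "nat \<Rightarrow> nat \<Rightarrow> nat \<Rightarrow> 'a pair_pre_digraph \<Rightarrow> bool" where
  "is_W n k c G \<longleftrightarrow> (\<exists>K S T. finite K \<and> finite T \<and> K \<inter> T = {} \<and> S \<subseteq> K \<and>
     card K = c + 1 - k \<and> card S = k \<and> card (K \<union> T) = n \<and>
     pverts G = K \<union> T \<and>
     parcs G = {(u, v). u \<noteq> v \<and> (u \<in> K \<and> v \<in> K \<or> u \<in> S \<and> v \<in> T \<or> u \<in> T \<and> v \<in> S)})"

text \<open>\<open>A 0\<close> is the large clique, \<open>A 1, \<dots>, A t\<close> are the small ones.\<close>

definition is_Z :: "nat \<Rightarrow> nat \<Rightarrow> nat \<Rightarrow> 'a pair_pre_digraph \<Rightarrow> bool" where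
  "is_Z n k c G \<longleftrightarrow> (\<exists>(A :: nat \<Rightarrow> 'a set) t x y.
     2 \<le> k \<and> c + 1 - k \<le> n \<and> t * (k - 1) = n - (c + 1 - k) \<and> x \<noteq> y \<and>
     (\<forall>i \<le> t. finite (A i)) \<and> card (A 0) = c + 1 - k \<and> (\<forall>i \<in> {1..t}. card (A i) = k + 1) \<and>
     (\<forall>i \<le> t. \<forall>j \<le> t. i \<noteq> j \<longrightarrow> A i \<inter> A j = {x, y}) \<and>
     pverts G = (\<Union>i\<le>t. A i) \<and>
     parcs G = {(u, v). u \<noteq> v \<and> (\<exists>i \<le> t. u \<in> A i \<and> v \<in> A i)})"

definition closure_step :: "nat \<Rightarrow> 'a pair_pre_digraph \<Rightarrow> 'a pair_pre_digraph \<Rightarrow> bool" where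
  "closure_step m G G' \<longleftrightarrow> (\<exists>u \<in> pverts G. \<exists>v \<in> pverts G.
     u \<noteq> v \<and> (u, v) \<notin> parcs G \<and> m \<le> out_degree G u + out_degree G v \<and>
     G' = \<lparr>pverts = pverts G, parcs = parcs G \<union> {(u, v), (v, u)}\<rparr>)"

definition is_m_closure :: "nat \<Rightarrow> 'a pair_pre_digraph \<Rightarrow> 'a pair_pre_digraph \<Rightarrow> bool" where
  "is_m_closure m G H \<longleftrightarrow> (closure_step m)\<^sup>*\<^sup>* G H \<and> (\<forall>H'. \<not> closure_step m H H')"

definition m_closure :: "nat \<Rightarrow> 'a pair_pre_digraph \<Rightarrow> 'a pair_pre_digraph" where
  "m_closure m G = (THE H. is_m_closure m G H)"

definition C_closure :: "'a pair_pre_digraph \<Rightarrow> ('a \<times> 'a) awalk \<Rightarrow> 'a pair_pre_digraph" where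
  "C_closure G C =
     \<lparr>pverts = pverts G,
      parcs = (parcs G - parcs (induced G (cycle_verts C))) \<union>
              parcs (m_closure (card (cycle_edges C) + 1) (induced G (cycle_verts C)))\<rparr>"

definition iso_to_subgraph :: "'a pair_pre_digraph \<Rightarrow> 'b pair_pre_digraph \<Rightarrow> bool" where
  "iso_to_subgraph G W \<longleftrightarrow>
     (\<exists>H :: 'b pair_pre_digraph. subgraph (with_proj H) (with_proj W) \<and>
        digraph_iso (with_proj G) (with_proj H))"

lemma pair_graph_induced:
  assumes "pair_graph G" "finite S"
  shows "pair_graph (induced G S)"
proof -
  interpret pair_graph G by fact
  have "finite {e \<in> parcs G. fst e \<in> S \<and> snd e \<in> S}" using pair_finite_arcs by simp
  then show ?thesis using assms(2) pair_no_loops arcs_symmetric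
    by unfold_locales (auto simp: induced_def symmetric_def sym_def)
qed

subsection \<open>The closure is well defined\<close>

lemma closure_step_verts: "(closure_step m)\<^sup>*\<^sup>* G H \<Longrightarrow> pverts H = pverts G"
  by (induction rule: rtranclp_induct) (auto simp: closure_step_def)

lemma closure_step_wf:
  assumes "(closure_step m)\<^sup>*\<^sup>* G H" "parcs G \<subseteq> pverts G \<times> pverts G"
  shows "parcs H \<subseteq> pverts G \<times> pverts G"
  using assms
proof (induction rule: rtranclp_induct)
  case (step H H')
  then show ?case using closure_step_verts[OF step.hyps(1)] by (auto simp: closure_step_def)
qed

lemma closure_step_mono: "(closure_step m)\<^sup>*\<^sup>* G H \<Longrightarrow> parcs G \<subseteq> parcs H"
  by (induction rule: rtranclp_induct) (auto simp: closure_step_def)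

lemma out_degree_mono:
  assumes "parcs G \<subseteq> parcs H" "finite (parcs H)"
  shows "out_degree (with_proj G) u \<le> out_degree (with_proj H) u"
  unfolding out_degree_def out_arcs_def using assms by (auto intro!: card_mono)

lemma closure_step_le_closed:
  assumes "(closure_step m)\<^sup>*\<^sup>* G H" "parcs G \<subseteq> parcs H2" "pverts H2 = pverts G"
    "finite (parcs H2)" "\<forall>H'. \<not> closure_step m H2 H'"
  shows "parcs H \<subseteq> parcs H2"
  using assms
proof (induction rule: rtranclp_induct)
  case (step H H')
  then have sub: "parcs H \<subseteq> parcs H2" by blast
  from step.hyps(2) obtain u v where uv: "u \<in> pverts H" "v \<in> pverts H" "u \<noteq> v"
    "m \<le> out_degree H u + out_degree H v" "parcs H' = parcs H \<union> {(u, v), (v, u)}"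
    unfolding closure_step_def by auto
  have V: "pverts H = pverts H2" using closure_step_verts[OF step.hyps(1)] step.prems by simp
  have deg: "m \<le> out_degree H2 u + out_degree H2 v"
    using uv(4) out_degree_mono[OF sub step.prems(3), of u] out_degree_mono[OF sub step.prems(3), of v]
    by linarith
  have closed: "(a, b) \<in> parcs H2" if "a \<in> pverts H2" "b \<in> pverts H2" "a \<noteq> b"
    "m \<le> out_degree H2 a + out_degree H2 b" for a b
    using step.prems(4) that unfolding closure_step_def by blast
  have "(u, v) \<in> parcs H2" "(v, u) \<in> parcs H2"
    using closed[of u v] closed[of v u] uv(1-3) V deg by (auto simp: add.commute)
  with sub uv(5) show ?case by auto
qed

lemma closure_terminates:
  assumes "finite (pverts G)" "parcs G \<subseteq> pverts G \<times> pverts G"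
  shows "\<exists>H. is_m_closure m G H"
  using assms
proof (induction "card (pverts G \<times> pverts G - parcs G)" arbitrary: G rule: less_induct)
  case less
  show ?case
  proof (cases "\<exists>G'. closure_step m G G'")
    case False
    then show ?thesis unfolding is_m_closure_def by blast
  next
    case True
    then obtain G' where G': "closure_step m G G'" by blast
    then obtain u v where uv: "u \<in> pverts G" "v \<in> pverts G" "(u, v) \<notin> parcs G"
      "pverts G' = pverts G" "parcs G' = parcs G \<union> {(u, v), (v, u)}"
      unfolding closure_step_def by auto
    have "card (pverts G' \<times> pverts G' - parcs G') < card (pverts G \<times> pverts G - parcs G)"
      using uv less.prems by (intro psubset_card_mono) auto
    with less.hyps[of G'] uv less.prems obtain H where "is_m_closure m G' H" by auto
    with G' show ?thesis unfolding is_m_closure_def by (meson converse_rtranclp_into_rtranclp)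
  qed
qed

lemma is_m_closure_unique:
  assumes "finite (pverts G)" "parcs G \<subseteq> pverts G \<times> pverts G"
    "is_m_closure m G H1" "is_m_closure m G H2"
  shows "H1 = H2"
proof -
  have fin: "finite (parcs H)" if "is_m_closure m G H" for H
    using that closure_step_wf[of m G H] assms(1,2) unfolding is_m_closure_def
    by (meson finite_SigmaI finite_subset)
  have "parcs H \<subseteq> parcs H'" if "is_m_closure m G H" "is_m_closure m G H'" for H H'
    using that fin[OF that(2)] unfolding is_m_closure_def
    by (meson closure_step_le_closed closure_step_mono closure_step_verts)
  then have "parcs H1 = parcs H2" using assms(3,4) by blast
  moreover have "pverts H1 = pverts H2"
    using assms(3,4) closure_step_verts unfolding is_m_closure_def by metis
  ultimately show ?thesis by simp
qed

lemma is_m_closure_m_closure: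
  assumes "pair_graph G"
  shows "is_m_closure m G (m_closure m G)"
proof -
  interpret pair_graph G by fact
  have "finite (pverts G)" "parcs G \<subseteq> pverts G \<times> pverts G"
    using pair_finite_verts in_arcsD1 in_arcsD2 by auto
  then show ?thesis
    unfolding m_closure_def using closure_terminates is_m_closure_unique by (metis theI)
qed

end

theory Submission
  imports Defs
begin

text \<open>
  A longer path between two vertices of \<open>C\<close> in the closed graph \<open>G[V(C)]\<close> can be rerouted along
  edges of \<open>G\<close>, so \<open>C\<close> stays locally maximal in its closure, and \<open>G[V(C)]\<close> may be assumed to be
  \<open>(c+1)\<close>-closed. Let \<open>S\<close> be the clique of all vertices of degree at least \<open>c - \<lfloor>c/2\<rfloor> + 1\<close> in
  \<open>G[V(C)]\<close>.

  If \<open>S\<close> is large, say \<open>|S| = c + 1 - d\<close> with \<open>d < \<lfloor>c/2\<rfloor>\<close>, then a path through \<open>G - C\<close> with \<open>b\<close>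
  vertices between \<open>u, v \<in> C\<close> forces \<open>b\<close> vertices of \<open>C - S\<close> right after \<open>u\<close> and \<open>v\<close> on \<open>C\<close>, of
  which there are only \<open>d - 1\<close>. Combined with a rooted version of the Erdos--Gallai path lemma this
  shows that \<open>G - C\<close> can be peeled off by vertices of degree at most \<open>d\<close>; hence \<open>e(G) \<le> f(n,d,c)\<close>,
  so \<open>d = k\<close> by convexity of \<open>f\<close>. The equality cases of the argument are exactly the graphs
  \<open>W\<close> (components of \<open>G - C\<close> are vertices) and \<open>Z\<close> (they are cliques).

  Otherwise the bound on \<open>e(G[V(C)])\<close> makes all vertices of \<open>S\<close> universal in \<open>G[V(C)]\<close> and gives
  \<open>|S| \<in> {\<lfloor>c/2\<rfloor> - 1, \<lfloor>c/2\<rfloor>}\<close>. Threading a minimum partition of \<open>C - S\<close> into vertices and edges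
  through \<open>S\<close> yields Hamiltonian paths of \<open>G[V(C)]\<close> that exclude the smaller value and confine all
  edges leaving \<open>C\<close> to \<open>S\<close>.
\<close>

subsection \<open>Rooted paths\<close>

text \<open>Peeling destroys 2-connectivity, so the path lemma is not applied to the vertices that
  remain. It runs in a whole component of \<open>G - C\<close> and may use vertices already peeled
  off; only degrees are counted in the remaining set \<open>U\<close>. Its path contains some
  \<open>w\<close> of \<open>U\<close> with all \<open>g\<close> neighbours of \<open>w\<close> in
  \<open>U\<close>, which gives an ear with at least \<open>g + 1\<close> inner vertices. The
  neighbours of \<open>w\<close> on \<open>C\<close> are the other half of its degree, and both
  halves are paid for by \<open>C - S\<close>. An ear with \<open>b\<close> inner vertices between
  \<open>f i\<close> and \<open>f j\<close> forbids all chords from \<open>f (i + k)\<close> to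
  \<open>f (j + l)\<close> with \<open>k, l \<ge> 1\<close> and \<open>k + l \<le> b + 1\<close>.
  Since \<open>S\<close> is a clique, this forces long runs of \<open>C - S\<close> behind the ends
  of an ear, and at most one of the runs behind the neighbours of \<open>w\<close> is empty. The
  number \<open>c + 1\<close> is the degree sum at which a path with both ends prescribed can be
  freed from a missing edge without getting shorter; for Hamiltonian cycles the sum \<open>c\<close>
  would do.\<close>

definition gpath :: "('a \<Rightarrow> 'a \<Rightarrow> bool) \<Rightarrow> 'a set \<Rightarrow> 'a \<Rightarrow> 'a list \<Rightarrow> 'a \<Rightarrow> bool" where
  "gpath E A x P y \<longleftrightarrow>
     P \<noteq> [] \<and> hd P = x \<and> last P = y \<and> distinct P \<and> set P \<subseteq> A \<and> successively E P"

lemma gpath_mono: "gpath E A x P y \<Longrightarrow> A \<subseteq> B \<Longrightarrow> gpath E B x P y"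
  unfolding gpath_def by blast

lemma gpath_ends: "gpath E A x P y \<Longrightarrow> x \<in> set P \<and> y \<in> set P"
  unfolding gpath_def using hd_in_set last_in_set by blast

lemma gpath_self: "gpath E A x P x \<Longrightarrow> P = [x]"
  unfolding gpath_def by (cases P) (auto split: if_splits)

lemma gpath_Cons:
  assumes "gpath E A x P y" "E z x" "z \<notin> A"
  shows "gpath E (insert z A) z (z # P) y"
  using assms unfolding gpath_def by (auto simp: successively_Cons)

lemma gpath_append_tl:
  assumes "gpath E A x P y" "gpath E B y Q z" "A \<inter> B \<subseteq> {y}"
  shows "gpath E (A \<union> B) x (P @ tl Q) z"
proof -
  obtain Q' where Q: "Q = y # Q'" using assms(2) unfolding gpath_def by (cases Q) auto
  have "y \<notin> set Q'" "set Q' \<subseteq> B" "distinct Q'" using assms(2) unfolding gpath_def Q by auto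
  then have "set P \<inter> set Q' = {}" using assms(1,3) unfolding gpath_def by blast
  with assms(1,2) show ?thesis unfolding gpath_def Q
    by (auto simp: successively_append_iff successively_Cons)
qed

text \<open>Connectivity enters only through cut conditions. The set of vertices reached by a path
  inside \<open>A\<close> would otherwise be a cut without a leaving edge.\<close>

lemma exists_gpath:
  assumes "x \<in> A" "y \<in> A"
    and cut: "\<And>D. x \<in> D \<Longrightarrow> D \<subseteq> A \<Longrightarrow> y \<notin> D \<Longrightarrow> \<exists>a\<in>D. \<exists>b\<in>A - D. E a b"
  shows "\<exists>P. gpath E A x P y"
proof (rule ccontr)
  assume no: "\<nexists>P. gpath E A x P y"
  define D where "D = {z \<in> A. \<exists>P. gpath E A x P z}"
  have "gpath E A x [x] x" using assms(1) unfolding gpath_def by simp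
  then have "x \<in> D" unfolding D_def using assms(1) by blast
  moreover have "y \<notin> D" using no unfolding D_def by blast
  ultimately obtain a b where ab: "a \<in> D" "b \<in> A - D" "E a b"
    using cut[of D] unfolding D_def by blast
  obtain P where P: "gpath E A x P a" using ab(1) unfolding D_def by blast
  have "b \<notin> set P"
  proof
    assume "b \<in> set P"
    then obtain P1 P2 where "P = P1 @ b # P2" by (meson split_list)
    with P have "gpath E A x (P1 @ [b]) b"
      unfolding gpath_def by (cases P1) (auto simp: successively_append_iff simp flip: append_Cons)
    with ab(2) show False unfolding D_def by blast
  qed
  with P ab have "gpath E A x (P @ [b]) b"
    unfolding gpath_def by (auto simp: successively_append_iff)
  with ab(2) show False unfolding D_def by blast
qed

lemma successively_clique:
  assumes "distinct xs" "\<And>a b. a \<in> set xs \<Longrightarrow> b \<in> set xs \<Longrightarrow> a \<noteq> b \<Longrightarrow> E a b"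
  shows "successively E xs"
  using assms
proof (induction xs)
  case (Cons a xs)
  then show ?case by (cases xs) auto
qed simp

section \<open>Components, and connectivity as a cut condition\<close>

definition component :: "('a \<Rightarrow> 'a \<Rightarrow> bool) \<Rightarrow> 'a set \<Rightarrow> 'a \<Rightarrow> 'a set" where
  "component E A r = {z. (\<lambda>a b. a \<in> A \<and> b \<in> A \<and> E a b)\<^sup>*\<^sup>* r z}"

definition connected_on :: "('a \<Rightarrow> 'a \<Rightarrow> bool) \<Rightarrow> 'a set \<Rightarrow> bool" where
  "connected_on E R \<longleftrightarrow> (\<forall>D. D \<subseteq> R \<longrightarrow> D \<noteq> {} \<longrightarrow> D \<noteq> R \<longrightarrow> (\<exists>a\<in>D. \<exists>b\<in>R - D. E a b))"

lemma component_self: "r \<in> component E A r"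
  unfolding component_def by simp

lemma component_subset: "r \<in> A \<Longrightarrow> component E A r \<subseteq> A"
  unfolding component_def by (auto elim: rtranclp.cases)

lemma component_closed:
  "r \<in> A \<Longrightarrow> a \<in> component E A r \<Longrightarrow> b \<in> A \<Longrightarrow> E a b \<Longrightarrow> b \<in> component E A r"
  using component_subset[of r A E] unfolding component_def
  by (auto intro: rtranclp.rtrancl_into_rtrancl)

lemma component_least:
  assumes "r \<in> D" "\<And>a b. a \<in> D \<Longrightarrow> b \<in> A \<Longrightarrow> E a b \<Longrightarrow> b \<in> D"
  shows "component E A r \<subseteq> D"
proof
  fix z assume "z \<in> component E A r"
  then have "(\<lambda>a b. a \<in> A \<and> b \<in> A \<and> E a b)\<^sup>*\<^sup>* r z" unfolding component_def by simp
  then show "z \<in> D" by induction (use assms in auto)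
qed

lemma connected_on_component:
  assumes "symp E" "r \<in> A"
  shows "connected_on E (component E A r)"
  unfolding connected_on_def
proof (intro allI impI)
  let ?K = "component E A r"
  fix D assume D: "D \<subseteq> ?K" "D \<noteq> {}" "D \<noteq> ?K"
  show "\<exists>a\<in>D. \<exists>b\<in>?K - D. E a b"
  proof (rule ccontr)
    assume no: "\<not> ?thesis"
    have cl: "\<And>a b. a \<in> ?K \<Longrightarrow> b \<in> A \<Longrightarrow> E a b \<Longrightarrow> b \<in> ?K"
      using component_closed[OF assms(2)] by metis
    show False
    proof (cases "r \<in> D")
      case True
      then have "?K \<subseteq> D" by (rule component_least) (use no cl D in blast)
      with D show False by blast
    next
      case False
      then have "r \<in> ?K - D" using component_self by fast
      then have "?K \<subseteq> ?K - D"
        by (rule component_least) (use no cl assms(1) in \<open>blast dest: sympD\<close>)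
      with D show False by blast
    qed
  qed
qed

lemma component_disjoint:
  assumes "symp E" "r \<in> A" "s \<in> A" "s \<notin> component E A r"
  shows "component E A r \<inter> component E A s = {}"
proof (rule ccontr)
  assume "\<not> ?thesis"
  then obtain z where z: "z \<in> component E A r" "z \<in> component E A s" by blast
  have "component E A s \<subseteq> component E A s - component E A r"
    by (rule component_least)
      (use assms component_self component_closed[OF assms(2)] component_closed[OF assms(3)]
        component_subset[OF assms(3), of E] in \<open>fastforce dest: sympD\<close>)+
  with z show False by blast
qed

text \<open>Every set meeting \<open>U\<close> and avoiding the roots \<open>x\<close>, \<open>y\<close> has at least two outside neighbours.\<close>

definition rooted :: "('a \<Rightarrow> 'a \<Rightarrow> bool) \<Rightarrow> 'a set \<Rightarrow> 'a set \<Rightarrow> 'a \<Rightarrow> 'a \<Rightarrow> bool" where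
  "rooted E V U x y \<longleftrightarrow>
     (\<forall>D v. D \<subseteq> V - {x, y} \<longrightarrow> D \<inter> U \<noteq> {} \<longrightarrow> (\<exists>a\<in>D. \<exists>b\<in>V - D - {v}. E a b))"

lemma rootedD:
  assumes "rooted E V U x y" "D \<subseteq> V - {x, y}" "D \<inter> U \<noteq> {}"
  obtains a b where "a \<in> D" "b \<in> V" "b \<notin> D" "b \<noteq> v" "E a b"
proof -
  have "\<exists>a\<in>D. \<exists>b\<in>V - D - {v}. E a b" using assms unfolding rooted_def by simp
  then show ?thesis using that by blast
qed

text \<open>If \<open>y\<close> were out of reach, the part reached from \<open>v\<close> together
  with \<open>D\<close> would have \<open>x\<close> as its only outside neighbour, against
  \<open>rooted\<close>.\<close>

lemma rooted_escape:
  assumes root: "rooted E V U x y" and "x \<noteq> y" "y \<in> V"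
    and D: "D \<subseteq> V - {x, y}" "D \<inter> U \<noteq> {}" and v: "v \<in> V - D" "v \<noteq> x"
    and nb: "\<And>a b. a \<in> D \<Longrightarrow> b \<in> V \<Longrightarrow> E a b \<Longrightarrow> b \<in> D \<union> {x, v}"
  shows "\<exists>P. gpath E (V - D - {x}) v P y"
proof (rule exists_gpath)
  fix D1 assume D1: "v \<in> D1" "D1 \<subseteq> V - D - {x}" "y \<notin> D1"
  have "D1 \<union> D \<subseteq> V - {x, y}" "(D1 \<union> D) \<inter> U \<noteq> {}" using D D1 by blast+
  then obtain a b where ab: "a \<in> D1 \<union> D" "b \<in> V" "b \<notin> D1 \<union> D" "b \<noteq> x" "E a b"
    using rootedD[OF root] by metis
  have "a \<notin> D" using nb[of a b] ab D1(1) by auto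
  with ab show "\<exists>a\<in>D1. \<exists>b\<in>V - D - {x} - D1. E a b" by blast
qed (use assms in auto)

text \<open>
  A common generalisation of the rooted Erdos--Gallai path lemma and its weighted variants: the
  path passes through a vertex all of whose neighbours in \<open>U\<close> it contains. The idea is to descend
  into a smallest set \<open>D\<close> that is separated by \<open>x\<close> and one further vertex \<open>v\<close>.
\<close>

lemma rooted_path_dominating:
  assumes "finite V" "symp E" "x \<in> V" "y \<in> V" "x \<noteq> y" "U \<subseteq> V - {x, y}" "U \<noteq> {}"
    "rooted E V U x y"
  shows "\<exists>P w. gpath E V x P y \<and> w \<in> U \<and> w \<in> set P \<and> (\<forall>z\<in>U. E w z \<longrightarrow> z \<in> set P) \<and>
    (E w y \<longrightarrow> (\<exists>P1. P = P1 @ [w, y]))"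
  using assms
proof (induction "card V" arbitrary: V U x y rule: less_induct)
  case less
  note fin = less.prems(1) and sym = less.prems(2) and root = less.prems(8)
  \<comment> \<open>The pair \<open>x\<close>, \<open>v\<close> separates \<open>D\<close> from the
    rest. The choice \<open>D = V - {x, y}\<close>, \<open>v = y\<close> qualifies, so a smallest
    such \<open>D\<close> exists; its minimality makes the recursive instance rooted.\<close>
  define sep where "sep D v \<longleftrightarrow> D \<subseteq> V - {x, y} \<and> D \<inter> U \<noteq> {} \<and> v \<in> V - D \<and> v \<noteq> x \<and>
    (\<forall>a\<in>D. \<forall>b\<in>V. E a b \<longrightarrow> b \<in> D \<union> {x, v})" for D v
  have "sep (V - {x, y}) y" unfolding sep_def using less.prems by auto
  then have "\<exists>D. \<exists>v. sep D v" by blast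
  then obtain D where D: "\<exists>v. sep D v" and Dmin: "\<And>D'. \<exists>v. sep D' v \<Longrightarrow> card D \<le> card D'"
    using ex_has_least_nat[of "\<lambda>D. \<exists>v. sep D v" _ card] by metis
  obtain v where v: "sep D v" using D by blast
  have DV: "D \<subseteq> V - {x, y}" and DU: "D \<inter> U \<noteq> {}" and vV: "v \<in> V - D" "v \<noteq> x"
    and nb: "\<And>a b. a \<in> D \<Longrightarrow> b \<in> V \<Longrightarrow> E a b \<Longrightarrow> b \<in> D \<union> {x, v}"
    using v unfolding sep_def by auto
  have finD: "finite D" using DV fin finite_subset by blast
  \<comment> \<open>Either \<open>u\<close> is a proper second separator, against minimality of
    \<open>D\<close>, or it contributes nothing and \<open>x\<close> is the only outside neighbour
    of \<open>D'\<close>.\<close>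
  have small: False if small_prems: "D' \<subset> D" "D' \<inter> U \<noteq> {}"
    "\<And>a b. a \<in> D' \<Longrightarrow> b \<in> V \<Longrightarrow> E a b \<Longrightarrow> b \<in> D' \<union> {x, u}" for D' u
  proof (cases "u \<in> V - D' \<and> u \<noteq> x")
    case True
    then have "sep D' u" unfolding sep_def using small_prems DV by auto
    then show False using Dmin psubset_card_mono[OF finD small_prems(1)] by (meson leD)
  next
    case False
    have "D' \<subseteq> V - {x, y}" using DV small_prems by blast
    then obtain a b where "a \<in> D'" "b \<in> V" "b \<notin> D'" "b \<noteq> x" "E a b"
      using rootedD[OF root _ small_prems(2)] by metis
    then show False using small_prems(3)[of a b] False by blast
  qed
  \<comment> \<open>All outside neighbours of \<open>D\<close> are among \<open>x\<close> and
    \<open>v\<close>, and there are two of them; so \<open>x\<close> has a neighbour in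
    \<open>D\<close>.\<close>
  obtain x2 b0 where "x2 \<in> D" "b0 \<in> V" "b0 \<notin> D" "b0 \<noteq> v" "E x2 b0"
    using rootedD[OF root DV DU] by metis
  then have x2: "x2 \<in> D" "E x2 x" using nb by auto
  have xx2: "E x x2" using x2 sym by (blast dest: sympD)
  obtain P2 where P2: "gpath E (V - D - {x}) v P2 y"
    using rooted_escape[OF root less.prems(5,4) DV DU vV] nb by blast
  have xV: "x \<notin> D \<union> {v}" using DV vV by auto
  have glue: "gpath E V x (x # P1 @ tl P2) y" if "gpath E (D \<union> {v}) x2 P1 v" for P1
  proof -
    have "gpath E ((D \<union> {v}) \<union> (V - D - {x})) x2 (P1 @ tl P2) y"
      by (rule gpath_append_tl[OF that P2]) auto
    then have "gpath E (insert x ((D \<union> {v}) \<union> (V - D - {x}))) x (x # P1 @ tl P2) y"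
      by (rule gpath_Cons[where E = E]) (use xx2 xV in auto)
    then show ?thesis by (rule gpath_mono) (use DV vV less.prems in auto)
  qed
  show ?case
  proof (cases "U \<inter> D = {x2}")
    case True
    have dom: "z \<in> {x, x2, v}" if "z \<in> U" "E x2 z" for z
      using nb[OF x2(1), of z] that True less.prems(6) by blast
    show ?thesis
    proof (cases "E x2 y")
      case True2: True
      then have "y = v" using nb[OF x2(1), of y] less.prems DV by auto
      then show ?thesis using True2 True xx2 dom less.prems DV x2
        by (intro exI[of _ "[x, x2, y]"] exI[of _ x2]) (auto simp: gpath_def)
    next
      case False
      have "\<exists>P1. gpath E (D \<union> {v}) x2 P1 v"
      proof (rule exists_gpath)
        fix D2 assume D2: "x2 \<in> D2" "D2 \<subseteq> D \<union> {v}" "v \<notin> D2"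
        then have "D2 \<subseteq> V - {x, y}" "D2 \<inter> U \<noteq> {}" using DV True by blast+
        then obtain a b where "a \<in> D2" "b \<in> V" "b \<notin> D2" "b \<noteq> x" "E a b"
          using rootedD[OF root] by metis
        moreover from this have "b \<in> D \<union> {v}" using nb[of a b] D2 by blast
        ultimately show "\<exists>a\<in>D2. \<exists>b\<in>D \<union> {v} - D2. E a b" by blast
      qed (use x2 in auto)
      then obtain P1 where P1: "gpath E (D \<union> {v}) x2 P1 v" by blast
      show ?thesis using glue[OF P1] dom gpath_ends[OF P1] False True
        by (intro exI[of _ "x # P1 @ tl P2"] exI[of _ x2]) auto
    qed
  next
    case False
    \<comment> \<open>The recursive roots are \<open>x2\<close> and \<open>v\<close>. Taking
      \<open>x2\<close> out of \<open>U\<close> is harmless for domination, because a root lies on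
      the path anyway.\<close>
    let ?V = "D \<union> {v}" and ?U = "U \<inter> D - {x2}"
    have lt: "card ?V < card V"
      using xV less.prems(1,3) DV vV by (intro psubset_card_mono) auto
    have "rooted E ?V ?U x2 v"
      unfolding rooted_def
    proof (intro allI impI, rule ccontr)
      fix D' u assume D': "D' \<subseteq> ?V - {x2, v}" "D' \<inter> ?U \<noteq> {}"
        and no: "\<not> (\<exists>a\<in>D'. \<exists>b\<in>?V - D' - {u}. E a b)"
      have "D' \<subset> D" "D' \<inter> U \<noteq> {}" using D' x2 by blast+
      then show False
      proof (rule small)
        fix a b assume "a \<in> D'" "b \<in> V" "E a b"
        then show "b \<in> D' \<union> {x, u}" using nb[of a b] no D' by blast
      qed
    qed
    moreover have "?U \<noteq> {}" using False DU x2 by blast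
    moreover have "finite ?V" "x2 \<in> ?V" "v \<in> ?V" "x2 \<noteq> v" "?U \<subseteq> ?V - {x2, v}"
      using finD x2 vV by auto
    ultimately obtain P1 w where P1: "gpath E ?V x2 P1 v" and w: "w \<in> ?U" "w \<in> set P1"
      and dom: "\<forall>z\<in>?U. E w z \<longrightarrow> z \<in> set P1" and last: "E w v \<longrightarrow> (\<exists>P'. P1 = P' @ [w, v])"
      using less.hyps[OF lt _ sym, of x2 v ?U] by blast
    have "z \<in> set (x # P1 @ tl P2)" if "z \<in> U" "E w z" for z
      using nb[of w z] that w dom gpath_ends[OF P1] less.prems(6) by auto
    \<comment> \<open>A neighbour \<open>y\<close> of a vertex of \<open>D\<close> can only be
      \<open>v\<close>, and then nothing is appended behind the recursive path.\<close>
    moreover have "\<exists>P'. x # P1 @ tl P2 = P' @ [w, y]" if "E w y"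
    proof -
      have "y = v" using nb[of w y] that w less.prems DV by auto
      with last that obtain P' where "P1 = P' @ [w, v]" by blast
      moreover have "P2 = [y]" using gpath_self P2 \<open>y = v\<close> by metis
      ultimately show ?thesis using \<open>y = v\<close> by (intro exI[of _ "x # P'"]) simp
    qed
    ultimately show ?thesis using glue[OF P1] w
      by (intro exI[of _ "x # P1 @ tl P2"] exI[of _ w]) auto
  qed
qed

text \<open>Equality case of the rooted path bound, by induction on \<open>\<delta>\<close>: a
  neighbour \<open>x2\<close> of \<open>x\<close> replaces \<open>x\<close> as root for each
  component of \<open>R - {x2}\<close>. There the degrees drop by at most one (the neighbour
  \<open>x\<close>), and so does the bound on paths, since \<open>x\<close> can be put in
  front.\<close>

lemma clique_if_paths_short:
  assumes "finite R" "symp E" "irreflp E" "x \<notin> R" "y \<notin> R" "x \<noteq> y" "R \<noteq> {}" "connected_on E R"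
    "rooted E (R \<union> {x, y}) R x y"
    "\<And>r. r \<in> R \<Longrightarrow> \<delta> \<le> card {z \<in> R \<union> {x, y}. E r z}"
    "\<And>P. gpath E (R \<union> {x, y}) x P y \<Longrightarrow> length P \<le> \<delta> + 1"
  shows "card R + 1 = \<delta> \<and> (\<forall>a\<in>R. \<forall>b\<in>R \<union> {x, y}. a \<noteq> b \<longrightarrow> E a b)"
  using assms
proof (induction \<delta> arbitrary: R x rule: less_induct)
  case (less \<delta>)
  note fin = less.prems(1) and sym = less.prems(2) and irr = less.prems(3) and root = less.prems(9)
    and deg = less.prems(10) and short = less.prems(11)
  let ?V = "R \<union> {x, y}"
  have nself: "\<not> E a a" for a using irr by (simp add: irreflpD)
  obtain P w where "gpath E ?V x P y" "w \<in> R" "w \<in> set P"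
    using rooted_path_dominating[OF _ sym _ _ less.prems(6) _ less.prems(7) root]
    using fin less.prems(4,5) by blast
  moreover from this have "3 \<le> length P"
  proof -
    have "w \<noteq> x" "w \<noteq> y" using \<open>w \<in> R\<close> less.prems(4,5) by auto
    then have "card {x, w, y} = 3" using less.prems(6) by simp
    then show ?thesis
      using card_mono[of "set P" "{x, w, y}"] gpath_ends[OF \<open>gpath E ?V x P y\<close>] \<open>w \<in> set P\<close>
        card_length[of P] by auto
  qed
  ultimately have d2: "2 \<le> \<delta>" using short by fastforce
  have "R \<inter> R \<noteq> {}" "R \<subseteq> ?V - {x, y}" using less.prems(4,5,7) by auto
  then obtain x2 b0 where "x2 \<in> R" "b0 \<in> ?V" "b0 \<notin> R" "b0 \<noteq> y" "E x2 b0"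
    using rootedD[OF root] by metis
  then have x2: "x2 \<in> R" "E x2 x" "E x x2" using sym by (auto dest: sympD)
  \<comment> \<open>A violating \<open>D\<close> is separated by \<open>x\<close> and
    \<open>v\<close>. The dominating path through \<open>D\<close> contains some \<open>w\<close>
    with all its neighbours, hence at least \<open>\<delta> + 1\<close> vertices, and still has to
    continue from \<open>v\<close> to \<open>y\<close>.\<close>
  have root2: "\<exists>a\<in>D. \<exists>b\<in>(R \<union> {y}) - D - {v}. E a b" if D: "D \<subseteq> R - {x2}" "D \<noteq> {}" for D v
  proof (rule ccontr)
    assume no: "\<not> ?thesis"
    have nb: "b \<in> D \<union> {x, v}" if "a \<in> D" "b \<in> ?V" "E a b" for a b using no that by blast
    have D': "D \<subseteq> ?V - {x, y}" "D \<inter> R \<noteq> {}" using D less.prems(4,5) by auto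
    obtain a b where "a \<in> D" "b \<in> ?V" "b \<notin> D" "b \<noteq> x" "E a b" using rootedD[OF root D'] by metis
    then have vV: "v \<in> ?V - D" "v \<noteq> x" using nb by blast+
    \<comment> \<open>Connectedness of \<open>R\<close> puts \<open>v\<close> into \<open>R\<close>,
      so the continuation to \<open>y\<close> costs at least one more vertex.\<close>
    obtain a b where "a \<in> D" "b \<in> R - D" "E a b"
      using less.prems(8) D x2 unfolding connected_on_def by blast
    then have vy: "v \<noteq> y" using nb[of a b] less.prems(4,5) by auto
    let ?W = "D \<union> {x, v}"
    have "rooted E ?W D x v"
      unfolding rooted_def
    proof (intro allI impI)
      fix D2 u assume D2: "D2 \<subseteq> ?W - {x, v}" "D2 \<inter> D \<noteq> {}"
      then have "D2 \<subseteq> ?V - {x, y}" "D2 \<inter> R \<noteq> {}" using D' by blast+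
      then obtain a b where "a \<in> D2" "b \<in> ?V" "b \<notin> D2" "b \<noteq> u" "E a b" using rootedD[OF root] by metis
      moreover from this have "b \<in> ?W" using nb[of a b] D2 by blast
      ultimately show "\<exists>a\<in>D2. \<exists>b\<in>?W - D2 - {u}. E a b" by blast
    qed
    moreover have "finite ?W" "x \<noteq> v" "D \<subseteq> ?W - {x, v}"
      using fin D finite_subset vV D' by auto
    ultimately obtain P w where P: "gpath E ?W x P v" and w: "w \<in> D" "w \<in> set P"
      "\<forall>z\<in>D. E w z \<longrightarrow> z \<in> set P"
      using rooted_path_dominating[of ?W E x v D] sym D by blast
    have "insert w {z \<in> ?V. E w z} \<subseteq> set P" using w nb[OF w(1)] gpath_ends[OF P] by blast
    then have "card (insert w {z \<in> ?V. E w z}) \<le> length P"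
      by (meson List.finite_set card_length card_mono le_trans)
    then have long: "\<delta> + 1 \<le> length P" using deg[of w] w D fin nself by auto
    obtain P2 where P2: "gpath E (?V - D - {x}) v P2 y"
      using rooted_escape[OF root less.prems(6) _ D' vV] nb by blast
    then have "length P2 \<ge> 2" using vy unfolding gpath_def by (cases P2; cases "tl P2") auto
    moreover have "gpath E (?W \<union> (?V - D - {x})) x (P @ tl P2) y"
      by (rule gpath_append_tl[OF P P2]) auto
    then have "gpath E ?V x (P @ tl P2) y" by (rule gpath_mono) (use D vV in auto)
    then have "length (P @ tl P2) \<le> \<delta> + 1" using short by blast
    ultimately show False using long by simp
  qed
  let ?K = "component E (R - {x2})"
  have comp: "card (?K r) + 2 = \<delta> \<and> (\<forall>a\<in>?K r. \<forall>b\<in>?K r \<union> {x, x2, y}. a \<noteq> b \<longrightarrow> E a b)"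
    if r: "r \<in> R - {x2}" for r
  proof -
    have sub: "?K r \<subseteq> R - {x2}" by (rule component_subset[OF r])
    have fK: "finite (?K r)" using sub fin finite_subset by blast
    have nbK: "b \<in> ?K r \<union> {x, x2, y}" if "a \<in> ?K r" "b \<in> ?V" "E a b" for a b
      using component_closed[OF r, of a E b] that by blast
    have "rooted E (?K r \<union> {x2, y}) (?K r) x2 y"
      unfolding rooted_def
    proof (intro allI impI)
      fix D v assume D: "D \<subseteq> ?K r \<union> {x2, y} - {x2, y}" "D \<inter> ?K r \<noteq> {}"
      then have "D \<subseteq> R - {x2}" "D \<noteq> {}" using sub by blast+
      then obtain a b where "a \<in> D" "b \<in> (R \<union> {y}) - D - {v}" "E a b" using root2 by meson
      moreover from this have "b \<in> ?K r \<union> {x2, y}" using nbK[of a b] D less.prems(4,6) by auto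
      ultimately show "\<exists>a\<in>D. \<exists>b\<in>?K r \<union> {x2, y} - D - {v}. E a b" by blast
    qed
    moreover have "\<delta> - 1 \<le> card {z \<in> ?K r \<union> {x2, y}. E q z}" if q: "q \<in> ?K r" for q
    proof -
      have "{z \<in> ?V. E q z} \<subseteq> insert x {z \<in> ?K r \<union> {x2, y}. E q z}" using nbK[OF q] by blast
      then have "card {z \<in> ?V. E q z} \<le> card (insert x {z \<in> ?K r \<union> {x2, y}. E q z})"
        using fK by (intro card_mono) auto
      also have "\<dots> \<le> Suc (card {z \<in> ?K r \<union> {x2, y}. E q z})" by (rule card_insert_le_m1) auto
      finally show ?thesis using deg[of q] q sub by auto
    qed
    moreover have "length P \<le> \<delta> - 1 + 1" if P: "gpath E (?K r \<union> {x2, y}) x2 P y" for P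
    proof -
      have "gpath E (insert x (?K r \<union> {x2, y})) x (x # P) y"
        by (rule gpath_Cons[OF P x2(3)]) (use less.prems(4,6) sub x2 in auto)
      then have "gpath E ?V x (x # P) y" by (rule gpath_mono) (use sub x2 in auto)
      then show ?thesis using short d2 by fastforce
    qed
    moreover have "?K r \<noteq> {}" using component_self by fast
    moreover have "x2 \<notin> ?K r" "y \<notin> ?K r" "x2 \<noteq> y" using sub less.prems(5) x2 by auto
    moreover have "\<delta> - 1 < \<delta>" using d2 by simp
    ultimately have IH: "card (?K r) + 1 = \<delta> - 1 \<and>
      (\<forall>a\<in>?K r. \<forall>b\<in>?K r \<union> {x2, y}. a \<noteq> b \<longrightarrow> E a b)"
      by (intro less.IH[OF _ fK sym irr _ _ _ _ connected_on_component[OF sym r]])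
    \<comment> \<open>Without \<open>x\<close> there are only \<open>\<delta> - 3\<close> neighbours
      in the component and the two roots, one less than the degree requires.\<close>
    have "E q x" if q: "q \<in> ?K r" for q
    proof (rule ccontr)
      assume "\<not> E q x"
      then have "{z \<in> ?V. E q z} \<subseteq> (?K r \<union> {x2, y}) - {q}" using nbK[OF q] nself by blast
      then have "card {z \<in> ?V. E q z} \<le> card ((?K r \<union> {x2, y}) - {q})"
        using fK by (intro card_mono) auto
      also have "\<dots> = card (?K r \<union> {x2, y}) - 1" using q fK by (intro card_Diff_singleton) auto
      finally have "card {z \<in> ?V. E q z} \<le> card (?K r \<union> {x2, y}) - 1" .
      moreover have "card (?K r \<union> {x2, y}) \<le> card (?K r) + card {x2, y}" by (rule card_Un_le)
      moreover have "card {x2, y} \<le> 2" by (simp add: card_insert_if)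
      moreover have "\<delta> \<le> card {z \<in> ?V. E q z}" using deg[of q] q sub by blast
      ultimately show False using IH by linarith
    qed
    then show ?thesis using IH d2 by auto
  qed
  \<comment> \<open>Two components could be traversed one after the other via \<open>x2\<close>: a
    path with \<open>2 \<delta> - 1\<close> vertices, too many as \<open>\<delta> \<ge> 3\<close>
    for nonempty components.\<close>
  have one: "?K r = R - {x2}" if r: "r \<in> R - {x2}" for r
  proof (rule ccontr)
    assume "\<not> ?thesis"
    then obtain s where s: "s \<in> R - {x2}" "s \<notin> ?K r" using component_subset[OF r, of E] by blast
    have sub: "?K r \<subseteq> R - {x2}" "?K s \<subseteq> R - {x2}"
      by (rule component_subset[OF r], rule component_subset[OF s(1)])
    then have fK: "finite (?K r)" "finite (?K s)" using fin finite_subset by blast+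
    obtain k1 k2 where k: "set k1 = ?K r" "distinct k1" "set k2 = ?K s" "distinct k2"
      using fK finite_distinct_list by metis
    have len: "length k1 + 2 = \<delta>" "length k2 + 2 = \<delta>"
      using comp[OF r] comp[OF s(1)] distinct_card[OF k(2)] distinct_card[OF k(4)] k(1,3) by auto
    have ne: "k1 \<noteq> []" "k2 \<noteq> []"
      using k(1,3) component_self[of r E "R - {x2}"] component_self[of s E "R - {x2}"] by auto
    have disj: "?K r \<inter> ?K s = {}" using component_disjoint[OF sym r s(1)] s(2) by blast
    have succ: "successively E k1" "successively E k2"
      using comp[OF r] comp[OF s(1)] k by (auto intro!: successively_clique)
    have ends: "hd k1 \<in> ?K r" "last k1 \<in> ?K r" "hd k2 \<in> ?K s" "last k2 \<in> ?K s"
      using hd_in_set[OF ne(1)] hd_in_set[OF ne(2)] last_in_set[OF ne(1)] last_in_set[OF ne(2)] k by auto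
    have edges: "E x (hd k1)" "E (last k1) x2" "E x2 (hd k2)" "E (last k2) y"
    proof -
      have "E a b" if "a \<in> ?K q" "q \<in> {r, s}" "b \<in> {x, x2, y}" for a b q
      proof -
        have q: "q \<in> R - {x2}" using that(2) r s(1) by blast
        then have "a \<in> R - {x2}" using component_subset[OF q, of E] that(1) by blast
        then have "a \<noteq> b" using that(3) less.prems(4,5) by blast
        then show ?thesis using comp[OF q] that(1,3) by blast
      qed
      note adj = this
      show "E x (hd k1)" by (rule sympD[OF sym adj[OF ends(1)]]) auto
      show "E (last k1) x2" by (rule adj[OF ends(2)]) auto
      show "E x2 (hd k2)" by (rule sympD[OF sym adj[OF ends(3)]]) auto
      show "E (last k2) y" by (rule adj[OF ends(4)]) auto
    qed
    have "gpath E ?V x (x # k1 @ x2 # k2 @ [y]) y"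
      unfolding gpath_def using k ne succ edges disj sub less.prems(4-6) x2
      by (auto simp: successively_append_iff successively_Cons)
    then have "length (x # k1 @ x2 # k2 @ [y]) \<le> \<delta> + 1" using short by blast
    then show False using len ne by (cases k1) auto
  qed
  have comp': "card R + 1 = \<delta> \<and> (\<forall>a\<in>R - {x2}. \<forall>b\<in>?V. a \<noteq> b \<longrightarrow> E a b)"
  proof (cases "R = {x2}")
    case True
    have "{z \<in> ?V. E x2 z} \<subseteq> {x, y}" using True nself by auto
    then have "card {z \<in> ?V. E x2 z} \<le> card {x, y}" by (intro card_mono) auto
    then have "\<delta> \<le> 2" using deg[OF x2(1)] less.prems(6) by simp
    then show ?thesis using True d2 by simp
  next
    case False
    then obtain r where r: "r \<in> R - {x2}" using x2 by blast
    have K: "card (R - {x2}) + 2 = \<delta>"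
      "\<forall>a\<in>R - {x2}. \<forall>b\<in>(R - {x2}) \<union> {x, x2, y}. a \<noteq> b \<longrightarrow> E a b"
      using comp[OF r] unfolding one[OF r] by (rule conjunct1, rule conjunct2)
    have "card R = Suc (card (R - {x2}))" by (rule card.remove[OF fin x2(1)])
    then have "card R + 1 = \<delta>" using K(1) by simp
    moreover have "(R - {x2}) \<union> {x, x2, y} = ?V" using x2(1) by blast
    then have "\<forall>a\<in>R - {x2}. \<forall>b\<in>?V. a \<noteq> b \<longrightarrow> E a b" using K(2) by simp
    ultimately show ?thesis by blast
  qed
  have "E x2 b" if "b \<in> ?V" "b \<noteq> x2" for b
  proof (rule ccontr)
    assume "\<not> E x2 b"
    then have "{z \<in> ?V. E x2 z} \<subseteq> ?V - {b, x2}" using nself by blast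
    then have "card {z \<in> ?V. E x2 z} \<le> card (?V - {b, x2})" using fin by (intro card_mono) auto
    also have "\<dots> = card ?V - 2" using that x2 fin by (subst card_Diff_subset) auto
    also have "card ?V = card R + 2" using fin less.prems(4-6) by simp
    finally show False using comp' deg[OF x2(1)] by simp
  qed
  with comp' show ?case by blast
qed

subsection \<open>Links between vertices of a locally maximal cycle\<close>

text \<open>The cycle is indexed by all integers modulo \<open>c\<close>, so arcs and shifts may
  wrap around. In \<open>maximal\<close>, a path inside the cycle's vertex set and an ear outside
  close up to a cycle with two boundary edges, which is how local maximality is used. Taking
  \<open>v\<close> outside \<open>V\<close> in \<open>two_conn\<close> gives plain
  connectivity.\<close>

locale cycle_frame =
  fixes E :: "'a \<Rightarrow> 'a \<Rightarrow> bool" and V :: "'a set" and f :: "int \<Rightarrow> 'a" and c :: nat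
  assumes finV: "finite V" and sym: "symp E" and irr: "irreflp E" and c3: "3 \<le> c"
    and f_eq: "f i = f j \<longleftrightarrow> i mod int c = j mod int c"
    and f_V: "range f \<subseteq> V"
    and f_adj: "E (f i) (f (i + 1))"
    and two_conn: "D \<subseteq> V - {v} \<Longrightarrow> D \<noteq> {} \<Longrightarrow> D \<noteq> V - {v} \<Longrightarrow> \<exists>a\<in>D. \<exists>b\<in>V - D - {v}. E a b"
    and maximal: "u \<in> range f \<Longrightarrow> v \<in> range f \<Longrightarrow> u \<noteq> v \<Longrightarrow> gpath E (range f) u P v \<Longrightarrow>
      rs \<noteq> [] \<Longrightarrow> distinct rs \<Longrightarrow> set rs \<subseteq> V - range f \<Longrightarrow> successively E rs \<Longrightarrow>
      E u (hd rs) \<Longrightarrow> E (last rs) v \<Longrightarrow> length P + length rs \<le> c"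
begin

abbreviation "Cy \<equiv> range f"
abbreviation "Out \<equiv> V - Cy"

lemma E_sym: "E a b \<Longrightarrow> E b a"
  using sym by (blast dest: sympD)

lemma E_irr: "\<not> E a a"
  using irr by (simp add: irreflpD)

text \<open>Ears. A lower bound on the length makes the notion monotone in \<open>b\<close>, and
  \<open>rs \<noteq> []\<close> excludes a mere chord even for \<open>b = 0\<close>.\<close>

definition linked :: "'a \<Rightarrow> 'a \<Rightarrow> nat \<Rightarrow> bool" where
  "linked u v b \<longleftrightarrow> (\<exists>rs. b \<le> length rs \<and> rs \<noteq> [] \<and> distinct rs \<and> set rs \<subseteq> Out \<and> successively E rs \<and>
     E u (hd rs) \<and> E (last rs) v)"

lemma linked_sym: "linked u v b \<Longrightarrow> linked v u b"
proof -
  assume "linked u v b"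
  then obtain rs where "b \<le> length rs" "rs \<noteq> []" "distinct rs" "set rs \<subseteq> Out" "successively E rs"
    "E u (hd rs)" "E (last rs) v" unfolding linked_def by blast
  then show ?thesis unfolding linked_def
    by (intro exI[of _ "rev rs"]) (auto simp: hd_rev last_rev intro: E_sym elim!: successively_mono)
qed

lemma linked_mono: "linked u v b \<Longrightarrow> b' \<le> b \<Longrightarrow> linked u v b'"
  unfolding linked_def by (meson le_trans)

lemma linked_bound:
  assumes "linked u v b" "u \<in> Cy" "v \<in> Cy" "u \<noteq> v" "gpath E Cy u P v"
  shows "length P + b \<le> c"
  using assms maximal unfolding linked_def by (meson add_left_mono le_trans)

lemma f_periodic: "f (i + int c) = f i"
  by (simp add: f_eq)

lemma f_inj: "inj_on f {a..<a + int c}"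
proof (rule inj_onI)
  fix i j assume *: "i \<in> {a..<a + int c}" "j \<in> {a..<a + int c}" "f i = f j"
  then have "int c dvd i - j" using f_eq mod_eq_dvd_iff by blast
  moreover have "\<bar>i - j\<bar> < int c" using * by auto
  ultimately show "i = j" using zdvd_not_zless[of "\<bar>i - j\<bar>" "int c"] by (cases "i = j") auto
qed

lemma f_neq: "i < j \<Longrightarrow> j < i + int c \<Longrightarrow> f i \<noteq> f j"
  using f_inj[of i] by (auto dest: inj_onD)

lemma f_window:
  assumes "z \<in> Cy" obtains i where "a \<le> i" "i < a + int c" "f i = z"
proof -
  obtain j where j: "z = f j" using assms by blast
  let ?i = "a + (j - a) mod int c"
  have "f ?i = z" unfolding j f_eq by (simp add: mod_simps)
  moreover have "a \<le> ?i" "?i < a + int c" using c3 by auto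
  ultimately show ?thesis using that by blast
qed

lemma Cy_window: "Cy = f ` {a..<a + int c}"
  using f_window[of _ a] by (auto simp: image_iff) (metis atLeastLessThan_iff)

lemma card_Cy: "card Cy = c"
  using card_image[OF f_inj[of 0]] Cy_window[of 0] by simp

lemma finCy: "finite Cy"
  using finV f_V finite_subset by blast

lemma successively_upto: "successively (\<lambda>i j. j = i + 1) [a..b]"
  by (subst successively_conv_nth) auto

lemma arc_succ: "successively E (map f [a..b])"
  unfolding successively_map using successively_upto[of a b] by (rule successively_mono) (auto simp: f_adj)

lemma arc_succ_rev: "successively E (rev (map f [a..b]))"
  using arc_succ[of a b] by (auto elim!: successively_mono intro: E_sym)

lemma distinct_map_f:
  assumes "distinct xs" "set xs \<subseteq> {a..<a + int c}"
  shows "distinct (map f xs)"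
  using assms f_inj[of a] by (auto simp: distinct_map intro: inj_on_subset)

lemma upto_ends: "a \<le> b \<Longrightarrow> hd [a..b] = a \<and> last [a..b] = b \<and> [a..b] \<noteq> []" for a b :: int
proof -
  assume ab: "a \<le> b"
  have "hd [a..b] = a" "[a..b] \<noteq> []" by (simp_all add: upto_rec1[OF ab])
  moreover have "last [a..b] = b" by (simp add: upto_rec2[OF ab])
  ultimately show ?thesis by blast
qed

text \<open>Replacing either arc between the two vertices by the ear must not lengthen the
  cycle.\<close>

lemma linked_dist:
  assumes "i < j" "j < i + int c" "linked (f i) (f j) b"
  shows "int b + 1 \<le> j - i" "int b + 1 \<le> i + int c - j"
proof -
  have ne: "f i \<noteq> f j" using f_neq assms by blast
  have "hd [i..j] = i" "last [i..j] = j" "[i..j] \<noteq> []"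
    using upto_ends[of i j] assms by auto
  moreover have "distinct (map f [i..j])"
    by (rule distinct_map_f[where a = i]) (use assms in auto)
  ultimately have "gpath E Cy (f i) (map f [i..j]) (f j)"
    unfolding gpath_def using arc_succ by (auto simp: hd_map last_map)
  from linked_bound[OF assms(3) _ _ ne this] show "int b + 1 \<le> i + int c - j" using assms by simp
  let ?k = "i + int c"
  have "hd [j..?k] = j" "last [j..?k] = ?k" "[j..?k] \<noteq> []"
    using upto_ends[of j ?k] assms by auto
  moreover have "distinct (map f [j..?k])"
    by (rule distinct_map_f[where a = j]) (use assms in auto)
  ultimately have "gpath E Cy (f j) (map f [j..?k]) (f i)"
    unfolding gpath_def using arc_succ f_periodic by (auto simp: hd_map last_map)
  from linked_bound[OF linked_sym[OF assms(3)] _ _ ne[symmetric] this]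
  show "int b + 1 \<le> j - i" using assms by simp
qed

text \<open>The chord would allow the path from \<open>f i\<close> backwards to
  \<open>f (j + l)\<close>, across to \<open>f (i + k)\<close>, and forwards to \<open>f j\<close>.
  It misses only \<open>k + l - 2 < b\<close> vertices of the cycle, so the ear closes it to a
  longer one.\<close>

lemma linked_nonadj:
  assumes "i < j" "j < i + int c" "linked (f i) (f j) b" "1 \<le> k" "1 \<le> l" "k + l \<le> int b + 1"
  shows "\<not> E (f (i + k)) (f (j + l))"
proof
  assume e: "E (f (i + k)) (f (j + l))"
  have ne: "f i \<noteq> f j" using f_neq assms by blast
  note d = linked_dist[OF assms(1-3)]
  let ?A = "[j + l..i + int c]" and ?B = "[i + k..j]"
  let ?P = "rev (map f ?A) @ map f ?B"
  have A: "hd ?A = j + l" "last ?A = i + int c" "?A \<noteq> []"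
    using upto_ends[of "j + l" "i + int c"] assms d by auto
  have B: "hd ?B = i + k" "last ?B = j" "?B \<noteq> []"
    using upto_ends[of "i + k" j] assms d by auto
  have "distinct (map f (?A @ ?B))"
    by (rule distinct_map_f[where a = "i + 1"]) (use assms d in auto)
  then have "distinct ?P" by auto
  moreover have "successively E ?P"
    using arc_succ_rev[of "j + l" "i + int c"] arc_succ[of "i + k" j] e A B
    by (simp add: successively_append_iff last_rev hd_map E_sym del: successively_rev)
  ultimately have "gpath E Cy (f i) ?P (f j)"
    unfolding gpath_def using A B f_periodic by (auto simp: hd_rev last_map)
  from linked_bound[OF assms(3) _ _ ne this] show False using assms d by simp
qed

lemma f_shift: "f p = f q \<Longrightarrow> f (p + k) = f (q + k)"
  unfolding f_eq by (metis mod_add_left_eq)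

lemma card_shift:
  assumes "A \<subseteq> Cy"
  shows "card ((\<lambda>p. f (p + k)) ` {p. f p \<in> A}) = card A"
proof -
  let ?W = "{p \<in> {0..<int c}. f p \<in> A}"
  have "(\<lambda>p. f (p + k)) ` {p. f p \<in> A} = (\<lambda>p. f (p + k)) ` ?W"
  proof (rule equalityI; rule subsetI)
    fix x assume "x \<in> (\<lambda>p. f (p + k)) ` {p. f p \<in> A}"
    then obtain p where p: "x = f (p + k)" "f p \<in> A" by blast
    obtain q where q: "0 \<le> q" "q < 0 + int c" "f q = f p" by (rule f_window[of "f p" 0]) auto
    have "x = f (q + k)" using p(1) f_shift[OF q(3)] by simp
    then show "x \<in> (\<lambda>p. f (p + k)) ` ?W" by (rule image_eqI) (use p q in simp)
  qed blast
  moreover have "inj_on (\<lambda>p. f (p + k)) ?W"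
  proof (rule inj_onI)
    fix i j assume "i \<in> ?W" "j \<in> ?W" "f (i + k) = f (j + k)"
    then have "i + k = j + k" by (intro inj_onD[OF f_inj[of k]]) auto
    then show "i = j" by simp
  qed
  moreover have "f ` ?W = A"
  proof (rule equalityI; rule subsetI)
    fix x assume x: "x \<in> A"
    obtain q where "0 \<le> q" "q < 0 + int c" "f q = x" by (rule f_window[of x 0]) (use x assms in auto)
    then show "x \<in> f ` ?W" using x by (intro image_eqI[of _ _ q]) auto
  qed auto
  moreover have "inj_on f ?W" by (rule inj_on_subset[OF f_inj[of 0]]) auto
  ultimately show ?thesis using card_image[of "\<lambda>p. f (p + k)" ?W] card_image[of f ?W] by simp
qed

text \<open>Records how a vertex \<open>w\<close> outside is attached: \<open>g\<close> counts its
  outside neighbours, \<open>N\<close> contains its neighbours on the cycle. All long ears start at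
  the port \<open>f i0\<close>; other pairs are linked only through \<open>w\<close> itself, whence
  the bound 1.\<close>

definition ported :: "int \<Rightarrow> 'a set \<Rightarrow> nat \<Rightarrow> bool" where
  "ported i0 N g \<longleftrightarrow> f i0 \<in> N \<and> N \<subseteq> Cy \<and> 2 \<le> card N \<and> (\<forall>z\<in>N - {f i0}. linked (f i0) z (g + 1)) \<and>
     (\<forall>z\<in>N. \<forall>z'\<in>N. z \<noteq> z' \<longrightarrow> linked z z' 1)"

text \<open>Running the cycle backwards turns facts about successors into facts about
  predecessors.\<close>

lemma frame_rev: "cycle_frame E V (\<lambda>i. f (- i)) c"
proof -
  have r: "range (\<lambda>i. f (- i)) = Cy" by (metis fun.set_map surj_uminus image_image)
  show ?thesis
  proof (unfold_locales, unfold r)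
    show "f (- i) = f (- j) \<longleftrightarrow> i mod int c = j mod int c" for i j
      unfolding f_eq mod_eq_dvd_iff using dvd_diff_commute[of "int c" i j] by simp
    show "E (f (- i)) (f (- (i + 1)))" for i using E_sym[OF f_adj[of "- (i + 1)"]] by simp
  qed (fact finV sym irr c3 f_V | (rule two_conn; assumption) | (rule maximal; assumption))+
qed

end

section \<open>Counting the cycle vertices outside a large clique behind the ports\<close>

locale clique_frame = cycle_frame +
  fixes Q :: "'a set" and d :: nat
  assumes QC: "Q \<subseteq> range f" and Qclique: "\<And>a b. a \<in> Q \<Longrightarrow> b \<in> Q \<Longrightarrow> a \<noteq> b \<Longrightarrow> E a b"
    and cardQ: "card Q + d = c + 1" and d_small: "2 * d < c"
begin

abbreviation "X \<equiv> Cy - Q"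

lemma cardX: "card X + 1 = d"
proof -
  have "card X = card Cy - card Q" by (rule card_Diff_subset[OF finite_subset[OF QC finCy] QC])
  moreover have "card Q \<le> card Cy" by (rule card_mono[OF finCy QC])
  ultimately show ?thesis using cardQ d_small card_Cy by arith
qed

text \<open>The length of the run of vertices of \<open>X - N\<close> directly behind
  \<open>f i\<close>; it is finite because \<open>Q\<close> is nonempty.\<close>

definition stop :: "'a set \<Rightarrow> int \<Rightarrow> nat" where
  "stop N i = (LEAST l. f (i + 1 + int l) \<in> Q \<union> N)"

lemma Q_ne: "Q \<noteq> {}"
  using cardQ d_small by auto

lemma stop_ex: "\<exists>l. f (i + 1 + int l) \<in> Q"
proof -
  obtain q where q: "q \<in> Q" using Q_ne by blast
  have "q \<in> Cy" by (rule subsetD[OF QC q])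
  then obtain j where "i + 1 \<le> j" "f j = q" by (rule f_window)
  with q show ?thesis by (intro exI[of _ "nat (j - (i + 1))"]) auto
qed

lemma stop_in: "f (i + 1 + int (stop N i)) \<in> Q \<union> N"
  unfolding stop_def by (rule LeastI_ex) (use stop_ex in blast)

lemma stop_le: "i < j \<Longrightarrow> f j \<in> Q \<union> N \<Longrightarrow> i + int (stop N i) < j"
proof -
  assume *: "i < j" "f j \<in> Q \<union> N"
  then have "f (i + 1 + int (nat (j - i - 1))) \<in> Q \<union> N" by simp
  then have "stop N i \<le> nat (j - i - 1)" unfolding stop_def by (rule Least_le)
  then show ?thesis using * by auto
qed

lemma before_stop: "i < j \<Longrightarrow> j \<le> i + int (stop N i) \<Longrightarrow> f j \<in> X - N"
  using stop_le[of i j N] by auto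

text \<open>Representatives are taken from the period starting at the port, so that
  \<open>i0\<close> is the least index and \<open>i0 + c\<close> its next copy.\<close>

definition window :: "int \<Rightarrow> 'a set \<Rightarrow> int set" where
  "window i0 N = {i \<in> {i0..<i0 + int c}. f i \<in> N}"

lemma window_card: "N \<subseteq> Cy \<Longrightarrow> card (window i0 N) = card N"
proof -
  assume N: "N \<subseteq> Cy"
  have "f ` window i0 N = N" unfolding window_def using N Cy_window[of i0] by auto
  moreover have "inj_on f (window i0 N)"
    using f_inj[of i0] by (rule inj_on_subset) (auto simp: window_def)
  ultimately show ?thesis using card_image by metis
qed

lemma window_fin: "finite (window i0 N)"
  by (rule finite_subset[of _ "{i0..<i0 + int c}"]) (auto simp: window_def)

context
  fixes i0 N g
  assumes P: "ported i0 N g"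
begin

lemma N_Cy: "N \<subseteq> Cy" and i0_win: "i0 \<in> window i0 N"
  using P c3 unfolding ported_def window_def by auto

lemma port_link: "j \<in> window i0 N \<Longrightarrow> j \<noteq> i0 \<Longrightarrow> linked (f i0) (f j) (g + 1)"
proof -
  assume j: "j \<in> window i0 N" "j \<noteq> i0"
  then have "f i0 \<noteq> f j" using f_neq[of i0 j] unfolding window_def by auto
  with j P show ?thesis unfolding ported_def window_def by auto
qed

lemma port_dist:
  assumes "j \<in> window i0 N" "j \<noteq> i0"
  shows "i0 + int g + 2 \<le> j" "j + int g + 2 \<le> i0 + int c"
  using linked_dist[OF _ _ port_link[OF assms]] assms unfolding window_def by auto

lemma pair_link: "i \<in> window i0 N \<Longrightarrow> j \<in> window i0 N \<Longrightarrow> i < j \<Longrightarrow> linked (f i) (f j) 1"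
  using P f_neq[of i j] unfolding ported_def window_def by auto

lemma stop_window:
  assumes "i \<in> window i0 N" "j \<in> window i0 N" "i < j"
  shows "i + int (stop N i) < j"
  using assms stop_le[of i j N] unfolding window_def by auto

lemma stop_end:
  assumes "i \<in> window i0 N"
  shows "i + int (stop N i) < i0 + int c"
  using assms stop_le[of i "i0 + int c" N] i0_win f_periodic[of i0] unfolding window_def by auto

lemma runs_inj: "inj_on f (\<Union>i\<in>window i0 N. {i + 1..i + int (stop N i)})"
proof (rule inj_on_subset[OF f_inj[of i0]], safe)
  fix i j assume i: "i \<in> window i0 N" and j: "j \<in> {i + 1..i + int (stop N i)}"
  have "i0 \<le> i" using i unfolding window_def by simp
  then show "j \<in> {i0..<i0 + int c}" using stop_end[OF i] j by simp
qed

lemma runs_sub: "f ` (\<Union>i\<in>window i0 N. {i + 1..i + int (stop N i)}) \<subseteq> X - N"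
proof (rule image_subsetI, erule UN_E)
  fix j i assume "j \<in> {i + 1..i + int (stop N i)}"
  then show "f j \<in> X - N" by (intro before_stop[of i j N]) auto
qed

lemma runs_card:
  "card (f ` (\<Union>i\<in>window i0 N. {i + 1..i + int (stop N i)})) = (\<Sum>i\<in>window i0 N. stop N i)"
proof -
  have "card (\<Union>i\<in>window i0 N. {i + 1..i + int (stop N i)}) =
    (\<Sum>i\<in>window i0 N. card {i + 1..i + int (stop N i)})"
  proof (rule card_UN_disjoint)
    show "\<forall>i\<in>window i0 N. \<forall>j\<in>window i0 N. i \<noteq> j \<longrightarrow>
      {i + 1..i + int (stop N i)} \<inter> {j + 1..j + int (stop N j)} = {}"
    proof (intro ballI impI)
      fix i j assume "i \<in> window i0 N" "j \<in> window i0 N" "i \<noteq> j"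
      then show "{i + 1..i + int (stop N i)} \<inter> {j + 1..j + int (stop N j)} = {}"
        using stop_window[of i j] stop_window[of j i] by (cases "i < j") auto
    qed
  qed (auto simp: window_fin)
  then show ?thesis using card_image[OF runs_inj] by simp
qed

lemma sum_stop_le: "(\<Sum>i\<in>window i0 N. stop N i) \<le> card (X - N)"
  unfolding runs_card[symmetric] using runs_sub finCy by (intro card_mono) auto

text \<open>Linked vertices are never consecutive on the cycle, so an empty run cannot end at a
  vertex of \<open>N\<close>.\<close>

lemma zero_stop:
  assumes "i \<in> window i0 N" "stop N i = 0" shows "f (i + 1) \<in> Q"
proof (rule ccontr)
  assume "f (i + 1) \<notin> Q"
  then have N: "f (i + 1) \<in> N" using stop_in[of i N] assms(2) by simp
  show False
  proof (cases "i + 1 < i0 + int c")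
    case True
    then have "i + 1 \<in> window i0 N" using N assms unfolding window_def by auto
    from linked_dist(1)[OF _ _ pair_link[OF assms(1) this]] show False using c3 by simp
  next
    case False
    then have "i + 1 = i0 + int c" using assms(1) unfolding window_def by auto
    moreover from this have "i \<noteq> i0" using c3 by auto
    ultimately show False using port_dist(2)[OF assms(1)] by simp
  qed
qed

text \<open>Two empty runs would put two successors into the clique, and their edge is a forbidden
  chord with \<open>k = l = 1\<close>.\<close>

lemma zero_unique:
  assumes "i \<in> window i0 N" "j \<in> window i0 N" "stop N i = 0" "stop N j = 0" shows "i = j"
proof (rule ccontr)
  assume "i \<noteq> j"
  have *: False if "i \<in> window i0 N" "j \<in> window i0 N" "i < j" "f (i + 1) \<in> Q" "f (j + 1) \<in> Q" for i j
  proof -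
    have lt: "j < i + int c" using that unfolding window_def by auto
    have "\<not> E (f (i + 1)) (f (j + 1))"
      by (rule linked_nonadj[OF that(3) lt pair_link[OF that(1-3)]]) auto
    moreover have "f (i + 1) \<noteq> f (j + 1)" using f_neq[of "i + 1" "j + 1"] that(3) lt by auto
    ultimately show False using that(4,5) Qclique by blast
  qed
  show False using *[of i j] *[of j i] zero_stop assms \<open>i \<noteq> j\<close> by (meson linorder_neqE)
qed

text \<open>The long ears keep all other vertices of \<open>N\<close> at distance at least
  \<open>g + 2\<close>, so a run that short can only end in the clique.\<close>

lemma stop_i0: "stop N i0 \<le> g \<Longrightarrow> f (i0 + 1 + int (stop N i0)) \<in> Q"
proof -
  assume le: "stop N i0 \<le> g"
  let ?j = "i0 + 1 + int (stop N i0)"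
  have "f ?j \<notin> N"
  proof
    assume N: "f ?j \<in> N"
    have "\<exists>j. j \<in> window i0 N \<and> j \<noteq> i0"
    proof (rule ccontr)
      assume "\<not> ?thesis"
      then have "window i0 N = {i0}" using i0_win by blast
      then have "card (window i0 N) = 1" by simp
      then show False using window_card[OF N_Cy, of i0] P unfolding ported_def by simp
    qed
    then obtain j where j: "j \<in> window i0 N" "j \<noteq> i0" by blast
    then have "?j < i0 + int c" using port_dist[OF j] le by linarith
    then have "?j \<in> window i0 N" using N unfolding window_def by auto
    then show False using port_dist(1)[of ?j] le by auto
  qed
  then show ?thesis using stop_in[of i0 N] by blast
qed

text \<open>Otherwise the clique edge between the vertices that end the two runs is a chord with
  \<open>k + l \<le> g + 2\<close>, which the ear with \<open>g + 1\<close> inner vertices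
  forbids.\<close>

lemma port_sum:
  assumes j: "j \<in> window i0 N" "j \<noteq> i0" and s: "f (j + 1 + int (stop N j)) \<in> Q"
  shows "g + 1 \<le> stop N i0 + stop N j"
proof (rule ccontr)
  assume "\<not> ?thesis"
  then have le: "stop N i0 + stop N j \<le> g" by simp
  note d = port_dist[OF j]
  have lt: "i0 < j" "j < i0 + int c" using j unfolding window_def by auto
  have "\<not> E (f (i0 + (1 + int (stop N i0)))) (f (j + (1 + int (stop N j))))"
    by (rule linked_nonadj[OF lt port_link[OF j]]) (use le in auto)
  moreover have "f (i0 + (1 + int (stop N i0))) \<noteq> f (j + (1 + int (stop N j)))"
    by (rule f_neq) (use le d in auto)
  ultimately show False using Qclique stop_i0 s le by (auto simp: algebra_simps)
qed

lemma last_window: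
  obtains j where "j \<in> window i0 N" "j \<noteq> i0" "\<And>i. i \<in> window i0 N \<Longrightarrow> i \<le> j"
proof -
  let ?j = "Max (window i0 N)"
  have j: "?j \<in> window i0 N" "\<And>i. i \<in> window i0 N \<Longrightarrow> i \<le> ?j"
    using i0_win window_fin by (auto intro: Max_in)
  moreover have "?j \<noteq> i0"
  proof
    assume "?j = i0"
    then have "window i0 N \<subseteq> {i0}" using j(2) unfolding window_def by force
    then have "card (window i0 N) \<le> 1" using card_mono[of "{i0}"] by fastforce
    then show False using window_card[OF N_Cy] P unfolding ported_def by simp
  qed
  ultimately show ?thesis using that by blast
qed

text \<open>Behind the last vertex of \<open>N\<close> the next one is the port again, at distance
  at least \<open>g + 2\<close>. So this run is long by itself or ends in the clique.\<close>

lemma last_sum: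
  assumes j: "j \<in> window i0 N" "j \<noteq> i0" and m: "\<And>i. i \<in> window i0 N \<Longrightarrow> i \<le> j"
  shows "g + 1 \<le> stop N i0 + stop N j"
proof (cases "g + 1 \<le> stop N j")
  case False
  have "f (j + 1 + int (stop N j)) \<notin> N"
  proof
    assume N: "f (j + 1 + int (stop N j)) \<in> N"
    have "j + 1 + int (stop N j) < i0 + int c" using False port_dist(2)[OF j] by linarith
    then have "j + 1 + int (stop N j) \<in> window i0 N" using N j unfolding window_def by auto
    then show False using m by fastforce
  qed
  then show ?thesis using port_sum[OF j] stop_in[of j N] by blast
qed simp

text \<open>The runs at \<open>i0\<close> and at the last index \<open>j\<close> give
  \<open>g + 1\<close>, and the other \<open>card N - 2\<close> runs give one each unless some run
  \<open>k\<close> is empty. In that case the run at \<open>i0\<close> alone has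
  \<open>g + 1\<close> vertices and all runs other than \<open>k\<close> are nonempty, which yields
  the same total.\<close>

lemma sum_stop_ge: "g + card N \<le> (\<Sum>i\<in>window i0 N. stop N i) + 1"
proof -
  let ?W = "window i0 N"
  obtain j where j: "j \<in> ?W" "j \<noteq> i0" "\<And>i. i \<in> ?W \<Longrightarrow> i \<le> j" using last_window by blast
  let ?R = "?W - {i0, j}"
  have cW: "card ?W = card N" by (rule window_card[OF N_Cy])
  have "2 \<le> card N" using P unfolding ported_def by blast
  then have cR: "card ?R + 2 = card N"
    using card_Diff_subset[of "{i0, j}" ?W] i0_win j cW by simp
  have sum: "(\<Sum>i\<in>?W. stop N i) = stop N i0 + stop N j + (\<Sum>i\<in>?R. stop N i)"
  proof -
    have "?W = insert i0 (insert j ?R)" using i0_win j by auto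
    then have "(\<Sum>i\<in>?W. stop N i) = (\<Sum>i\<in>insert i0 (insert j ?R). stop N i)" by simp
    then show ?thesis using j(2) window_fin by simp
  qed
  show ?thesis
  proof (cases "\<exists>k\<in>?R. stop N k = 0")
    case False
    then have "(\<Sum>i\<in>?R. 1) \<le> (\<Sum>i\<in>?R. stop N i)" by (intro sum_mono) (auto simp: Suc_le_eq)
    then show ?thesis using sum last_sum[OF j] cR by simp
  next
    case True
    then obtain k where k: "k \<in> ?R" "stop N k = 0" by blast
    have "g + 1 \<le> stop N i0" using port_sum[of k] k zero_stop[of k] by simp
    moreover have "1 \<le> stop N j" using zero_unique[of k j] k j(1) by (cases "stop N j") auto
    moreover have pos: "1 \<le> stop N i" if i: "i \<in> ?R - {k}" for i
    proof (rule ccontr)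
      assume "\<not> ?thesis"
      then have "i = k" using zero_unique[of i k] i k by simp
      then show False using i by simp
    qed
    moreover have "card (?R - {k}) \<le> (\<Sum>i\<in>?R. stop N i)"
    proof -
      have "(\<Sum>i\<in>?R - {k}. 1) \<le> (\<Sum>i\<in>?R - {k}. stop N i)"
        by (rule sum_mono) (rule pos)
      also have "\<dots> \<le> (\<Sum>i\<in>?R. stop N i)" by (intro sum_mono2) (auto simp: window_fin)
      finally show ?thesis by simp
    qed
    moreover have "card ?R = Suc (card (?R - {k}))"
      by (rule card.remove) (use k window_fin in auto)
    ultimately show ?thesis using sum cR by linarith
  qed
qed

lemma port_count: "g + card N \<le> card (X - N) + 1"
  using sum_stop_ge sum_stop_le by linarith

end

end

section \<open>The case of equality in the port count\<close>

context clique_frame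
begin

lemma range_rev: "range (\<lambda>i. f (- i)) = Cy"
  by (metis fun.set_map surj_uminus image_image)

lemma clique_frame_rev: "clique_frame E V (\<lambda>i. f (- i)) c Q d"
  unfolding clique_frame_def clique_frame_axioms_def range_rev
  using frame_rev QC Qclique cardQ d_small by blast

lemma ported_rev:
  assumes "ported i0 N g"
  shows "cycle_frame.ported E V (\<lambda>i. f (- i)) (- i0) N g"
proof -
  interpret rev: clique_frame E V "\<lambda>i. f (- i)" c Q d by (rule clique_frame_rev)
  have "rev.linked = linked" unfolding rev.linked_def linked_def range_rev by (rule refl)
  then show ?thesis using assms unfolding rev.ported_def ported_def range_rev by simp
qed

text \<open>With equality the runs fill \<open>X\<close> completely and avoid \<open>N\<close>;
  walking back inside a run ends at its port.\<close>

lemma X_nbr_back: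
  assumes P: "ported i0 N g" and tight: "g + card N = d"
  shows "X \<inter> N = {}" "(\<Sum>i\<in>window i0 N. stop N i) = card X"
    "f p \<in> X \<Longrightarrow> f (p - 1) \<in> X \<union> N"
proof -
  have fX: "finite X" using finCy by blast
  have "card X \<le> (\<Sum>i\<in>window i0 N. stop N i)" using sum_stop_ge[OF P] tight cardX by linarith
  moreover have le: "card (X - N) \<le> card X" using fX by (intro card_mono) auto
  ultimately show sum: "(\<Sum>i\<in>window i0 N. stop N i) = card X" using sum_stop_le[OF P] by linarith
  then have "card (X - N) = card X" using sum_stop_le[OF P] le by linarith
  then have XN: "X - N = X" using card_subset_eq[OF fX, of "X - N"] by blast
  then show dis: "X \<inter> N = {}" by blast
  have runs: "f ` (\<Union>i\<in>window i0 N. {i + 1..i + int (stop N i)}) = X"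
    using card_subset_eq[OF fX, of "f ` (\<Union>i\<in>window i0 N. {i + 1..i + int (stop N i)})"]
      runs_sub[OF P] runs_card[OF P] sum XN by auto
  assume "f p \<in> X"
  then obtain i p' where p: "i \<in> window i0 N" "i + 1 \<le> p'" "p' \<le> i + int (stop N i)" "f p = f p'"
    unfolding runs[symmetric] by auto
  have "f (p - 1) = f (p' - 1)" using p(4) unfolding f_eq by (metis mod_diff_left_eq)
  moreover have "f (p' - 1) \<in> X \<union> N"
    using p(1-3) before_stop[of i "p' - 1" N] by (cases "p' - 1 = i") (auto simp: window_def)
  ultimately show "f (p - 1) \<in> X \<union> N" by simp
qed

lemma X_nbr_fwd:
  assumes P: "ported i0 N g" and tight: "g + card N = d" and "f p \<in> X"
  shows "f (p + 1) \<in> X \<union> N"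
proof -
  interpret rev: clique_frame E V "\<lambda>i. f (- i)" c Q d by (rule clique_frame_rev)
  show ?thesis using rev.X_nbr_back(3)[OF ported_rev[OF P] tight, of "- p"] assms(3)
    unfolding range_rev by (simp add: add.commute)
qed

text \<open>For \<open>g = 0\<close> there are \<open>card X + 1\<close> runs, at most one of them
  empty. So their first vertices alone already exhaust \<open>X\<close>.\<close>

lemma X_pred_N:
  assumes P: "ported i0 N g" and tight: "g + card N = d" and g: "g = 0" and p: "f p \<in> X"
  shows "f (p - 1) \<in> N"
proof -
  let ?W = "{i \<in> window i0 N. stop N i \<noteq> 0}" and ?Z = "{i \<in> window i0 N. stop N i = 0}"
  have fX: "finite X" using finCy by blast
  have fZ: "finite ?Z" using window_fin[of i0 N] by simp
  have "card ?Z \<le> 1"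
    using zero_unique[OF P] by (simp add: card_le_Suc0_iff_eq[OF fZ])
  moreover have "card (window i0 N) = card ?W + card ?Z"
    by (subst card_Un_disjoint[symmetric]) (auto simp: window_fin intro: arg_cong[where f = card])
  ultimately have "card X \<le> card ?W" using window_card[OF N_Cy[OF P]] tight g cardX by simp
  moreover have "inj_on (\<lambda>i. f (i + 1)) ?W"
  proof (rule inj_onI)
    fix i j assume "i \<in> ?W" "j \<in> ?W" "f (i + 1) = f (j + 1)"
    then have "i + 1 = j + 1" by (intro inj_onD[OF f_inj[of "i0 + 1"]]) (auto simp: window_def)
    then show "i = j" by simp
  qed
  moreover have sub: "(\<lambda>i. f (i + 1)) ` ?W \<subseteq> X"
  proof
    fix x assume "x \<in> (\<lambda>i. f (i + 1)) ` ?W"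
    then obtain i where i: "x = f (i + 1)" "stop N i \<noteq> 0" by blast
    then show "x \<in> X" using before_stop[of i "i + 1" N] by auto
  qed
  ultimately have "(\<lambda>i. f (i + 1)) ` ?W = X"
    by (intro card_seteq[OF fX]) (simp_all add: card_image)
  then obtain i where i: "i \<in> window i0 N" "f p = f (i + 1)" using p by auto
  then have "f (p - 1) = f i" unfolding f_eq by (metis mod_diff_left_eq add_diff_cancel_right')
  then show ?thesis using i unfolding window_def by simp
qed

lemma X_succ_N:
  assumes P: "ported i0 N g" and tight: "g + card N = d" and g: "g = 0" and p: "f p \<in> X"
  shows "f (p + 1) \<in> N"
proof -
  interpret rev: clique_frame E V "\<lambda>i. f (- i)" c Q d by (rule clique_frame_rev)
  show ?thesis using rev.X_pred_N[OF ported_rev[OF P] tight g, of "- p"] p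
    unfolding range_rev by (simp add: add.commute)
qed

lemma stop_in_Q:
  assumes P: "ported i0 N g" and tight: "g + card N = d"
  shows "f (i + 1 + int (stop N i)) \<in> Q"
  using stop_in[of i N] X_nbr_back(1)[OF P tight] N_Cy[OF P] by blast

text \<open>An empty run at the port would force \<open>g + 1\<close> vertices behind every other
  vertex of \<open>N\<close>, but \<open>(card N - 1) * (g + 1)\<close> exceeds
  \<open>card X = g + card N - 1\<close>.\<close>

lemma port_succ_X:
  assumes P: "ported i0 N g" and tight: "g + card N = d" and "1 \<le> g" "3 \<le> card N"
  shows "1 \<le> stop N i0" "f (i0 + 1) \<in> X"
proof -
  show "1 \<le> stop N i0"
  proof (rule ccontr)
    assume "\<not> ?thesis"
    then have z: "stop N i0 = 0" by simp
    have "g + 1 \<le> stop N j" if "j \<in> window i0 N - {i0}" for j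
      using port_sum[OF P, of j] that stop_in_Q[OF P tight] z by auto
    then have "(\<Sum>j\<in>window i0 N - {i0}. g + 1) \<le> (\<Sum>j\<in>window i0 N - {i0}. stop N j)"
      by (intro sum_mono)
    also have "\<dots> \<le> (\<Sum>j\<in>window i0 N. stop N j)" by (intro sum_mono2) (auto simp: window_fin)
    also have "\<dots> = card X" by (rule X_nbr_back(2)[OF P tight])
    finally have "card (window i0 N - {i0}) * (g + 1) \<le> card X" by simp
    then have "(card N - 1) * (g + 1) \<le> g + (card N - 1)"
      using window_card[OF N_Cy[OF P], of i0] i0_win[OF P] window_fin tight cardX assms(4) by simp
    moreover obtain m where "card N = m + 3" using assms(4) by (metis add.commute le_Suc_ex)
    ultimately show False using assms(3) by (simp add: algebra_simps)
  qed
  then show "f (i0 + 1) \<in> X" using before_stop[of i0 "i0 + 1" N] by auto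
qed

text \<open>Suppose there are at least three. Some run is empty, as otherwise
  \<open>X \<union> N\<close> would be closed under successors and be the whole cycle. The empty run
  forces \<open>g + 1\<close> vertices behind the port, and the run at the last index extends all
  the way round to the port and has \<open>g + 1\<close> vertices too: more than \<open>X\<close>
  has.\<close>

lemma port_two:
  assumes P: "ported i0 N g" and tight: "g + card N = d" and g: "1 \<le> g"
  shows "card N = 2"
proof (rule ccontr)
  assume "card N \<noteq> 2"
  then have N3: "3 \<le> card N" using P unfolding ported_def by simp
  let ?W = "window i0 N"
  interpret rev: clique_frame E V "\<lambda>i. f (- i)" c Q d by (rule clique_frame_rev)
  have "f (i0 - 1) \<in> X"
    using rev.port_succ_X(2)[OF ported_rev[OF P] tight g N3] unfolding range_rev by simp
  then have pred: "f (i0 + int c - 1) \<in> X" using f_periodic[of "i0 - 1"] by (simp add: algebra_simps)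
  have XN: "X \<inter> N = {}" by (rule X_nbr_back(1)[OF P tight])
  have "\<exists>k\<in>?W. stop N k = 0"
  proof (rule ccontr)
    assume no: "\<not> ?thesis"
    have "f (i0 + int n) \<in> X \<union> N" for n
    proof (induction n)
      case 0
      then show ?case using P unfolding ported_def by simp
    next
      case (Suc n)
      show ?case
      proof (cases "f (i0 + int n) \<in> X")
        case True
        then show ?thesis using X_nbr_fwd[OF P tight, of "i0 + int n"] by (simp add: algebra_simps)
      next
        case False
        then have "f (i0 + int n) \<in> N" using Suc by blast
        moreover obtain k where k: "i0 \<le> k" "k < i0 + int c" "f k = f (i0 + int n)"
          using f_window[of "f (i0 + int n)" i0] by blast
        ultimately have "k \<in> ?W" unfolding window_def by simp
        then have "f (k + 1) \<in> X" using no before_stop[of k "k + 1" N] by auto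
        moreover have "f (k + 1) = f (i0 + int (Suc n))"
          using k(3) unfolding f_eq by (metis add.assoc add.commute mod_add_left_eq of_nat_Suc)
        ultimately show ?thesis by simp
      qed
    qed
    then have "Cy \<subseteq> X \<union> N"
      using Cy_window[of i0] by (auto, metis (no_types, lifting) DiffD2 UnE zle_iff_zadd)
    then have "card Cy \<le> card (X \<union> N)" using finCy N_Cy[OF P] by (intro card_mono) (auto intro: finite_subset)
    also have "\<dots> \<le> card X + card N" by (rule card_Un_le)
    finally show False using card_Cy cardX tight d_small by linarith
  qed
  then obtain k where k: "k \<in> ?W" "stop N k = 0" by blast
  have "k \<noteq> i0" using port_succ_X(1)[OF P tight g N3] k by auto
  then have s0: "g + 1 \<le> stop N i0" using port_sum[OF P k(1)] stop_in_Q[OF P tight, of k] k by auto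
  obtain j where j: "j \<in> ?W" "j \<noteq> i0" "\<And>i. i \<in> ?W \<Longrightarrow> i \<le> j" using last_window[OF P] by blast
  \<comment> \<open>Backwards from the port every vertex is in \<open>X\<close> until the last index
    \<open>j\<close> is met, because predecessors of \<open>X\<close> lie in
    \<open>X \<union> N\<close>.\<close>
  have trail: "f (i0 + int c - 1 - int n) \<in> X" if "j < i0 + int c - 1 - int n" for n
    using that
  proof (induction n)
    case (Suc n)
    then have "f (i0 + int c - 1 - int n) \<in> X" by simp
    then have "f (i0 + int c - 1 - int (Suc n)) \<in> X \<union> N"
      using X_nbr_back(3)[OF P tight, of "i0 + int c - 1 - int n"] by (simp add: algebra_simps)
    moreover have "f (i0 + int c - 1 - int (Suc n)) \<notin> N"
    proof
      assume "f (i0 + int c - 1 - int (Suc n)) \<in> N"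
      then have "i0 + int c - 1 - int (Suc n) \<in> ?W" using Suc.prems j(1) unfolding window_def by auto
      then show False using j(3) Suc.prems by fastforce
    qed
    ultimately show ?case by blast
  qed (use pred in simp)
  have sj: "g + 1 \<le> stop N j"
  proof (rule ccontr)
    assume "\<not> ?thesis"
    then have lt: "j + 1 + int (stop N j) \<le> i0 + int c - 1" using port_dist(2)[OF P j(1,2)] by linarith
    have "f (i0 + int c - 1 - int (nat (i0 + int c - 1 - (j + 1 + int (stop N j))))) \<in> X"
      by (rule trail) (use lt in auto)
    then show False using lt stop_in_Q[OF P tight, of j] by (simp add: ac_simps)
  qed
  let ?R = "?W - {i0, j, k}"
  have kj: "k \<noteq> j" using sj k by auto
  have cR: "card ?R + 3 = card N"
    using card_Diff_subset[of "{i0, j, k}" ?W] i0_win[OF P] j k \<open>k \<noteq> i0\<close> kj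
      window_card[OF N_Cy[OF P], of i0] N3 by simp
  have "?W = insert i0 (insert j (insert k ?R))" using i0_win[OF P] j k by auto
  then have "(\<Sum>i\<in>?W. stop N i) = (\<Sum>i\<in>insert i0 (insert j (insert k ?R)). stop N i)" by simp
  also have "\<dots> = stop N i0 + stop N j + stop N k + (\<Sum>i\<in>?R. stop N i)"
    using j(2) kj \<open>k \<noteq> i0\<close> window_fin by simp
  finally have "card X = stop N i0 + stop N j + stop N k + (\<Sum>i\<in>?R. stop N i)"
    using X_nbr_back(2)[OF P tight] by simp
  moreover have "1 \<le> stop N i" if i: "i \<in> ?R" for i
  proof (rule ccontr)
    assume "\<not> ?thesis"
    then have "i = k" using zero_unique[OF P, of i k] i k by simp
    then show False using i by simp
  qed
  then have "(\<Sum>i\<in>?R. 1) \<le> (\<Sum>i\<in>?R. stop N i)" by (rule sum_mono)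
  then have "card ?R \<le> (\<Sum>i\<in>?R. stop N i)" by simp
  ultimately show False using s0 sj cR cardX tight g by linarith
qed

text \<open>A nonempty run can only end at the other vertex of \<open>N\<close>, which is at
  distance at least \<open>g + 2\<close>. As \<open>card X = g + 1\<close>, a single run uses up all
  of \<open>X\<close>.\<close>

lemma port_arc:
  assumes P: "ported i0 N g" and tight: "g + card N = d" and N2: "card N = 2"
  obtains i j where "i < j" "j < i + int c" "N = {f i, f j}" "X = f ` {i<..<j}" "j - i = int d"
    "f i \<in> Q" "f j \<in> Q" "linked (f i) (f j) (g + 1)"
proof -
  let ?W = "window i0 N"
  have fX: "finite X" using finCy by blast
  have XN: "X \<inter> N = {}" by (rule X_nbr_back(1)[OF P tight])
  obtain j where j: "j \<in> ?W" "j \<noteq> i0" "\<And>i. i \<in> ?W \<Longrightarrow> i \<le> j" using last_window[OF P] by blast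
  have "{i0, j} \<subseteq> ?W" using i0_win[OF P] j by simp
  moreover have "card ?W \<le> card {i0, j}" using window_card[OF N_Cy[OF P], of i0] N2 j(2) by simp
  ultimately have W: "?W = {i0, j}" using card_seteq[OF window_fin[of i0 N]] by blast
  have lt: "i0 < j" "j < i0 + int c" using j(1,2) unfolding window_def by auto
  have ne: "f i0 \<noteq> f j" using f_neq[OF lt] .
  have "{f i0, f j} \<subseteq> N" using W unfolding window_def by auto
  then have N: "N = {f i0, f j}"
    using card_seteq[of N "{f i0, f j}"] N2 ne by (metis card_2_iff card.infinite order_refl zero_neq_numeral)
  note link = port_link[OF P j(1,2)] and dist = port_dist[OF P j(1,2)]
  have NQ: "f i0 \<in> Q" "f j \<in> Q" using XN N N_Cy[OF P] by auto
  have cX: "card X = g + 1" using tight N2 cardX by simp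
  have sum: "stop N i0 + stop N j = card X" using X_nbr_back(2)[OF P tight] j(2) unfolding W by simp
  have nextN: "f (i + 1 + int (stop N i)) \<in> N" if "stop N i \<noteq> 0" for i
  proof -
    have "f (i + int (stop N i)) \<in> X" using before_stop[of i "i + int (stop N i)" N] that by simp
    then show ?thesis using X_nbr_fwd[OF P tight, of "i + int (stop N i)"] stop_in_Q[OF P tight, of i]
      by (auto simp: algebra_simps)
  qed
  have eqX: "X = f ` {i<..<l}" if "i < l" "l - i = int (card X) + 1" "l \<le> i + 1 + int (stop N i)" "l \<le> i + int c" for i l
  proof -
    have "f ` {i<..<l} \<subseteq> X" using that before_stop[of i _ N] by fastforce
    moreover have "card (f ` {i<..<l}) = card X"
      by (subst card_image[OF inj_on_subset[OF f_inj[of "i + 1"]]]) (use that in auto)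
    ultimately show ?thesis using card_subset_eq[OF fX] by metis
  qed
  show ?thesis
  proof (cases "stop N i0 = 0")
    case False
    let ?m = "i0 + 1 + int (stop N i0)"
    have "?m \<le> j" using stop_window[OF P i0_win[OF P] j(1) lt(1)] by simp
    then have "?m \<in> ?W" using nextN[OF False] lt unfolding window_def by auto
    then have m: "?m = j" using W by auto
    then have "j - i0 = int d" using dist(1) sum cX cardX by linarith
    moreover have "X = f ` {i0<..<j}" by (rule eqX) (use lt m cX sum dist in auto)
    ultimately show ?thesis using that[of i0 j] lt N NQ link by simp
  next
    case True
    then have sj: "stop N j = g + 1" using sum cX by simp
    let ?m = "j + 1 + int (stop N j)"
    have "?m \<le> i0 + int c" using stop_end[OF P j(1)] by simp
    moreover have "\<not> ?m < i0 + int c"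
    proof
      assume "?m < i0 + int c"
      then have "?m \<in> ?W" using nextN[of j] sj lt unfolding window_def by auto
      then show False using j(3)[of ?m] by auto
    qed
    ultimately have m: "?m = i0 + int c" by simp
    have "X = f ` {j<..<i0 + int c}" by (rule eqX) (use lt m cX sj in auto)
    moreover have "i0 + int c - j = int d" using m sj cX cardX by linarith
    moreover have "f (i0 + int c) = f i0" by (rule f_periodic)
    ultimately show ?thesis
      using that[of j "i0 + int c"] lt N NQ linked_sym[OF link] by (simp add: insert_commute)
  qed
qed

end

subsection \<open>Vertices of small degree outside the cycle\<close>

context cycle_frame
begin

lemma fin_Out: "U \<subseteq> Out \<Longrightarrow> finite U"
  by (rule finite_subset[of _ Out]) (simp_all add: finV)

lemma Cy_big: "D \<subseteq> Out \<Longrightarrow> D \<noteq> V - {v}"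
proof
  assume D: "D \<subseteq> Out" "D = V - {v}"
  have "f 0 \<noteq> f 1" using f_neq[of 0 1] c3 by simp
  moreover have "f 0 \<in> V" "f 1 \<in> V" using f_V by auto
  ultimately have "f 0 \<in> D \<or> f 1 \<in> D" using D(2) by auto
  then show False using D(1) by auto
qed

lemma component_edge:
  assumes r: "r \<in> Out" and D: "D \<subseteq> component E Out r" "D \<noteq> {}"
  shows "\<exists>a\<in>D. \<exists>b\<in>(component E Out r \<union> Cy) - D - {v}. E a b"
proof -
  have sub: "component E Out r \<subseteq> Out" by (rule component_subset[OF r])
  have "D \<subseteq> Out" using D sub by blast
  show ?thesis
  proof (cases "v \<in> D")
    case False
    have "D \<subseteq> V - {v}" using False \<open>D \<subseteq> Out\<close> by blast
    then obtain a b where ab: "a \<in> D" "b \<in> V - D - {v}" "E a b"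
      using two_conn[OF _ D(2) Cy_big[OF \<open>D \<subseteq> Out\<close>]] by blast
    then have "b \<in> component E Out r \<union> Cy" using component_closed[OF r, of a E b] D(1) by blast
    then show ?thesis using ab by blast
  next
    case True
    \<comment> \<open>A \<open>v\<close> inside \<open>D\<close> deletes no possible neighbour. It
      is replaced by a vertex of the cycle, so that \<open>D\<close> avoids the vertex deleted in
      \<open>two_conn\<close>.\<close>
    have "f 0 \<notin> D" using \<open>D \<subseteq> Out\<close> by auto
    then have "D \<subseteq> V - {f 0}" using \<open>D \<subseteq> Out\<close> by blast
    then obtain a b where ab: "a \<in> D" "b \<in> V - D - {f 0}" "E a b"
      using two_conn[OF _ D(2) Cy_big[OF \<open>D \<subseteq> Out\<close>]] by blast
    then have "b \<in> component E Out r \<union> Cy" using component_closed[OF r, of a E b] D(1) by blast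
    then show ?thesis using ab True by blast
  qed
qed

text \<open>
  All of \<open>Cy - {f i0}\<close> is contracted to the single vertex \<open>f (i0 + 1)\<close> in order to apply the
  rooted path lemma with the roots \<open>f i0\<close> and \<open>f (i0 + 1)\<close>.
\<close>

lemma dominated_vertex:
  assumes U: "U \<subseteq> Out" and r: "r \<in> Out" and UR: "U \<inter> component E Out r \<noteq> {}"
    and e: "r1 \<in> component E Out r" "E r1 (f i0)"
  shows "\<exists>w\<in>U \<inter> component E Out r.
    (\<exists>z\<in>Cy - {f i0}. E w z) \<and> ported i0 (insert (f i0) {z \<in> Cy. E w z}) (card {z \<in> U. E w z}) \<or>
    {z \<in> Cy. E w z} \<subseteq> {f i0} \<and> (\<exists>z\<in>Cy - {f i0}. ported i0 {f i0, z} (card {z \<in> U. E w z}))"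
proof -
  define R where "R = component E Out r"
  define x where "x = f i0"
  define y where "y = f (i0 + 1)"
  have xy: "x \<noteq> y" unfolding x_def y_def using f_neq[of i0 "i0 + 1"] c3 by simp
  have RO: "R \<subseteq> Out" unfolding R_def by (rule component_subset[OF r])
  have xR: "x \<notin> R" "y \<notin> R" using RO unfolding x_def y_def by auto
  \<comment> \<open>Adjacency after the contraction, on the component and the two roots: an edge to
    \<open>y\<close> stands for some edge to the cycle not ending at \<open>x\<close>.\<close>
  define F where "F a b \<longleftrightarrow> a \<in> R \<and> b \<in> R \<and> E a b \<or> a = x \<and> b \<in> R \<and> E b x \<or> b = x \<and> a \<in> R \<and> E a x \<or>
    a = y \<and> b \<in> R \<and> (\<exists>z\<in>Cy - {x}. E b z) \<or> b = y \<and> a \<in> R \<and> (\<exists>z\<in>Cy - {x}. E a z)" for a b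
  have Fsym: "symp F" unfolding F_def by (rule sympI) (use E_sym in blast)
  have FR: "F a b \<longleftrightarrow> E a b" if "a \<in> R" "b \<in> R" for a b
    using that xR unfolding F_def by blast
  have Fx: "F a x \<longleftrightarrow> E a x" if "a \<in> R" for a using that xR xy unfolding F_def by blast
  have Fy: "F a y \<longleftrightarrow> (\<exists>z\<in>Cy - {x}. E a z)" if "a \<in> R" for a using that xR xy unfolding F_def by blast
  let ?V = "R \<union> {x, y}" and ?U = "U \<inter> R"
  have conn: "connected_on E R" unfolding R_def by (rule connected_on_component[OF sym r])
  have "rooted F ?V ?U x y"
    unfolding rooted_def
  proof (intro allI impI)
    fix D v assume D: "D \<subseteq> ?V - {x, y}" "D \<inter> ?U \<noteq> {}"
    then have D': "D \<subseteq> R" "D \<noteq> {}" by blast+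
    show "\<exists>a\<in>D. \<exists>b\<in>?V - D - {v}. F a b"
    \<comment> \<open>A neighbour other than \<open>y\<close> comes from connectedness of
      \<open>R\<close>, or from \<open>r1\<close> if \<open>D\<close> is all of \<open>R\<close>. A
      neighbour other than any different \<open>v\<close> comes from 2-connectivity.\<close>
    proof (cases "v = y")
      case True
      show ?thesis
      proof (cases "D = R")
        case True2: True
        have "F r1 x" using Fx e unfolding R_def x_def by simp
        then show ?thesis using e(1) True True2 xy xR unfolding R_def by blast
      next
        case False
        then obtain a b where ab: "a \<in> D" "b \<in> R - D" "E a b" using conn D' unfolding connected_on_def by meson
        then have "F a b" using FR D' by blast
        moreover have "b \<in> ?V - D - {v}" using ab xR True by blast
        ultimately show ?thesis using ab(1) by blast
      qed
    next
      case False
      obtain a b where ab: "a \<in> D" "b \<in> (R \<union> Cy) - D - {v}" "E a b"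
        using component_edge[OF r, of D v] D' unfolding R_def by blast
      have aR: "a \<in> R" using ab D' by blast
      consider "b \<in> R" | "b = x" | "b \<in> Cy - {x}" using ab by blast
      then show ?thesis
      proof cases
        case 1
        then have "F a b" using FR aR ab by blast
        then show ?thesis using 1 ab by blast
      next
        case 2
        then have "F a b" using Fx aR ab by blast
        then show ?thesis using 2 ab by blast
      next
        case 3
        then have "F a y" using Fy aR ab by blast
        moreover have "y \<in> ?V - D - {v}" using False D by blast
        ultimately show ?thesis using ab(1) by blast
      qed
    qed
  qed
  moreover have "finite ?V" using fin_Out[OF RO] by simp
  moreover have "?U \<subseteq> ?V - {x, y}" "?U \<noteq> {}" using xR UR unfolding R_def by blast+
  ultimately obtain P w where P: "gpath F ?V x P y" and w: "w \<in> ?U" "w \<in> set P"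
    and dom: "\<forall>z\<in>?U. F w z \<longrightarrow> z \<in> set P" and lst: "F w y \<longrightarrow> (\<exists>P1. P = P1 @ [w, y])"
    using rooted_path_dominating[OF _ Fsym _ _ xy, of ?V ?U] by auto
  obtain rs where rs: "P = x # rs @ [y]"
  proof -
    obtain P1 where P1: "P = x # P1" using P unfolding gpath_def by (cases P) auto
    have "P1 \<noteq> []" using P xy unfolding P1 gpath_def by auto
    then have "P1 = butlast P1 @ [y]" using P append_butlast_last_id[of P1] unfolding P1 gpath_def by auto
    then show ?thesis using that P1 by blast
  qed
  have disrs: "distinct rs" "x \<notin> set rs" "y \<notin> set rs" using P unfolding gpath_def rs by auto
  have rsR: "set rs \<subseteq> R" using P disrs unfolding gpath_def rs by auto
  have w_rs: "w \<in> set rs" using w xR unfolding rs by auto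
  then have ne: "rs \<noteq> []" by auto
  have succF: "successively F (x # rs @ [y])" using P unfolding gpath_def rs by simp
  then have succ: "successively F rs" "F x (hd rs)" "F (last rs) y"
    using ne by (auto simp: successively_Cons successively_append_iff)
  have "successively E rs"
    using succ(1) by (rule successively_mono) (use FR rsR in blast)
  have hl: "hd rs \<in> R" "last rs \<in> R" using ne rsR hd_in_set last_in_set by blast+
  have hx: "E x (hd rs)" using succ(2) sympD[OF Fsym] Fx[OF hl(1)] E_sym by blast
  obtain z0 where z0: "z0 \<in> Cy - {x}" "E (last rs) z0" using succ(3) Fy[OF hl(2)] by blast
  define g where "g = card {z \<in> U. E w z}"
  have wO: "w \<in> R" using w by blast
  have "insert w {z \<in> U. E w z} \<subseteq> set rs"
  proof -
    have "z \<in> set rs" if z: "z \<in> U" "E w z" for z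
    proof -
      have zR: "z \<in> R" using component_closed[OF r, of w E z] wO z U unfolding R_def by blast
      then have "z \<in> set P" using dom FR wO z by blast
      then show ?thesis using zR xR unfolding rs by auto
    qed
    then show ?thesis using w_rs by blast
  qed
  then have "card (insert w {z \<in> U. E w z}) \<le> length rs"
    by (meson List.finite_set card_length card_mono le_trans)
  moreover have "finite {z \<in> U. E w z}" using fin_Out[OF U] by simp
  ultimately have len: "g + 1 \<le> length rs" using E_irr unfolding g_def by simp
  have link: "linked x z (g + 1)" if "E (last rs) z" for z
    unfolding linked_def
    using len ne disrs(1) rsR RO \<open>successively E rs\<close> hx that by (intro exI[of _ rs]) auto
  have linkw: "linked z z' 1" if "E w z" "E w z'" for z z'
    unfolding linked_def using wO RO that E_sym by (intro exI[of _ "[w]"]) auto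
  have xC: "x \<in> Cy" unfolding x_def by simp
  have "(\<exists>z\<in>Cy - {x}. E w z) \<and> ported i0 (insert x {z \<in> Cy. E w z}) g \<or>
    {z \<in> Cy. E w z} \<subseteq> {x} \<and> (\<exists>z\<in>Cy - {x}. ported i0 {x, z} g)"
  proof (cases "\<exists>z\<in>Cy - {x}. E w z")
    case True
    let ?N = "insert x {z \<in> Cy. E w z}"
    \<comment> \<open>A vertex \<open>w\<close> adjacent to the contracted root is the last inner
      vertex of the path. The same ear then leads from \<open>x\<close> to each neighbour of
      \<open>w\<close> on the cycle, not only to the one chosen at contraction.\<close>
    obtain P1 where "P = P1 @ [w, y]" using lst True Fy[OF wO] by blast
    then have "x # rs = P1 @ [w]" using arg_cong[where f = butlast, of "x # rs @ [y]" "P1 @ [w, y]"]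
      unfolding rs by (simp add: butlast_append)
    then have lw: "last rs = w" using ne by (metis last_ConsR last_snoc)
    have l1: "linked x z (g + 1)" if "z \<in> ?N - {x}" for z using link that lw by blast
    have "linked z z' 1" if zz: "z \<in> ?N" "z' \<in> ?N" "z \<noteq> z'" for z z'
    proof -
      consider "z = x" | "z' = x" | "E w z" "E w z'" using zz by blast
      then show ?thesis
      proof cases
        case 1
        then show ?thesis using l1[of z'] zz linked_mono[of x z' "g + 1" 1] by auto
      next
        case 2
        then show ?thesis using l1[of z] zz linked_mono[of x z "g + 1" 1] linked_sym by auto
      qed (rule linkw)
    qed
    moreover have "2 \<le> card ?N"
    proof -
      obtain z where "z \<in> Cy - {x}" "E w z" using True by blast
      then have "card {x, z} \<le> card ?N" "card {x, z} = 2" using finCy by (auto intro!: card_mono)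
      then show ?thesis by simp
    qed
    ultimately have "ported i0 ?N g" unfolding ported_def x_def[symmetric] using l1 xC by blast
    then show ?thesis using True by blast
  next
    case False
    have l: "linked x z0 (g + 1)" by (rule link[OF z0(2)])
    then have "linked x z0 1" "linked z0 x 1" using linked_mono[of x z0 "g + 1" 1] linked_sym by auto
    then have "ported i0 {x, z0} g" unfolding ported_def x_def[symmetric] using l xC z0(1) by auto
    then show ?thesis using False z0(1) by blast
  qed
  then show ?thesis using w unfolding x_def g_def R_def by blast
qed

lemma component_port:
  assumes "r \<in> Out"
  obtains r1 i0 where "r1 \<in> component E Out r" "E r1 (f i0)"
proof -
  have "component E Out r \<noteq> {}" using component_self[of r E Out] by blast
  then obtain a b where ab: "a \<in> component E Out r" "b \<in> (component E Out r \<union> Cy) - component E Out r" "E a b"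
    using component_edge[OF assms order_refl, of r] by blast
  then obtain i where "b = f i" by blast
  then show ?thesis using that ab by blast
qed

end

context clique_frame
begin

lemma X_minus_le: "card (X - N) \<le> card X"
  using finCy by (intro card_mono) auto

text \<open>For the dominated vertex \<open>w\<close>, the neighbours in \<open>U\<close> and the
  vertices of \<open>N\<close> together number at most
  \<open>card (X - N) + 1 \<le> d\<close>.\<close>

lemma low_degree_vertex:
  assumes U: "U \<subseteq> Out" "U \<noteq> {}"
  shows "\<exists>w\<in>U. card {z \<in> U \<union> Cy. E w z} \<le> d"
proof -
  obtain r where r: "r \<in> U" using U by blast
  have rO: "r \<in> Out" using r U by blast
  obtain r1 i0 where e: "r1 \<in> component E Out r" "E r1 (f i0)" using component_port[OF rO] by blast
  have "U \<inter> component E Out r \<noteq> {}" using r component_self[of r E Out] by blast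
  then obtain w where w: "w \<in> U" and
    "(\<exists>z\<in>Cy - {f i0}. E w z) \<and> ported i0 (insert (f i0) {z \<in> Cy. E w z}) (card {z \<in> U. E w z}) \<or>
    {z \<in> Cy. E w z} \<subseteq> {f i0} \<and> (\<exists>z\<in>Cy - {f i0}. ported i0 {f i0, z} (card {z \<in> U. E w z}))"
    using dominated_vertex[OF U(1) rO _ e] by blast
  then obtain N where N: "ported i0 N (card {z \<in> U. E w z})" "{z \<in> Cy. E w z} \<subseteq> N" by blast
  have "finite N" by (rule finite_subset[OF N_Cy[OF N(1)] finCy])
  have "card {z \<in> U \<union> Cy. E w z} \<le> card ({z \<in> U. E w z} \<union> N)"
    using N(2) \<open>finite N\<close> fin_Out[OF U(1)] by (intro card_mono) auto
  also have "\<dots> \<le> card {z \<in> U. E w z} + card N" by (rule card_Un_le)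
  also have "\<dots> \<le> card (X - N) + 1" by (rule port_count[OF N(1)])
  also have "\<dots> \<le> d" using X_minus_le[of N] cardX by linarith
  finally show ?thesis using w by blast
qed

text \<open>Minimum degree \<open>d\<close> meets the upper bound \<open>d\<close> of the port
  count. Hence \<open>N\<close> is exactly the set of neighbours of \<open>w\<close> on the cycle;
  in the alternative without a neighbour besides \<open>f i0\<close> the degree would be too
  small.\<close>

lemma tight_vertex:
  assumes deg: "\<And>v. v \<in> V \<Longrightarrow> d \<le> card {z \<in> V. E v z}"
    and r: "r \<in> Out" and e: "r1 \<in> component E Out r" "E r1 (f i0)"
  shows "\<exists>w\<in>component E Out r. ported i0 {z \<in> Cy. E w z} (card {z \<in> component E Out r. E w z}) \<and>
    card {z \<in> component E Out r. E w z} + card {z \<in> Cy. E w z} = d"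
proof -
  let ?R = "component E Out r"
  have RO: "?R \<subseteq> Out" by (rule component_subset[OF r])
  have "?R \<inter> ?R \<noteq> {}" using e(1) by blast
  then obtain w where w: "w \<in> ?R" and
    alt: "(\<exists>z\<in>Cy - {f i0}. E w z) \<and> ported i0 (insert (f i0) {z \<in> Cy. E w z}) (card {z \<in> ?R. E w z}) \<or>
    {z \<in> Cy. E w z} \<subseteq> {f i0} \<and> (\<exists>z\<in>Cy - {f i0}. ported i0 {f i0, z} (card {z \<in> ?R. E w z}))"
    using dominated_vertex[OF RO r _ e] by blast
  let ?g = "card {z \<in> ?R. E w z}"
  have fR: "finite ?R" by (rule fin_Out[OF RO])
  have "{z \<in> V. E w z} \<subseteq> {z \<in> ?R. E w z} \<union> {z \<in> Cy. E w z}" using component_closed[OF r w] by blast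
  then have "card {z \<in> V. E w z} \<le> card ({z \<in> ?R. E w z} \<union> {z \<in> Cy. E w z})"
    using fR finCy by (intro card_mono) auto
  also have "\<dots> \<le> ?g + card {z \<in> Cy. E w z}" by (rule card_Un_le)
  finally have dg: "d \<le> ?g + card {z \<in> Cy. E w z}" using deg[of w] w RO by force
  have bd: "?g + card N \<le> d" if "ported i0 N ?g" for N
    using port_count[OF that] X_minus_le[of N] cardX by linarith
  from alt show ?thesis
  proof
    let ?N = "insert (f i0) {z \<in> Cy. E w z}"
    assume "(\<exists>z\<in>Cy - {f i0}. E w z) \<and> ported i0 ?N ?g"
    then have P: "ported i0 ?N ?g" by blast
    have "card {z \<in> Cy. E w z} \<le> card ?N" using finCy by (intro card_mono) auto
    then have "card {z \<in> Cy. E w z} = card ?N" and t: "?g + card {z \<in> Cy. E w z} = d"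
      using bd[OF P] dg by linarith+
    then have "{z \<in> Cy. E w z} = ?N" using finCy by (intro card_subset_eq) auto
    then show ?thesis using P t w by auto
  next
    assume "{z \<in> Cy. E w z} \<subseteq> {f i0} \<and> (\<exists>z\<in>Cy - {f i0}. ported i0 {f i0, z} ?g)"
    then obtain z where z: "{z \<in> Cy. E w z} \<subseteq> {f i0}" "z \<in> Cy - {f i0}" "ported i0 {f i0, z} ?g" by blast
    have "card {z \<in> Cy. E w z} \<le> card {f i0}" using z(1) by (intro card_mono) auto
    moreover have "card {f i0, z} = 2" using z(2) by auto
    ultimately show ?thesis using bd[OF z(3)] dg by simp
  qed
qed

text \<open>Repeated removal of a vertex with at most \<open>d\<close> neighbours among the
  remaining vertices and the cycle. Ordered pairs are counted, so each edge costs 2.\<close>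

lemma arcs_outside:
  assumes "U \<subseteq> Out"
  shows "card {(a, b). (a \<in> U \<and> b \<in> U \<union> Cy \<or> a \<in> Cy \<and> b \<in> U) \<and> E a b} \<le> 2 * d * card U"
  using assms
proof (induction "card U" arbitrary: U)
  case 0
  then have "U = {}" using fin_Out[OF 0(2)] by simp
  then show ?case by simp
next
  case (Suc m)
  have fU: "finite U" by (rule fin_Out[OF Suc.prems])
  have "U \<noteq> {}" using Suc.hyps(2) by auto
  then obtain w where w: "w \<in> U" "card {z \<in> U \<union> Cy. E w z} \<le> d"
    using low_degree_vertex[OF Suc.prems] by blast
  let ?A = "\<lambda>U. {(a, b). (a \<in> U \<and> b \<in> U \<union> Cy \<or> a \<in> Cy \<and> b \<in> U) \<and> E a b}"
  let ?N = "{z \<in> U \<union> Cy. E w z}"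
  have fN: "finite ?N" using fU finCy by simp
  have cU: "card U = Suc (card (U - {w}))" by (rule card.remove[OF fU w(1)])
  have IH: "card (?A (U - {w})) \<le> 2 * d * card (U - {w})"
    by (rule Suc.hyps(1)) (use Suc.hyps(2) cU Suc.prems in auto)
  have fA: "finite (?A (U - {w}))"
    by (rule finite_subset[of _ "(U \<union> Cy) \<times> (U \<union> Cy)"]) (use fU finCy in auto)
  have "?A U \<subseteq> ?A (U - {w}) \<union> (Pair w ` ?N \<union> (\<lambda>z. (z, w)) ` ?N)" using E_sym by auto
  then have "card (?A U) \<le> card (?A (U - {w}) \<union> (Pair w ` ?N \<union> (\<lambda>z. (z, w)) ` ?N))"
    using fA fN by (intro card_mono) auto
  also have "\<dots> \<le> card (?A (U - {w})) + card (Pair w ` ?N \<union> (\<lambda>z. (z, w)) ` ?N)" by (rule card_Un_le)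
  also have "card (Pair w ` ?N \<union> (\<lambda>z. (z, w)) ` ?N) \<le> card (Pair w ` ?N) + card ((\<lambda>z. (z, w)) ` ?N)"
    by (rule card_Un_le)
  also have "card (Pair w ` ?N) \<le> card ?N" by (rule card_image_le[OF fN])
  also have "card ((\<lambda>z. (z, w)) ` ?N) \<le> card ?N" by (rule card_image_le[OF fN])
  finally have "card (?A U) \<le> card (?A (U - {w})) + 2 * d" using w(2) by simp
  also have "\<dots> \<le> 2 * d * card (U - {w}) + 2 * d" using IH by simp
  finally show ?case unfolding cU by simp
qed

text \<open>With \<open>card Q = c + 1 - d\<close> this is twice \<open>f_fun (card V) d c\<close>:
  the clique, at most \<open>d\<close> edges at each of the \<open>d - 1\<close> vertices of
  \<open>X\<close>, and \<open>d\<close> per vertex outside.\<close>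

lemma arcs_bound:
  assumes Xdeg: "\<And>x. x \<in> X \<Longrightarrow> card {z \<in> Cy. E x z} \<le> d"
  shows "card {(a, b). a \<in> V \<and> b \<in> V \<and> E a b} \<le>
    card Q * (card Q - 1) + 2 * d * (d - 1) + 2 * d * (card V - c)"
proof -
  let ?O = "{(a, b). (a \<in> Out \<and> b \<in> Out \<union> Cy \<or> a \<in> Cy \<and> b \<in> Out) \<and> E a b}"
  let ?Q = "Q \<times> Q - (\<lambda>a. (a, a)) ` Q"
  let ?X1 = "SIGMA x:X. {z \<in> Cy. E x z}"
  let ?X2 = "prod.swap ` ?X1"
  have fQ: "finite Q" by (rule finite_subset[OF QC finCy])
  have fX: "finite X" using finCy by blast
  have fX1: "finite ?X1" using fX finCy by (intro finite_SigmaI) auto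
  have fO: "finite ?O" by (rule finite_subset[of _ "V \<times> V"]) (use finV f_V in auto)
  have "{(a, b). a \<in> V \<and> b \<in> V \<and> E a b} \<subseteq> ?O \<union> (?Q \<union> (?X1 \<union> ?X2))"
  proof (rule subsetI, elim CollectE case_prodE conjE)
    fix p a b assume p: "p = (a, b)" and ab: "a \<in> V" "b \<in> V" "E a b"
    have "a \<noteq> b" using ab E_irr by auto
    consider "a \<in> Out \<or> b \<in> Out" | "a \<in> Q" "b \<in> Q" | "a \<in> X" "b \<in> Cy" | "a \<in> Cy" "b \<in> X"
      using ab by blast
    then show "p \<in> ?O \<union> (?Q \<union> (?X1 \<union> ?X2))"
    proof cases
      case 1
      then have "p \<in> ?O" unfolding p using ab by blast
      then show ?thesis by blast
    next
      case 2
      then have "p \<in> ?Q" unfolding p using \<open>a \<noteq> b\<close> by blast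
      then show ?thesis by blast
    next
      case 3
      then have "p \<in> ?X1" unfolding p using ab by blast
      then show ?thesis by blast
    next
      case 4
      then have "(b, a) \<in> ?X1" using E_sym[OF ab(3)] by blast
      then have "prod.swap (b, a) \<in> ?X2" by (rule imageI)
      then show ?thesis unfolding p by simp
    qed
  qed
  then have "card {(a, b). a \<in> V \<and> b \<in> V \<and> E a b} \<le> card (?O \<union> (?Q \<union> (?X1 \<union> ?X2)))"
    using fO fQ fX1 by (intro card_mono) auto
  also have "\<dots> \<le> card ?O + card (?Q \<union> (?X1 \<union> ?X2))" by (rule card_Un_le)
  also have "card (?Q \<union> (?X1 \<union> ?X2)) \<le> card ?Q + card (?X1 \<union> ?X2)" by (rule card_Un_le)
  also have "card (?X1 \<union> ?X2) \<le> card ?X1 + card ?X2" by (rule card_Un_le)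
  also have "card ?X2 \<le> card ?X1" by (rule card_image_le[OF fX1])
  also have "card ?X1 = (\<Sum>x\<in>X. card {z \<in> Cy. E x z})" by (rule card_SigmaI) (use fX finCy in auto)
  also have "(\<Sum>x\<in>X. card {z \<in> Cy. E x z}) \<le> (\<Sum>x\<in>X. d)" using Xdeg by (intro sum_mono) blast
  also have "(\<Sum>x\<in>X. d) = (d - 1) * d" using cardX by auto
  also have "card ?Q = card Q * card Q - card Q"
  proof -
    have "card ((\<lambda>a. (a, a)) ` Q) = card Q" by (intro card_image) (auto simp: inj_on_def)
    then show ?thesis using fQ by (subst card_Diff_subset) (auto simp: card_cartesian_product)
  qed
  also have "card ?O \<le> 2 * d * card Out" by (rule arcs_outside) simp
  also have "card Out = card V - c" using card_Diff_subset[OF finCy f_V] card_Cy by simp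
  finally show ?thesis by (simp add: algebra_simps diff_mult_distrib2)
qed

end

subsection \<open>The extremal structures for a large clique\<close>

context clique_frame
begin

text \<open>The vertex \<open>f j\<close> is lifted from its place and used as a bridge:
  \<open>L1\<close>, then \<open>j\<close>, then \<open>L2\<close> backwards is a Hamiltonian path
  of the cycle's vertices, which an ear between its ends would extend to a longer cycle.\<close>

lemma splice_aux:
  assumes L1: "L1 \<noteq> []" "hd L1 = a" "last L1 = l" "successively E (map f L1)"
    and L2: "L2 \<noteq> []" "hd L2 = l + 1" "f (last L2) \<in> Q" "successively E (map f L2)"
    and dist: "distinct (L1 @ j # L2)" "set (L1 @ j # L2) = {a..<a + int c}"
    and q: "f j \<in> Q" "E (f l) (f j)" and link: "linked (f a) (f (l + 1)) 1"
  shows False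
proof -
  let ?P = "map f L1 @ f j # rev (map f L2)"
  have dm: "distinct (map f (L1 @ j # L2))" by (rule distinct_map_f[OF dist(1), of a]) (use dist(2) in simp)
  then have dP: "distinct ?P" by auto
  have la: "last L2 \<in> set L2" "hd L2 \<in> set L2" "hd L1 \<in> set L1" using L1(1) L2(1) by auto
  have "f j \<noteq> f (last L2)" using dm la(1) by auto
  then have e: "E (f j) (f (last L2))" using Qclique q(1) L2(3) by blast
  have "successively E (rev (map f L2))"
    using L2(4) by (auto elim!: successively_mono intro: E_sym)
  then have "successively E ?P"
    using L1 L2(1) q(2) e by (simp add: successively_append_iff successively_Cons last_map hd_rev del: successively_rev)
  then have "gpath E Cy (f a) ?P (f (l + 1))"
    unfolding gpath_def using dP L1 L2 by (auto simp: hd_map last_rev)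
  moreover have "f a \<noteq> f (l + 1)" using dm la(2,3) L1(2) L2(2) by auto
  ultimately have "length ?P + 1 \<le> c" using linked_bound[OF link] by blast
  moreover have "length (L1 @ j # L2) = c" using distinct_card[OF dist(1)] dist(2) by simp
  ultimately show False by simp
qed

text \<open>Lifting out \<open>f j\<close> is possible as its two cycle neighbours are adjacent in
  the clique, and it reattaches to the clique vertex at the end of the window. The cases are the
  positions of \<open>j\<close>; if it is itself the last index, \<open>j - 1\<close> becomes the
  end.\<close>

lemma splice:
  assumes "a < l" "l + 1 < a + int c" "a < j" "j < a + int c" "j \<noteq> l" "j \<noteq> l + 1"
    and Q: "f (j - 1) \<in> Q" "f (j + 1) \<in> Q" "f j \<in> Q" "f (a - 1) \<in> Q" and e: "E (f l) (f j)"
    and link: "linked (f a) (f (l + 1)) 1"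
  shows False
proof -
  have ej: "E (f (j - 1)) (f (j + 1))"
    using Qclique[OF Q(1,2)] f_neq[of "j - 1" "j + 1"] c3 by simp
  have fa: "f (a + int c - 1) \<in> Q" using Q(4) f_periodic[of "a - 1"] by (simp add: algebra_simps)
  consider "j < l" | "l + 1 < j" "j < a + int c - 1" | "j = a + int c - 1" using assms by linarith
  then show False
  proof cases
    case 1
    have s: "successively E (map f ([a..j - 1] @ [j + 1..l]))"
      using arc_succ[of a "j - 1"] arc_succ[of "j + 1" l] ej upto_ends[of a "j - 1"]
        upto_ends[of "j + 1" l] 1 assms(3)
      by (auto simp: successively_append_iff last_map hd_map)
    show False
      by (rule splice_aux[OF _ _ _ s _ _ _ arc_succ[of "l + 1" "a + int c - 1"] _ _ Q(3) e link])
        (use 1 assms(1-4) fa upto_ends[of a "j - 1"] upto_ends[of "j + 1" l]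
          upto_ends[of "l + 1" "a + int c - 1"] in auto)
  next
    case 2
    have s: "successively E (map f ([l + 1..j - 1] @ [j + 1..a + int c - 1]))"
      using arc_succ[of "l + 1" "j - 1"] arc_succ[of "j + 1" "a + int c - 1"] ej
        upto_ends[of "l + 1" "j - 1"] upto_ends[of "j + 1" "a + int c - 1"] 2
      by (auto simp: successively_append_iff last_map hd_map)
    show False
      by (rule splice_aux[OF _ _ _ arc_succ[of a l] _ _ _ s _ _ Q(3) e link])
        (use 2 assms(1-4) fa upto_ends[of a l] upto_ends[of "l + 1" "j - 1"]
          upto_ends[of "j + 1" "a + int c - 1"] in auto)
  next
    case 3
    then have "l + 1 \<le> j - 1" using assms by linarith
    then show False
      by (intro splice_aux[OF _ _ _ arc_succ[of a l] _ _ _ arc_succ[of "l + 1" "j - 1"] _ _ Q(3) e link])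
        (use 3 assms(1-4) Q(1) upto_ends[of a l] upto_ends[of "l + 1" "j - 1"] in auto)
  qed
qed

lemma linked_succ_nonadj:
  assumes "linked (f i) (f j) 1" "f i \<noteq> f j"
  shows "\<not> E (f (i + 1)) (f (j + 1))"
proof -
  obtain k where k: "i \<le> k" "k < i + int c" "f k = f j" by (rule f_window[of "f j" i]) auto
  have "i < k" using k assms(2) by (cases "i = k") auto
  have "\<not> E (f (i + 1)) (f (k + 1))"
    by (rule linked_nonadj[OF \<open>i < k\<close> k(2)]) (use assms(1) k(3) in auto)
  then show ?thesis using f_shift[OF k(3), of 1] by simp
qed

context
  assumes deg: "\<And>v. v \<in> V \<Longrightarrow> d \<le> card {z \<in> V. E v z}" and Out_ne: "Out \<noteq> {}"
begin

lemma two_le_d: "2 \<le> d"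
proof -
  obtain r where r: "r \<in> Out" using Out_ne by blast
  obtain r1 i0 where e: "r1 \<in> component E Out r" "E r1 (f i0)" using component_port[OF r] by blast
  obtain w where "ported i0 {z \<in> Cy. E w z} (card {z \<in> component E Out r. E w z})"
    "card {z \<in> component E Out r. E w z} + card {z \<in> Cy. E w z} = d"
    using tight_vertex[OF deg r e] by blast
  then show ?thesis unfolding ported_def by linarith
qed

text \<open>Two consecutive vertices of \<open>X\<close> exclude \<open>g = 0\<close>, where every
  vertex of \<open>X\<close> is followed by a vertex of \<open>N\<close>. So there are two ports and
  \<open>g + 1 = d - 1\<close>.\<close>

lemma tight_arc:
  assumes r: "r \<in> Out" and e: "r1 \<in> component E Out r" "E r1 (f i0)"
    and X2: "f p \<in> X" "f (p + 1) \<in> X"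
  obtains N i j where "f i0 \<in> N" "i < j" "j < i + int c" "N = {f i, f j}" "X = f ` {i<..<j}"
    "j - i = int d" "f i \<in> Q" "f j \<in> Q" "linked (f i) (f j) (d - 1)"
proof -
  obtain w where P: "ported i0 {z \<in> Cy. E w z} (card {z \<in> component E Out r. E w z})"
    and t: "card {z \<in> component E Out r. E w z} + card {z \<in> Cy. E w z} = d"
    using tight_vertex[OF deg r e] by blast
  let ?N = "{z \<in> Cy. E w z}" and ?g = "card {z \<in> component E Out r. E w z}"
  have "?g \<noteq> 0"
  proof
    assume g: "?g = 0"
    have "f (p + 1) \<in> ?N" by (rule X_succ_N[OF P t g X2(1)])
    then show False using X_nbr_back(1)[OF P t] X2(2) by blast
  qed
  then have g1: "1 \<le> ?g" by simp
  have N2: "card ?N = 2" by (rule port_two[OF P t g1])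
  then have g: "?g + 1 = d - 1" using t by linarith
  obtain i j where ij: "i < j" "j < i + int c" "?N = {f i, f j}" "X = f ` {i<..<j}" "j - i = int d"
    "f i \<in> Q" "f j \<in> Q" "linked (f i) (f j) (?g + 1)" by (rule port_arc[OF P t N2])
  have "f i0 \<in> ?N" using P unfolding ported_def by blast
  then show ?thesis using that[of ?N i j] ij unfolding g by blast
qed

text \<open>The two ports of any component are the cycle vertices next to the arc \<open>X\<close>,
  so they are the same for all components. \<open>X\<close> then behaves like one more
  component.\<close>

lemma Z_case:
  assumes X2: "f p \<in> X" "f (p + 1) \<in> X"
  shows "\<exists>u\<in>Q. \<exists>v\<in>Q. u \<noteq> v \<and> (\<forall>w\<in>V - Q. \<exists>K. K \<subseteq> V - Q \<and> w \<in> K \<and> card K + 1 = d \<and>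
    (\<forall>a\<in>K. \<forall>b\<in>V. E a b \<longleftrightarrow> a \<noteq> b \<and> b \<in> K \<union> {u, v}))"
proof -
  obtain r where r: "r \<in> Out" using Out_ne by blast
  obtain r1 i0 where e: "r1 \<in> component E Out r" "E r1 (f i0)" using component_port[OF r] by blast
  obtain N i j where ij: "i < j" "j < i + int c" "X = f ` {i<..<j}" "j - i = int d"
    "f i \<in> Q" "f j \<in> Q" and link: "linked (f i) (f j) (d - 1)"
    by (rule tight_arc[OF r e X2])
  define u where "u = f i"
  define v where "v = f j"
  have uv: "u \<in> Q" "v \<in> Q" "u \<noteq> v" unfolding u_def v_def using ij f_neq by auto
  have att: "f i1 \<in> {u, v}" if s: "s \<in> Out" "s1 \<in> component E Out s" "E s1 (f i1)" for s s1 i1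
  proof -
    obtain N' i' j' where ij': "f i1 \<in> N'" "i' < j'" "j' < i' + int c" "N' = {f i', f j'}" "X = f ` {i'<..<j'}"
      "j' - i' = int d" "f i' \<in> Q" "f j' \<in> Q"
      by (rule tight_arc[OF s X2])
    have "f (i' + 1) \<in> X" unfolding ij'(5) using ij'(6) two_le_d by auto
    then obtain p1 where p1: "f (i' + 1) = f p1" "i < p1" "p1 < j" unfolding ij(3) by auto
    have "f i' = f (p1 - 1)" using f_shift[OF p1(1), of "-1"] by simp
    then have "p1 - 1 = i" using ij'(7) p1 ij(3) by (cases "p1 - 1 = i") auto
    then have "f i' = u" using \<open>f i' = f (p1 - 1)\<close> unfolding u_def by simp
    have "f (j' - 1) \<in> X" unfolding ij'(5) using ij'(6) two_le_d by auto
    then obtain p2 where p2: "f (j' - 1) = f p2" "i < p2" "p2 < j" unfolding ij(3) by auto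
    have "f j' = f (p2 + 1)" using f_shift[OF p2(1), of 1] by simp
    then have "p2 + 1 = j" using ij'(8) p2 ij(3) by (cases "p2 + 1 = j") auto
    then have "f j' = v" using \<open>f j' = f (p2 + 1)\<close> unfolding v_def by simp
    then show ?thesis using \<open>f i' = u\<close> ij'(1,4) by simp
  qed
  have outnb: "b \<in> component E Out s \<union> {u, v}" if s: "s \<in> Out" and a: "a \<in> component E Out s" "b \<in> V" "E a b" for s a b
  proof (cases "b \<in> Cy")
    case True
    then obtain i1 where "b = f i1" by blast
    then show ?thesis using att[OF s a(1)] a(3) by blast
  next
    case False
    then show ?thesis using component_closed[OF s a(1)] a by blast
  qed
  have fQ: "finite Q" by (rule finite_subset[OF QC finCy])
  have fX: "finite X" using finCy by blast
  have uvX: "u \<notin> X" "v \<notin> X" using uv by auto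
  \<comment> \<open>An edge from \<open>X\<close> to a third clique vertex \<open>b\<close> gives
    the path from \<open>u\<close> along the arc to \<open>x\<close>, then \<open>b\<close>, the
    rest of the clique and \<open>v\<close>, with at least \<open>card Q + 1\<close> vertices.
    Together with an ear of \<open>d - 1\<close> vertices this makes \<open>c + 1\<close>.\<close>
  have Xnb: "b \<in> X \<union> {u, v}" if x: "x \<in> X" "b \<in> V" "E x b" for x b
  proof (rule ccontr)
    assume nb: "b \<notin> X \<union> {u, v}"
    show False
    proof (cases "b \<in> Cy")
      case False
      then have bO: "b \<in> Out" using x by blast
      obtain i1 where "x = f i1" using x by blast
      then have "x \<in> {u, v}" using att[OF bO component_self, of i1] E_sym[OF x(3)] by blast
      then show False using x uv by blast
    next
      case True
      then have bQ: "b \<in> Q - {u, v}" using nb by blast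
      obtain k where k: "i < k" "k < j" "x = f k" using x(1) unfolding ij(3) by auto
      obtain qs where qs: "set qs = Q - {u, v, b}" "distinct qs" using finite_distinct_list[of "Q - {u, v, b}"] fQ by blast
      let ?A = "map f [i..k]" and ?B = "b # qs @ [v]"
      have up: "hd [i..k] = i" "last [i..k] = k" "[i..k] \<noteq> []" using upto_ends[of i k] k by auto
      have Aset: "set ?A \<subseteq> insert u X"
      proof
        fix z assume "z \<in> set ?A"
        then obtain m where m: "z = f m" "i \<le> m" "m \<le> k" by auto
        then show "z \<in> insert u X" unfolding ij(3) u_def using k by (cases "m = i") auto
      qed
      have dA: "distinct ?A" by (rule distinct_map_f[where a = i]) (use k ij in auto)
      have dB: "distinct ?B" using qs bQ uv by auto
      have Bset: "set ?B = Q - {u}" using qs bQ uv by auto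
      have "successively E ?B"
        by (rule successively_clique[OF dB]) (unfold Bset, use Qclique in blast)
      then have "successively E (?A @ ?B)"
        using arc_succ[of i k] up k(3) x(3) by (auto simp: successively_append_iff last_map)
      moreover have "distinct (?A @ ?B)" using dA dB Aset Bset by auto
      moreover have "set (?A @ ?B) \<subseteq> Cy" using Aset Bset QC uv by auto
      ultimately have "gpath E Cy u (?A @ ?B) v" unfolding gpath_def using up by (auto simp: hd_map u_def)
      then have "length (?A @ ?B) + (d - 1) \<le> c"
        using linked_bound[OF link] uv unfolding u_def v_def by blast
      moreover have "length ?B = card Q - 1" using distinct_card[OF dB] Bset uv(1) fQ by simp
      moreover have "length ?A \<ge> 2" using k by simp
      ultimately show False using cardQ two_le_d by simp
    qed
  qed
  \<comment> \<open>Only \<open>d - 2\<close> other vertices of \<open>X\<close> and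
    \<open>u\<close>, \<open>v\<close> are possible neighbours; minimum degree \<open>d\<close>
    needs all of them.\<close>
  have Xadj: "E x b" if x: "x \<in> X" "b \<in> X \<union> {u, v}" "b \<noteq> x" for x b
  proof (rule ccontr)
    assume "\<not> E x b"
    then have "{z \<in> V. E x z} \<subseteq> (X \<union> {u, v}) - {x, b}" using Xnb[OF x(1)] E_irr by blast
    then have "card {z \<in> V. E x z} \<le> card ((X \<union> {u, v}) - {x, b})" using fX by (intro card_mono) auto
    also have "\<dots> = card (X \<union> {u, v}) - card {x, b}" using x fX by (intro card_Diff_subset) auto
    also have "card (X \<union> {u, v}) = card X + 2" using fX uvX uv by (subst card_Un_disjoint) auto
    also have "card {x, b} = 2" using x by simp
    finally show False using deg[of x] x(1) f_V cardX by force
  qed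
  have comp: "card (component E Out s) + 1 = d \<and>
    (\<forall>a\<in>component E Out s. \<forall>b\<in>component E Out s \<union> {u, v}. a \<noteq> b \<longrightarrow> E a b)" if s: "s \<in> Out" for s
  proof -
    let ?R = "component E Out s"
    have RO: "?R \<subseteq> Out" by (rule component_subset[OF s])
    have uvR: "u \<notin> ?R" "v \<notin> ?R" using RO uv QC by blast+
    have uvC: "u \<in> Cy" "v \<in> Cy" using uv QC by blast+
    show ?thesis
    \<comment> \<open>The clique provides a path from \<open>u\<close> to \<open>v\<close> with
      \<open>c + 1 - d\<close> vertices. Ears therefore have at most \<open>d - 1\<close> inner
      vertices, which is the path bound for \<open>\<delta> = d\<close>.\<close>
    proof (rule clique_if_paths_short[OF fin_Out[OF RO] sym irr uvR uv(3) _ connected_on_component[OF sym s]])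
      show "?R \<noteq> {}" using component_self[of s E Out] by blast
      show "rooted E (?R \<union> {u, v}) ?R u v" unfolding rooted_def
      proof (intro allI impI)
        fix D v0 assume D: "D \<subseteq> ?R \<union> {u, v} - {u, v}" "D \<inter> ?R \<noteq> {}"
        then have D': "D \<subseteq> ?R" "D \<noteq> {}" by blast+
        obtain a b where ab: "a \<in> D" "b \<in> (?R \<union> Cy) - D - {v0}" "E a b"
          using component_edge[OF s D', of v0] by blast
        have "b \<in> V" using ab(2) RO f_V by blast
        then have "b \<in> ?R \<union> {u, v}" using outnb[OF s _ _ ab(3)] ab(1) D' by blast
        then show "\<exists>a\<in>D. \<exists>b\<in>?R \<union> {u, v} - D - {v0}. E a b" using ab by blast
      qed
      show "d \<le> card {z \<in> ?R \<union> {u, v}. E q z}" if q: "q \<in> ?R" for q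
      proof -
        have "{z \<in> V. E q z} \<subseteq> {z \<in> ?R \<union> {u, v}. E q z}" using outnb[OF s q] by blast
        then have "card {z \<in> V. E q z} \<le> card {z \<in> ?R \<union> {u, v}. E q z}"
          using fin_Out[OF RO] by (intro card_mono) auto
        moreover have "q \<in> V" using q RO by blast
        ultimately show ?thesis using deg[of q] by linarith
      qed
      show "length P \<le> d + 1" if P: "gpath E (?R \<union> {u, v}) u P v" for P
      proof -
        obtain P1 where P1: "P = u # P1" using P unfolding gpath_def by (cases P) auto
        have "P1 \<noteq> []" using P uv unfolding P1 gpath_def by auto
        then have "P1 = butlast P1 @ [v]" using P append_butlast_last_id[of P1] unfolding P1 gpath_def by auto
        then obtain rs where rs: "P = u # rs @ [v]" using P1 by blast
        show ?thesis
        proof (cases "rs = []")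
          case True
          then show ?thesis using rs two_le_d by simp
        next
          case False
          have "set rs \<subseteq> ?R" using P unfolding gpath_def rs by auto
          then have "linked u v (length rs)" unfolding linked_def using P False RO
            unfolding gpath_def rs
            by (intro exI[of _ rs]) (auto simp: successively_Cons successively_append_iff)
          obtain qs where qs: "set qs = Q - {u, v}" "distinct qs" using finite_distinct_list[of "Q - {u, v}"] fQ by blast
          let ?B = "u # qs @ [v]"
          have dB: "distinct ?B" using qs uv by auto
          have Bset: "set ?B = Q" using qs uv by auto
          have "successively E ?B"
            by (rule successively_clique[OF dB]) (unfold Bset, use Qclique in blast)
          then have "gpath E Cy u ?B v" unfolding gpath_def using dB Bset QC by auto
          then have "length ?B + length rs \<le> c"
            using linked_bound[OF \<open>linked u v (length rs)\<close> uvC uv(3)] by blast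
          moreover have "length ?B = card Q" using distinct_card[OF dB] Bset by simp
          ultimately show ?thesis using cardQ unfolding rs by simp
        qed
      qed
    qed
  qed
  have "\<exists>K. K \<subseteq> V - Q \<and> w \<in> K \<and> card K + 1 = d \<and> (\<forall>a\<in>K. \<forall>b\<in>V. E a b \<longleftrightarrow> a \<noteq> b \<and> b \<in> K \<union> {u, v})"
    if w: "w \<in> V - Q" for w
  proof (cases "w \<in> Cy")
    case True
    have "E a b \<longleftrightarrow> a \<noteq> b \<and> b \<in> X \<union> {u, v}" if "a \<in> X" "b \<in> V" for a b
      using Xnb[OF that] Xadj[OF that(1)] E_irr by blast
    then show ?thesis using True w cardX f_V by (intro exI[of _ X]) blast
  next
    case False
    then have s: "w \<in> Out" using w by blast
    let ?R = "component E Out w"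
    have RO: "?R \<subseteq> Out" by (rule component_subset[OF s])
    have "E a b \<longleftrightarrow> a \<noteq> b \<and> b \<in> ?R \<union> {u, v}" if "a \<in> ?R" "b \<in> V" for a b
      using outnb[OF s that] comp[OF s] that(1) E_irr by blast
    moreover have "?R \<subseteq> V - Q" using RO QC by blast
    ultimately show ?thesis using comp[OF s] component_self[of w E Out] by (intro exI[of _ ?R]) blast
  qed
  then show ?thesis using uv by blast
qed

text \<open>A component with an edge would make \<open>X\<close> an arc with two consecutive
  vertices, so components are single vertices. Each has \<open>d\<close> neighbours, including all
  cycle neighbours of \<open>X\<close>; as there are at least \<open>d\<close> of these, all outside
  vertices have the same neighbourhood.\<close>

lemma W_case:
  assumes noX2: "\<And>p. f p \<in> X \<Longrightarrow> f (p + 1) \<notin> X"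
  shows "\<exists>S\<subseteq>Q. card S = d \<and> (\<forall>a\<in>V. \<forall>b\<in>V. E a b \<longleftrightarrow>
    a \<noteq> b \<and> (a \<in> Q \<and> b \<in> Q \<or> a \<in> S \<and> b \<notin> Q \<or> a \<notin> Q \<and> b \<in> S))"
proof -
  have fX: "finite X" using finCy by blast
  have tight: "component E Out r = {r} \<and> card {z \<in> Cy. E r z} = d \<and> {z \<in> Cy. E r z} \<subseteq> Q \<and>
      (\<forall>p. f p \<in> X \<longrightarrow> f (p + 1) \<in> {z \<in> Cy. E r z} \<and> f (p - 1) \<in> {z \<in> Cy. E r z})"
    if r: "r \<in> Out" for r
  proof -
    let ?R = "component E Out r"
    obtain r1 i0 where e: "r1 \<in> ?R" "E r1 (f i0)" using component_port[OF r] by blast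
    obtain w where w: "w \<in> ?R" and P: "ported i0 {z \<in> Cy. E w z} (card {z \<in> ?R. E w z})"
      and t: "card {z \<in> ?R. E w z} + card {z \<in> Cy. E w z} = d"
      using tight_vertex[OF deg r e] by blast
    let ?N = "{z \<in> Cy. E w z}" and ?g = "card {z \<in> ?R. E w z}"
    have g: "?g = 0"
    proof (rule ccontr)
      assume "?g \<noteq> 0"
      then have g1: "1 \<le> ?g" by simp
      have N2: "card ?N = 2" by (rule port_two[OF P t g1])
      obtain i j where ij: "i < j" "X = f ` {i<..<j}" "j - i = int d"
        by (rule port_arc[OF P t N2])
      have "3 \<le> d" using t N2 g1 by linarith
      then have "f (i + 1) \<in> X" "f (i + 1 + 1) \<in> X" unfolding ij(2) using ij(3) by auto
      then show False using noX2 by blast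
    qed
    have fR: "finite ?R" by (rule fin_Out[OF component_subset[OF r]])
    have Rw: "{w} = ?R"
    proof (rule ccontr)
      assume "{w} \<noteq> ?R"
      then obtain b where "b \<in> ?R" "E w b"
        using connected_on_component[OF sym r] w unfolding connected_on_def by blast
      then show False using g fR by auto
    qed
    have "r \<in> {w}" unfolding Rw by (rule component_self)
    then have "w = r" by simp
    moreover from this have "?R = {r}" using Rw by simp
    moreover have "?N \<subseteq> Q" using X_nbr_back(1)[OF P t] by blast
    ultimately show ?thesis using t g X_succ_N[OF P t g] X_pred_N[OF P t g] by auto
  qed
  define S where "S = (\<lambda>p. f (p + 1)) ` {p. f p \<in> X} \<union> (\<lambda>p. f (p - 1)) ` {p. f p \<in> X}"
  have SN: "S \<subseteq> {z \<in> Cy. E r z}" if "r \<in> Out" for r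
    using tight[OF that] unfolding S_def by auto
  obtain r0 where r0: "r0 \<in> Out" using Out_ne by blast
  let ?N = "{z \<in> Cy. E r0 z}"
  have fS: "finite S" using SN[OF r0] finCy finite_subset[of S Cy] by blast
  let ?T = "(\<lambda>p. f (p + 1)) ` {p. f p \<in> X}"
  have TS: "?T \<subseteq> S" unfolding S_def by (rule Un_upper1)
  have cT: "card ?T + 1 = d" using card_shift[of X 1] cardX by simp
  \<comment> \<open>If predecessors of \<open>X\<close> contributed nothing beyond successors,
    \<open>X\<close> and its successors would be closed under succession and fill the cycle,
    although \<open>2 * (d - 1) < c\<close>.\<close>
  have "card S \<noteq> card ?T"
  proof
    assume "card S = card ?T"
    then have ST: "?T = S" using card_subset_eq[OF fS TS] by simp
    have XS: "f (p + 1) \<in> X \<union> ?T" if "f p \<in> X \<union> ?T" for p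
    proof (cases "f p \<in> X")
      case False
      then have "f p \<in> ?T" using that by simp
      then obtain q where "f p = f (q + 1)" "q \<in> {p. f p \<in> X}" by (rule imageE)
      then have q: "f q \<in> X" "f p = f (q + 1)" by simp_all
      have "f (q + 1) \<in> S" by (rule subsetD[OF TS imageI]) (use q in simp)
      show ?thesis
      proof (rule ccontr)
        assume no: "f (p + 1) \<notin> X \<union> ?T"
        let ?T' = "(\<lambda>p. f (p - 1)) ` {p. f p \<in> X}"
        have "?T' \<subseteq> S" unfolding S_def by (rule Un_upper2)
        moreover have "card ?T' = card ?T"
          using card_shift[of X "-1"] card_shift[of X 1] by simp
        ultimately have "?T' = S" using card_subset_eq[OF fS] ST by metis
        then have "f (q + 1) \<in> ?T'" using \<open>f (q + 1) \<in> S\<close> by simp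
        then obtain m where "f (q + 1) = f (m - 1)" "m \<in> {p. f p \<in> X}" by (rule imageE)
        then have m: "f m \<in> X" "f (q + 1) = f (m - 1)" by simp_all
        then have "f (p + 1) = f m" using q(2) f_shift[of p "m - 1" 1] by simp
        then show False using no m by simp
      qed
    next
      case True
      then have "f (p + 1) \<in> ?T" by (intro imageI) simp
      then show ?thesis by (rule UnI2)
    qed
    have "X \<noteq> {}"
    proof
      assume "X = {}"
      then have "card X = 0" by (simp only: card.empty)
      then show False using cardX two_le_d by linarith
    qed
    then obtain x0 where "x0 \<in> X" by blast
    moreover from this obtain p0 where "x0 = f p0" by blast
    ultimately have p0: "f p0 \<in> X" by simp
    have all: "f (p0 + int n) \<in> X \<union> ?T" for n
    proof (induction n)
      case (Suc n)
      then show ?case using XS[of "p0 + int n"] by (simp add: ac_simps)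
    qed (use p0 in simp)
    have "Cy \<subseteq> X \<union> ?T"
    proof
      fix z assume "z \<in> Cy"
      then obtain k where k: "p0 \<le> k" "f k = z" by (rule f_window[of z p0])
      then show "z \<in> X \<union> ?T" using all[of "nat (k - p0)"] by simp
    qed
    then have "card Cy \<le> card (X \<union> ?T)" using fX finite_subset[OF TS fS] by (intro card_mono) simp_all
    also have "\<dots> \<le> card X + card ?T" by (rule card_Un_le)
    finally show False using card_Cy cT cardX d_small by linarith
  qed
  then have "card ?T < card S" using card_mono[OF fS TS] by linarith
  then have "d \<le> card S" using cT by linarith
  have NS: "{z \<in> Cy. E r z} = S" if r: "r \<in> Out" for r
    using card_seteq[OF _ SN[OF r]] tight[OF r] \<open>d \<le> card S\<close> finCy by simp
  have cS: "card S = d" and SQ: "S \<subseteq> Q" using tight[OF r0] NS[OF r0] by auto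
  have outout: "\<not> E a b" if "a \<in> Out" "b \<in> Out" for a b
  proof
    assume ab: "E a b"
    then have "b \<in> component E Out a" by (rule component_closed[OF that(1) component_self that(2)])
    then have "b = a" using tight[OF that(1)] by simp
    then show False using ab E_irr by simp
  qed
  have Sucp: "f (p + 1) \<in> S" "f (p - 1) \<in> S" if "f p \<in> X" for p
    using that unfolding S_def by simp_all
  have linkS: "linked z z' 1" if "z \<in> S" "z' \<in> S" for z z'
  proof -
    have "E r0 z" "E r0 z'" using that unfolding NS[OF r0, symmetric] by simp_all
    then show ?thesis unfolding linked_def using r0 E_sym by (intro exI[of _ "[r0]"]) auto
  qed
  \<comment> \<open>A vertex of \<open>S\<close> whose predecessor is not in \<open>X\<close> serves
    as start \<open>a\<close> of the window in \<open>splice\<close>: the window then ends in the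
    clique.\<close>
  have "S - ?T \<noteq> {}"
  proof
    assume "S - ?T = {}"
    then have "S = ?T" by (intro subset_antisym TS) simp
    then show False using \<open>card S \<noteq> card ?T\<close> by (simp only:)
  qed
  then obtain z1 where z: "z1 \<in> S" "z1 \<notin> ?T" by (metis DiffE ex_in_conv)
  then have "z1 \<in> Cy" by (intro subsetD[OF QC] subsetD[OF SQ])
  then obtain a where a: "z1 = f a" by blast
  have aS: "f a \<in> S" using z(1) a by simp
  have aQ: "f (a - 1) \<in> Q"
  proof (rule ccontr)
    assume "f (a - 1) \<notin> Q"
    then have "f (a - 1 + 1) \<in> ?T" by (intro imageI) simp
    then have "z1 \<in> ?T" unfolding a by (simp only: diff_add_cancel)
    with z(2) show False by contradiction
  qed
  \<comment> \<open>For a neighbour in \<open>X\<close>, both predecessors lie in \<open>S\<close>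
    and are linked, which forbids the edge. A neighbour in \<open>Q - S\<close> has no cycle
    neighbour in \<open>X\<close>, so it can be spliced out.\<close>
  have Xnb: "b \<in> S" if x: "x \<in> X" "b \<in> V" "E x b" for x b
  proof (rule ccontr)
    assume nS: "b \<notin> S"
    have bC: "b \<in> Cy"
    proof (rule ccontr)
      assume "b \<notin> Cy"
      then have "b \<in> Out" using x by simp
      then have "x \<in> S" unfolding NS[OF \<open>b \<in> Out\<close>, symmetric] using x E_sym by simp
      then show False using SQ x by auto
    qed
    obtain l where l: "a \<le> l" "l < a + int c" "f l = x" by (rule f_window[of x a]) (use x in auto)
    obtain j where j: "a \<le> j" "j < a + int c" "f j = b" by (rule f_window[of b a]) (use bC in auto)
    show False
    proof (cases "b \<in> Q")
      case False
      then have bX: "b \<in> X" using bC by simp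
      have ne: "f (l - 1) \<noteq> f (j - 1)"
      proof
        assume "f (l - 1) = f (j - 1)"
        then have "x = b" using f_shift[of "l - 1" "j - 1" 1] l j by simp
        then show False using x E_irr by blast
      qed
      have "f (l - 1) \<in> S" "f (j - 1) \<in> S" using Sucp[of l] Sucp[of j] l j x bX by auto
      then show False using linked_succ_nonadj[of "l - 1" "j - 1"] linkS ne x l j by simp
    next
      case True
      have "f a \<notin> X" using aS SQ by auto
      then have al: "a < l" using l x by (cases "a = l") auto
      have l1: "l + 1 < a + int c"
      proof (rule ccontr)
        assume "\<not> ?thesis"
        then have "l = a - 1 + int c" using l by simp
        then have "f l = f (a - 1)" using f_periodic by simp
        then show False using aQ l x by auto
      qed
      have aj: "a < j" using j nS aS by (cases "a = j") auto
      have "f (l + 1) \<in> S" using Sucp[of l] l x by auto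
      have jl: "j \<noteq> l" "j \<noteq> l + 1" using l j x True \<open>f (l + 1) \<in> S\<close> nS by auto
      have "f (j + 1) \<in> Q"
      proof (rule ccontr)
        assume "f (j + 1) \<notin> Q"
        then have "f (j + 1 - 1) \<in> S" by (intro Sucp) auto
        then show False using nS j by simp
      qed
      moreover have "f (j - 1) \<in> Q"
      proof (rule ccontr)
        assume "f (j - 1) \<notin> Q"
        then have "f (j - 1 + 1) \<in> S" by (intro Sucp) auto
        then show False using nS j by simp
      qed
      ultimately show False
        using splice[OF al l1 aj j(2) jl] True aQ j l x linkS[OF aS \<open>f (l + 1) \<in> S\<close>] by auto
    qed
  qed
  have Xadj: "E x b \<longleftrightarrow> b \<in> S" if x: "x \<in> X" "b \<in> V" for x b
  proof -
    have "{z \<in> V. E x z} \<subseteq> S" using Xnb[OF x(1)] by auto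
    moreover have "x \<in> V" using x f_V by auto
    ultimately have "{z \<in> V. E x z} = S" using card_seteq[OF fS] deg[of x] cS by simp
    then show ?thesis using x by blast
  qed
  have "E p q \<longleftrightarrow> p \<noteq> q \<and> (p \<in> Q \<and> q \<in> Q \<or> p \<in> S \<and> q \<notin> Q \<or> p \<notin> Q \<and> q \<in> S)"
    if pq: "p \<in> V" "q \<in> V" for p q
  proof -
    have low: "E p q \<longleftrightarrow> q \<in> S" if p: "p \<in> V - Q" "q \<in> V" for p q
    proof (cases "p \<in> Cy")
      case True
      then show ?thesis using Xadj[of p q] p by simp
    next
      case False
      then have pO: "p \<in> Out" using p by simp
      show ?thesis
      proof (cases "q \<in> Cy")
        case True
        then show ?thesis unfolding NS[OF pO, symmetric] by simp
      next
        case False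
        then have "q \<notin> S" using SQ QC by auto
        then show ?thesis using outout[OF pO] p(2) False by simp
      qed
    qed
    show ?thesis
    proof (cases "p \<in> Q")
      case True
      show ?thesis
      proof (cases "q \<in> Q")
        case True2: True
        then show ?thesis using Qclique[OF True True2] E_irr True by blast
      next
        case False
        then show ?thesis using low[of q p] pq True E_sym by blast
      qed
    next
      case False
      then show ?thesis using low[of p q] pq SQ by blast
    qed
  qed
  then show ?thesis using SQ cS by blast
qed

end

end

subsection \<open>Dense cycles without a large clique\<close>

text \<open>A partition into paths with one or two vertices, kept as lists because the parts become
  segments of a path.\<close>

definition parts :: "('a \<Rightarrow> 'a \<Rightarrow> bool) \<Rightarrow> 'a set \<Rightarrow> 'a list list \<Rightarrow> bool" where
  "parts E F Ps \<longleftrightarrow> distinct (concat Ps) \<and> set (concat Ps) = F \<and>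
     (\<forall>P\<in>set Ps. (\<exists>a. P = [a]) \<or> (\<exists>a b. P = [a, b] \<and> E a b))"

lemma parts_Cons:
  "parts E F (P # Ps) \<longleftrightarrow> ((\<exists>a. P = [a]) \<or> (\<exists>a b. P = [a, b] \<and> E a b)) \<and> set P \<subseteq> F \<and> distinct P \<and>
     parts E (F - set P) Ps"
  unfolding parts_def by auto

lemma parts_perm:
  assumes "parts E F Ps" "P \<in> set Ps"
  obtains Qs where "parts E F (P # Qs)" "length Ps = Suc (length Qs)" "set Ps = insert P (set Qs)"
proof -
  obtain A B where AB: "Ps = A @ P # B" using assms(2) by (meson split_list)
  have "parts E F (P # A @ B)" using assms(1) unfolding parts_def AB by auto
  then show ?thesis using that[of "A @ B"] AB by auto
qed

lemma parts_extract:
  assumes "parts E F Ps" "u \<in> F" "symp E"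
  obtains P Qs where "parts E F (P # Qs)" "length Ps = Suc (length Qs)" "hd P = u"
proof -
  obtain P0 where P0: "P0 \<in> set Ps" "u \<in> set P0" using assms(1,2) unfolding parts_def by auto
  obtain Qs where Qs: "parts E F (P0 # Qs)" "length Ps = Suc (length Qs)"
    using parts_perm[OF assms(1) P0(1)] by blast
  show ?thesis
  proof (cases "hd P0 = u")
    case True
    then show ?thesis using that Qs by blast
  next
    case False
    then obtain a where a: "P0 = [a, u]" "E a u" using Qs(1) P0(2) unfolding parts_Cons by auto
    have "parts E F ([u, a] # Qs)" using Qs(1) a sympD[OF assms(3)] unfolding parts_Cons
      by (auto simp: insert_commute)
    then show ?thesis using that[of "[u, a]" Qs] Qs(2) by simp
  qed
qed

lemma parts_length:
  assumes "parts E F Ps"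
  shows "finite F" "length Ps \<le> card F"
    "card F + length (filter (\<lambda>P. length P = 1) Ps) = 2 * length Ps"
proof -
  show "finite F" using assms unfolding parts_def by blast
  have "card F = length (concat Ps)" using assms distinct_card unfolding parts_def by metis
  moreover have "length (concat Ps) + length (filter (\<lambda>P. length P = 1) Ps) = 2 * length Ps \<and>
    length Ps \<le> length (concat Ps)"
    if "\<forall>P\<in>set Ps. (\<exists>a. P = [a]) \<or> (\<exists>a b. P = [a, b] \<and> E a b)" for Ps
    using that by (induction Ps) auto
  ultimately show "length Ps \<le> card F"
    "card F + length (filter (\<lambda>P. length P = 1) Ps) = 2 * length Ps"
    using assms unfolding parts_def by auto
qed

lemma parts_succ: "parts E F Ps \<Longrightarrow> P \<in> set Ps \<Longrightarrow> P \<noteq> [] \<and> successively E P"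
  unfolding parts_def by fastforce

lemma parts_single: "parts E F Ps \<Longrightarrow> [x] \<in> set Ps \<Longrightarrow> x \<in> F"
proof -
  assume P: "parts E F Ps" "[x] \<in> set Ps"
  have "x \<in> set (concat Ps)" unfolding set_concat by (rule UN_I[OF P(2)]) simp
  moreover have "set (concat Ps) = F" using P(1) unfolding parts_def by (elim conjE)
  ultimately show "x \<in> F" by (simp only:)
qed

lemma disjoint_neq: "A \<inter> B = {} \<Longrightarrow> a \<in> A \<Longrightarrow> b \<in> B \<Longrightarrow> a \<noteq> b"
  by blast

text \<open>Vertices of \<open>ss\<close> and parts alternate, so one more vertex than parts
  suffices; the spare vertices of \<open>ss\<close> follow at the end as a clique.\<close>

lemma weave:
  assumes "parts E F Ps" "distinct ss" "length Ps < length ss" "set ss \<inter> F = {}"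
    "\<And>s z. s \<in> set ss \<Longrightarrow> z \<in> set ss \<union> F \<Longrightarrow> s \<noteq> z \<Longrightarrow> E s z \<and> E z s"
  shows "\<exists>L. gpath E (set ss \<union> F) (hd ss) L (last ss) \<and> length L = length ss + card F"
  using assms
proof (induction Ps arbitrary: ss F)
  case Nil
  then have "F = {}" unfolding parts_def by simp
  moreover have "successively E ss" by (rule successively_clique[OF Nil(2)]) (use Nil(5) in blast)
  ultimately show ?case using Nil by (intro exI[of _ ss]) (auto simp: gpath_def)
next
  case (Cons P Ps)
  obtain s ss' where ss: "ss = s # ss'" using Cons.prems(3) by (cases ss) auto
  have ne: "ss' \<noteq> []" using Cons.prems(3) unfolding ss by auto
  have P: "set P \<subseteq> F" "distinct P" "parts E (F - set P) Ps" "P \<noteq> []" "successively E P"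
    using Cons.prems(1) parts_succ[OF Cons.prems(1), of P] unfolding parts_Cons by auto
  have adj: "E a z \<and> E z a" if "a \<in> set ss'" "z \<in> set ss' \<union> (F - set P)" "a \<noteq> z" for a z
    using Cons.prems(5)[of a z] that unfolding ss by auto
  have "\<exists>L. gpath E (set ss' \<union> (F - set P)) (hd ss') L (last ss') \<and> length L = length ss' + card (F - set P)"
    by (rule Cons.IH[OF P(3)]) (use Cons.prems(2-4) adj ss in auto)
  then obtain L where L: "gpath E (set ss' \<union> (F - set P)) (hd ss') L (last ss')"
    and len: "length L = length ss' + card (F - set P)" by blast
  have fF: "finite F" by (rule parts_length(1)[OF Cons.prems(1)])
  have hl: "hd P \<in> F" "last P \<in> F" using P hd_in_set last_in_set by blast+
  have "s \<in> set ss" unfolding ss by simp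
  moreover from this have "s \<noteq> hd P" by (rule disjoint_neq[OF Cons.prems(4) _ hl(1)])
  ultimately have e1: "E s (hd P)" using Cons.prems(5)[of s "hd P"] hl by simp
  have "hd ss' \<in> set ss" using ne unfolding ss by simp
  moreover from this have "hd ss' \<noteq> last P" by (rule disjoint_neq[OF Cons.prems(4) _ hl(2)])
  ultimately have e2: "E (last P) (hd ss')" using Cons.prems(5)[of "hd ss'" "last P"] hl by simp
  have dis: "s \<notin> set P" "s \<notin> set L" "set P \<inter> set L = {}" 
    using L P Cons.prems(2,4) unfolding gpath_def ss by auto
  have "gpath E (set ss \<union> F) s (s # P @ L) (last ss)"
    using L P e1 e2 dis ne unfolding gpath_def ss
    by (auto simp: successively_Cons successively_append_iff)
  moreover have "length (s # P @ L) = length ss + card F"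
  proof -
    have "card F = card (F - set P) + length P"
      using card_Diff_subset[of "set P" F] P(1) distinct_card[OF P(2)] card_mono[OF fF P(1)] by simp
    then show ?thesis using len unfolding ss by simp
  qed
  ultimately show ?case unfolding ss by (intro exI[of _ "s # P @ L"]) auto
qed

lemma list_of_ends:
  assumes "finite S" "u \<in> S" "v \<in> S" "u \<noteq> v"
  obtains ss where "set ss = S" "distinct ss" "hd ss = u" "last ss = v"
proof -
  obtain xs where xs: "set xs = S - {u, v}" "distinct xs" using finite_distinct_list[of "S - {u, v}"] assms(1) by blast
  show ?thesis by (rule that[of "u # xs @ [v]"]) (use xs assms in auto)
qed

lemma list_of_last:
  assumes "finite S" "v \<in> S"
  obtains ss where "set ss = S" "distinct ss" "last ss = v" "ss \<noteq> []"
proof -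
  obtain xs where xs: "set xs = S - {v}" "distinct xs" using finite_distinct_list[of "S - {v}"] assms(1) by blast
  show ?thesis by (rule that[of "xs @ [v]"]) (use xs assms in auto)
qed

text \<open>The part of \<open>u\<close> starts the path and needs no vertex of \<open>S\<close>
  before it, which saves one vertex compared with \<open>weave\<close>. If \<open>u\<close> and
  \<open>v\<close> form one part, it is split to the two ends; if \<open>v\<close> is in another
  part, that part is put last and reversed.\<close>

lemma join_ham_path:
  assumes P: "parts E F Ps" and S: "finite S" "S \<noteq> {}" "S \<inter> F = {}" and "symp E"
    and univ: "\<And>s z. s \<in> S \<Longrightarrow> z \<in> S \<union> F \<Longrightarrow> s \<noteq> z \<Longrightarrow> E s z"
    and uv: "u \<noteq> v" "u \<in> F" "v \<in> S \<union> F" and len: "length Ps \<le> card S"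
  shows "\<exists>L. gpath E (S \<union> F) u L v \<and> length L = card S + card F"
proof -
  have fF: "finite F" by (rule parts_length(1)[OF P])
  have Esym: "E a b \<Longrightarrow> E b a" for a b using sympD[OF assms(5)] .
  obtain P1 Qs where P1: "parts E F (P1 # Qs)" "length Ps = Suc (length Qs)" "hd P1 = u"
    by (rule parts_extract[OF P uv(2) assms(5)])
  then have p1: "set P1 \<subseteq> F" "distinct P1" "parts E (F - set P1) Qs" "P1 \<noteq> []" "successively E P1"
    using parts_succ[OF P1(1), of P1] unfolding parts_Cons by auto
  have cF: "card F = card (F - set P1) + length P1"
    using card_Diff_subset[of "set P1" F] p1(1) distinct_card[OF p1(2)] card_mono[OF fF p1(1)] by simp
  have uni: "\<And>s z. s \<in> S \<Longrightarrow> z \<in> S \<union> F' \<Longrightarrow> s \<noteq> z \<Longrightarrow> E s z \<and> E z s" if "F' \<subseteq> F" for F'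
    using univ Esym that by blast
  have hl: "last P1 \<in> F" using p1 last_in_set by blast
  show ?thesis
  proof (cases "v \<in> S")
    case True
    obtain ss where ss: "set ss = S" "distinct ss" "last ss = v" "ss \<noteq> []" by (rule list_of_last[OF S(1) True])
    have lss: "length ss = card S" using distinct_card ss by metis
    have "\<exists>L. gpath E (set ss \<union> (F - set P1)) (hd ss) L (last ss) \<and> length L = length ss + card (F - set P1)"
      by (rule weave[OF p1(3) ss(2)]) (use ss(1) S(3) P1(2) len lss uni[of "F - set P1"] in auto)
    then obtain L where L: "gpath E (S \<union> (F - set P1)) (hd ss) L v" "length L = card S + card (F - set P1)"
      using ss lss by auto
    have "hd ss \<in> S" using ss by auto
    moreover from this have "hd ss \<noteq> last P1" by (rule disjoint_neq[OF S(3) _ hl])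
    ultimately have "E (last P1) (hd ss)" using uni[of F "hd ss" "last P1"] hl by simp
    then have "gpath E (S \<union> F) u (P1 @ L) v"
      using L p1 P1(3) S(3) unfolding gpath_def by (auto simp: successively_append_iff)
    then show ?thesis using L(2) cF by (intro exI[of _ "P1 @ L"]) simp
  next
    case False
    then have vF: "v \<in> F" using uv by blast
    have cS: "S \<noteq> {} \<Longrightarrow> 1 \<le> card S" using S(1) by (simp add: Suc_le_eq card_gt_0_iff)
    obtain s where s: "s \<in> S" using S(2) by blast
    show ?thesis
    proof (cases "v \<in> set P1")
      case True
      then have P1eq: "P1 = [u, v]" using P1(1,3) uv(1) unfolding parts_Cons by auto
      obtain ss where ss: "set ss = S" "distinct ss" "ss \<noteq> []"
        using list_of_last[OF S(1) s] by metis
      have lss: "length ss = card S" using distinct_card ss by metis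
      have "\<exists>L. gpath E (set ss \<union> (F - set P1)) (hd ss) L (last ss) \<and> length L = length ss + card (F - set P1)"
        by (rule weave[OF p1(3) ss(2)]) (use ss(1) S(3) P1(2) len lss uni[of "F - set P1"] in auto)
      then obtain L where L: "gpath E (S \<union> (F - set P1)) (hd ss) L (last ss)" "length L = card S + card (F - set P1)"
        using ss lss by auto
      have "hd ss \<in> S" "last ss \<in> S" using ss by auto
      moreover from this have "hd ss \<noteq> u" "last ss \<noteq> v"
        by (rule_tac [!] disjoint_neq[OF S(3)]) (simp_all add: uv(2) vF)
      ultimately have "E u (hd ss)" "E (last ss) v"
        using uni[of F "hd ss" u] uni[of F "last ss" v] uv(2) vF by simp_all
      then have "gpath E (S \<union> F) u (u # L @ [v]) v"
        using L uv vF S(3) unfolding gpath_def P1eq by (auto simp: successively_append_iff successively_Cons)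
      then show ?thesis using L(2) cF unfolding P1eq by (intro exI[of _ "u # L @ [v]"]) simp
    next
      case False
      then have v2: "v \<in> F - set P1" using vF by blast
      obtain P2 Rs where P2: "parts E (F - set P1) (P2 # Rs)" "length Qs = Suc (length Rs)" "hd P2 = v"
        by (rule parts_extract[OF p1(3) v2 assms(5)])
      then have p2: "set P2 \<subseteq> F - set P1" "distinct P2" "parts E (F - set P1 - set P2) Rs" "P2 \<noteq> []" "successively E P2"
        using parts_succ[OF P2(1), of P2] unfolding parts_Cons by auto
      have cF2: "card (F - set P1) = card (F - set P1 - set P2) + length P2"
        using card_Diff_subset[of "set P2" "F - set P1"] p2(1) distinct_card[OF p2(2)]
          card_mono[of "F - set P1" "set P2"] fF by simp
      obtain ss where ss: "set ss = S" "distinct ss" "ss \<noteq> []"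
        using list_of_last[OF S(1) s] by metis
      have lss: "length ss = card S" using distinct_card ss by metis
      let ?F = "F - set P1 - set P2"
      have "\<exists>L. gpath E (set ss \<union> ?F) (hd ss) L (last ss) \<and> length L = length ss + card ?F"
        by (rule weave[OF p2(3) ss(2)]) (use ss(1) S(3) P1(2) P2(2) len lss uni[of ?F] in auto)
      then obtain L where L: "gpath E (S \<union> ?F) (hd ss) L (last ss)" "length L = card S + card ?F"
        using ss lss by auto
      have hs: "hd ss \<in> S" "last ss \<in> S" using ss by auto
      have l2: "last P2 \<in> F" using p2 last_in_set by blast
      have "hd ss \<noteq> last P1" "last ss \<noteq> last P2"
        by (rule disjoint_neq[OF S(3) hs(1) hl], rule disjoint_neq[OF S(3) hs(2) l2])
      then have e: "E (last P1) (hd ss)" "E (last ss) (last P2)"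
        using uni[of F "hd ss" "last P1"] uni[of F "last ss" "last P2"] hl hs l2 by simp_all
      have "successively E (rev P2)" using p2(5) by (auto elim!: successively_mono intro: Esym)
      then have "gpath E (S \<union> F) u (P1 @ L @ rev P2) v"
        using L p1 p2 e P1(3) P2(3) S(3) unfolding gpath_def
        by (auto simp: successively_append_iff hd_rev last_rev simp del: successively_rev)
      then show ?thesis using L(2) cF cF2 by (intro exI[of _ "P1 @ L @ rev P2"]) simp
    qed
  qed
qed

text \<open>Here \<open>U\<close> is the whole component, and only the long ear is kept.\<close>

lemma (in cycle_frame) linked_partner:
  assumes r: "r \<in> Out" and e: "r1 \<in> component E Out r" "E r1 (f i0)"
  obtains w z where "w \<in> component E Out r" "z \<in> Cy" "z \<noteq> f i0"
    "linked (f i0) z (card {z \<in> component E Out r. E w z} + 1)"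
proof -
  let ?R = "component E Out r"
  have "?R \<inter> ?R \<noteq> {}" using e(1) by blast
  from dominated_vertex[OF component_subset[OF r] r this e]
  obtain w where w: "w \<in> ?R \<inter> ?R" and
    alt: "(\<exists>z\<in>Cy - {f i0}. E w z) \<and> ported i0 (insert (f i0) {z \<in> Cy. E w z}) (card {z \<in> ?R. E w z}) \<or>
    {z \<in> Cy. E w z} \<subseteq> {f i0} \<and> (\<exists>z\<in>Cy - {f i0}. ported i0 {f i0, z} (card {z \<in> ?R. E w z}))"
    by (rule bexE)
  note conclude = that
  have use: ?thesis if z: "z \<in> Cy - {f i0}" "z \<in> N" "ported i0 N (card {z \<in> ?R. E w z})" for z N
  proof -
    have "linked (f i0) z (card {z \<in> ?R. E w z} + 1)" using z unfolding ported_def by simp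
    then show ?thesis using conclude[of w z] w z(1) by simp
  qed
  from alt show ?thesis
  proof (elim disjE conjE bexE)
    fix z assume "z \<in> Cy - {f i0}" "E w z" "ported i0 (insert (f i0) {z \<in> Cy. E w z}) (card {z \<in> ?R. E w z})"
    then show ?thesis by (intro use[of z "insert (f i0) {z \<in> Cy. E w z}"]) simp_all
  next
    fix z assume "z \<in> Cy - {f i0}" "ported i0 {f i0, z} (card {z \<in> ?R. E w z})"
    then show ?thesis by (intro use[of z "{f i0, z}"]) simp_all
  qed
qed

section \<open>Degrees in a closed cycle\<close>

locale closed_frame = cycle_frame +
  assumes c6: "6 \<le> c"
    and closed: "\<And>a b. a \<in> range f \<Longrightarrow> b \<in> range f \<Longrightarrow> a \<noteq> b \<Longrightarrow>
      c + 1 \<le> card {z \<in> range f. E a z} + card {z \<in> range f. E b z} \<Longrightarrow> E a b"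
begin

definition Hc :: "'a set" where "Hc = range f"

lemma finH: "finite Hc" and card_H: "card Hc = c"
  unfolding Hc_def by (rule finCy, rule card_Cy)

definition dH :: "'a \<Rightarrow> nat" where "dH a = card {z \<in> Hc. E a z}"
definition t :: nat where "t = c div 2"
definition S :: "'a set" where "S = {v \<in> Hc. c - t + 1 \<le> dH v}"
text \<open>Vertices outside \<open>S\<close> have degree at most \<open>c - t\<close>, so this set
  is empty for even \<open>c\<close>. It collects the vertices that may still have edges outside
  \<open>S\<close> in the extremal situation \<open>p = t\<close>.\<close>

definition Y :: "'a set" where "Y = {v \<in> Hc - S. t + 1 \<le> dH v}"

abbreviation "p \<equiv> card S"
abbreviation "F \<equiv> Hc - S"

lemma closed': "a \<in> Hc \<Longrightarrow> b \<in> Hc \<Longrightarrow> a \<noteq> b \<Longrightarrow> c + 1 \<le> dH a + dH b \<Longrightarrow> E a b"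
  using closed[of a b] unfolding dH_def Hc_def by simp

lemma t_c: "c = 2 * t \<or> c = 2 * t + 1" "3 \<le> t"
  unfolding t_def using c6 by auto

lemma finS: "finite S" and finF: "finite F" and finY: "finite Y"
  using finH unfolding S_def Y_def by auto

lemma SC: "S \<subseteq> Hc" unfolding S_def by blast
lemma YF: "Y \<subseteq> F" unfolding Y_def by blast

lemma dH_less: "a \<in> Hc \<Longrightarrow> dH a + 1 \<le> c"
proof -
  assume a: "a \<in> Hc"
  have "{z \<in> Hc. E a z} \<subseteq> Hc - {a}" using E_irr by blast
  then have "dH a \<le> card (Hc - {a})" unfolding dH_def using finH by (intro card_mono) auto
  then show ?thesis using a finH card_H c3 by simp
qed

lemma F_le: "x \<in> F \<Longrightarrow> dH x \<le> c - t"
  unfolding S_def by auto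

lemma S_clique: "a \<in> S \<Longrightarrow> b \<in> S \<Longrightarrow> a \<noteq> b \<Longrightarrow> E a b"
  using closed'[of a b] t_c unfolding S_def by auto

lemma high_adj: "s \<in> S \<Longrightarrow> x \<in> Hc \<Longrightarrow> s \<noteq> x \<Longrightarrow> t \<le> dH x \<Longrightarrow> E s x"
  using closed'[of s x] t_c unfolding S_def by auto

lemma SY_clique:
  assumes "a \<in> S \<union> Y" "b \<in> S \<union> Y" "a \<noteq> b" shows "E a b"
proof -
  have "t + 1 \<le> dH z \<and> z \<in> Hc" if "z \<in> S \<union> Y" for z
    using that t_c unfolding S_def Y_def by auto
  then have "t + 1 \<le> dH a" "t + 1 \<le> dH b" "a \<in> Hc" "b \<in> Hc" using assms by simp_all
  then show ?thesis using assms(3) t_c by (intro closed') linarith+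
qed

text \<open>A vertex of \<open>Y\<close> has degree between \<open>t + 1\<close> and
  \<open>c - t\<close>, which needs odd \<open>c\<close> and then makes it exactly
  \<open>t + 1\<close>. Being adjacent to all other vertices of \<open>S \<union> Y\<close>, it
  bounds the size of that clique.\<close>

lemma Y_card:
  assumes "Y \<noteq> {}" shows "c = 2 * t + 1" "p + card Y \<le> t + 2"
proof -
  obtain y where y: "y \<in> Y" using assms by blast
  have le: "dH y \<le> c - t" "t + 1 \<le> dH y" using y F_le unfolding Y_def by auto
  then show c: "c = 2 * t + 1" using t_c by linarith
  have "(S \<union> Y) - {y} \<subseteq> {z \<in> Hc. E y z}" using SY_clique[of y] y SC YF by blast
  then have "card ((S \<union> Y) - {y}) \<le> dH y" unfolding dH_def using finH by (intro card_mono) auto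
  moreover have "card ((S \<union> Y) - {y}) = card (S \<union> Y) - 1" using y finS finY by simp
  moreover have "card (S \<union> Y) = p + card Y" using finS finY YF by (intro card_Un_disjoint) auto
  ultimately show "p + card Y \<le> t + 2" using le c by linarith
qed

lemma arcs_sum: "card {(a, b). a \<in> Hc \<and> b \<in> Hc \<and> E a b} = (\<Sum>a\<in>S. dH a) + (\<Sum>a\<in>F. dH a)"
proof -
  have "{(a, b). a \<in> Hc \<and> b \<in> Hc \<and> E a b} = (SIGMA a:Hc. {z \<in> Hc. E a z})" by blast
  then have "card {(a, b). a \<in> Hc \<and> b \<in> Hc \<and> E a b} = (\<Sum>a\<in>Hc. dH a)"
    unfolding dH_def using finH by (simp add: card_SigmaI)
  also have "Hc = S \<union> F" using SC by blast
  then have "(\<Sum>a\<in>Hc. dH a) = (\<Sum>a\<in>S \<union> F. dH a)" by simp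
  also have "\<dots> = (\<Sum>a\<in>S. dH a) + (\<Sum>a\<in>F. dH a)" using finS finF by (intro sum.union_disjoint) auto
  finally show ?thesis .
qed

lemma card_F: "card F = c - p" "p \<le> c"
  using card_Diff_subset[OF finS SC] card_H card_mono[OF finH SC] by auto

text \<open>A vertex outside the clique of degree above \<open>c + 1 - p\<close> would reach degree
  sum \<open>c + 1\<close> with every clique vertex. Closedness would join it to the whole clique,
  giving it degree at least \<open>p > c - t\<close>.\<close>

lemma big_clique_frame:
  assumes "c - t + 2 \<le> p"
  shows "clique_frame E V f c S (c + 1 - p)"
    "\<And>x. x \<in> F \<Longrightarrow> card {z \<in> Hc. E x z} \<le> c + 1 - p"
proof -
  show "clique_frame E V f c S (c + 1 - p)"
    by unfold_locales (use SC S_clique card_F(2) assms t_c in \<open>auto simp: Hc_def[symmetric]\<close>)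
  fix x assume x: "x \<in> F"
  show "card {z \<in> Hc. E x z} \<le> c + 1 - p"
  proof (rule ccontr)
    assume "\<not> ?thesis"
    then have dx: "c + 1 - p + 1 \<le> dH x" unfolding dH_def by simp
    have "E x s" if s: "s \<in> S" for s
    proof -
      have "S - {s} \<subseteq> {z \<in> Hc. E s z}" using S_clique[OF s] SC by blast
      then have "card (S - {s}) \<le> dH s" unfolding dH_def using finH by (intro card_mono) auto
      then have "p \<le> dH s + 1" using s finS by simp
      then have "c + 1 \<le> dH x + dH s" using dx card_F(2) by linarith
      moreover have "x \<in> Hc" "s \<in> Hc" "x \<noteq> s" using x s SC by auto
      ultimately show ?thesis by (intro closed')
    qed
    then have "S \<subseteq> {z \<in> Hc. E x z}" using SC by blast
    then have "p \<le> dH x" unfolding dH_def using finH by (intro card_mono) auto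
    then show False using F_le[OF x] assms by linarith
  qed
qed

text \<open>The bound \<open>arcs\<close> is the edge hypothesis for
  \<open>h_fun (c + 1) (t - 1)\<close>, doubled to ordered pairs; the final 2 expresses
  strictness.\<close>

context
  assumes small: "p \<le> c - t + 1"
    and arcs: "(c + 2 - t) * (c + 1 - t) + 2 * ((t - 1) * (t - 2)) + 2 \<le>
      card {(a, b). a \<in> Hc \<and> b \<in> Hc \<and> E a b}"
begin

text \<open>For \<open>p > t\<close>, a vertex of degree at least \<open>t\<close> is adjacent to
  all of \<open>S\<close>, hence has degree above \<open>t\<close> and lies in
  \<open>S \<union> Y\<close>. So apart from a clique of size at most \<open>c - t + 1\<close> all
  degrees are at most \<open>t - 1\<close>, which gives too few edges.\<close>

lemma p_le_t: "p \<le> t"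
proof (rule ccontr)
  assume "\<not> ?thesis"
  then have pt: "t + 1 \<le> p" by simp
  let ?B = "S \<union> Y" and ?L = "Hc - (S \<union> Y)"
  have fB: "finite ?B" using finS finY by simp
  have fL: "finite ?L" using finH by simp
  have low: "dH x \<le> t - 1" if x: "x \<in> ?L" for x
  proof (rule ccontr)
    assume "\<not> ?thesis"
    then have "S \<subseteq> {z \<in> Hc. E x z}" using high_adj[of _ x] x SC E_sym by fastforce
    then have "p \<le> dH x" unfolding dH_def using finH by (intro card_mono) auto
    moreover have "dH x \<le> t" using x SC unfolding Y_def by auto
    ultimately show False using pt by simp
  qed
  let ?BB = "?B \<times> ?B - (\<lambda>a. (a, a)) ` ?B" and ?X1 = "SIGMA x:?L. {z \<in> Hc. E x z}"
  have "{(a, b). a \<in> Hc \<and> b \<in> Hc \<and> E a b} \<subseteq> ?BB \<union> (?X1 \<union> prod.swap ` ?X1)"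
  proof (rule subsetI, elim CollectE case_prodE conjE)
    fix q a b assume q: "q = (a, b)" and ab: "a \<in> Hc" "b \<in> Hc" "E a b"
    have "a \<noteq> b" using ab E_irr by auto
    consider "a \<in> ?B" "b \<in> ?B" | "a \<in> ?L" | "b \<in> ?L" using ab by blast
    then show "q \<in> ?BB \<union> (?X1 \<union> prod.swap ` ?X1)"
    proof cases
      case 1
      then have "q \<in> ?BB" unfolding q using \<open>a \<noteq> b\<close> by blast
      then show ?thesis by blast
    next
      case 2
      then have "q \<in> ?X1" unfolding q using ab by blast
      then show ?thesis by blast
    next
      case 3
      then have "(b, a) \<in> ?X1" using E_sym[OF ab(3)] ab by blast
      then have "prod.swap (b, a) \<in> prod.swap ` ?X1" by (rule imageI)
      then show ?thesis unfolding q by simp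
    qed
  qed
  moreover have fX: "finite ?X1" using fL finH by (intro finite_SigmaI) auto
  ultimately have "card {(a, b). a \<in> Hc \<and> b \<in> Hc \<and> E a b} \<le> card (?BB \<union> (?X1 \<union> prod.swap ` ?X1))"
    using fB by (intro card_mono) auto
  also have "\<dots> \<le> card ?BB + card (?X1 \<union> prod.swap ` ?X1)" by (rule card_Un_le)
  also have "card (?X1 \<union> prod.swap ` ?X1) \<le> card ?X1 + card (prod.swap ` ?X1)" by (rule card_Un_le)
  also have "card (prod.swap ` ?X1) \<le> card ?X1" by (rule card_image_le[OF fX])
  also have "card ?X1 = (\<Sum>x\<in>?L. dH x)" unfolding dH_def by (rule card_SigmaI) (use fL finH in auto)
  also have "(\<Sum>x\<in>?L. dH x) \<le> (\<Sum>x\<in>?L. t - 1)" using low by (intro sum_mono) blast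
  also have "(\<Sum>x\<in>?L. t - 1) = (c - card ?B) * (t - 1)"
    using card_Diff_subset[of ?B Hc] SC YF fB card_H by auto
  also have "card ?BB = card ?B * card ?B - card ?B"
  proof -
    have "card ((\<lambda>a. (a, a)) ` ?B) = card ?B" by (intro card_image) (auto simp: inj_on_def)
    then show ?thesis using fB by (subst card_Diff_subset) (auto simp: card_cartesian_product)
  qed
  finally have bd: "(c + 2 - t) * (c + 1 - t) + 2 * ((t - 1) * (t - 2)) + 2 \<le>
    card ?B * card ?B - card ?B + 2 * ((c - card ?B) * (t - 1))" using arcs by linarith
  have cB: "card ?B = p + card Y" using finS finY YF by (intro card_Un_disjoint) auto
  have "card ?B \<le> c - t + 1"
    using Y_card small cB t_c by (cases "Y = {}") auto
  then have r: "card ?B = t + 1 \<or> (card ?B = t + 2 \<and> c = 2 * t + 1)" using pt cB t_c by linarith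
  obtain m where m: "t = m + 3" using t_c(2) by (metis add.commute le_Suc_ex)
  show False using bd r t_c(1) unfolding m
    by (elim disjE conjE) (auto simp: algebra_simps)
qed

lemma sumF: "(\<Sum>a\<in>F. dH a) + card {x \<in> F. dH x < t} \<le> t * (c - p) + card Y"
proof -
  have "(\<Sum>a\<in>F. dH a + (if dH a < t then 1 else 0)) \<le> (\<Sum>a\<in>F. t + (if a \<in> Y then 1 else 0))"
  proof (rule sum_mono)
    fix a assume a: "a \<in> F"
    have "dH a \<le> t + 1" using F_le[OF a] t_c by linarith
    then show "dH a + (if dH a < t then 1 else 0) \<le> t + (if a \<in> Y then 1 else 0)"
      using a unfolding Y_def by auto
  qed
  moreover have "(\<Sum>a\<in>F. if dH a < t then 1 else 0 :: nat) = card {x \<in> F. dH x < t}"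
    using finF by (simp add: sum.If_cases Int_def)
  moreover have "(\<Sum>a\<in>F. if a \<in> Y then 1 else 0 :: nat) = card Y"
  proof -
    have "F \<inter> Y = Y" using YF by blast
    then show ?thesis using finF by (simp add: sum.If_cases)
  qed
  moreover have "(\<Sum>a\<in>F. t) = t * (c - p)" using card_F by simp
  ultimately show ?thesis by (simp only: sum.distrib)
qed

lemma sumS: "(\<Sum>a\<in>S. dH a) \<le> p * (c - 1)"
proof -
  have "(\<Sum>a\<in>S. dH a) \<le> (\<Sum>a\<in>S. c - 1)" by (intro sum_mono) (use dH_less SC in force)
  then show ?thesis by simp
qed

text \<open>With \<open>u = t - p - 2\<close>, even full degree \<open>c - 1\<close> on
  \<open>S\<close> and degree \<open>t\<close> elsewhere, plus one on \<open>Y\<close>, stays below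
  \<open>arcs\<close>.\<close>

lemma p_ge: "t \<le> p + 1"
proof (rule ccontr)
  assume "\<not> ?thesis"
  then obtain u where u: "t = p + 2 + u" by (metis add.assoc add.commute le_iff_add not_less_eq_eq Suc_eq_plus1 add_2_eq_Suc')
  have "(c + 2 - t) * (c + 1 - t) + 2 * ((t - 1) * (t - 2)) + 2 \<le> p * (c - 1) + t * (c - p) + card Y"
    using arcs sumF sumS unfolding arcs_sum by linarith
  moreover have "card Y \<le> (if c = 2 * t + 1 then t + 2 - p else 0)"
    using Y_card by (cases "Y = {}") auto
  ultimately have main: "(c + 2 - t) * (c + 1 - t) + 2 * ((t - 1) * (t - 2)) + 2 \<le>
    p * (c - 1) + t * (c - p) + (if c = 2 * t + 1 then t + 2 - p else 0)" by linarith
  from t_c(1) show False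
  proof
    assume c: "c = 2 * t"
    have "c + 2 - t = p + u + 4" "c + 1 - t = p + u + 3" "t - 1 = p + u + 1" "t - 2 = p + u"
      "c - 1 = 2 * p + 2 * u + 3" "c - p = p + 2 * u + 4" using c u by auto
    then have "(p + u + 4) * (p + u + 3) + 2 * ((p + u + 1) * (p + u)) + 2 \<le>
      p * (2 * p + 2 * u + 3) + (p + 2 + u) * (p + 2 * u + 4)" using main c u by simp
    then show False by (simp add: algebra_simps)
  next
    assume c: "c = 2 * t + 1"
    have "c + 2 - t = p + u + 5" "c + 1 - t = p + u + 4" "t - 1 = p + u + 1" "t - 2 = p + u"
      "c - 1 = 2 * p + 2 * u + 4" "c - p = p + 2 * u + 5" "t + 2 - p = u + 4" using c u by auto
    then have "(p + u + 5) * (p + u + 4) + 2 * ((p + u + 1) * (p + u)) + 2 \<le>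
      p * (2 * p + 2 * u + 4) + (p + 2 + u) * (p + 2 * u + 5) + (u + 4)" using main c u by simp
    then show False by (simp add: algebra_simps)
  qed
qed

text \<open>A missing edge is expensive. By closedness \<open>dH s + dH x \<le> c\<close>; moreover
  \<open>s\<close> misses \<open>c - 1 - dH s\<close> vertices, all of degree below
  \<open>t\<close>, and \<open>x\<close> misses at least \<open>p - dH x\<close> vertices of
  \<open>S\<close>. Subtracting these losses contradicts \<open>arcs\<close> for both remaining
  values of \<open>p\<close>.\<close>

lemma S_universal:
  assumes s: "s \<in> S" and x: "x \<in> Hc" "s \<noteq> x" shows "E s x"
proof (rule ccontr)
  assume no: "\<not> E s x"
  have xF: "x \<in> F" using S_clique no s x by blast
  have dx: "dH x < t" using high_adj[OF s x] no by linarith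
  define M where "M = {z \<in> Hc - {s}. \<not> E s z}"
  define B where "B = {z \<in> S. \<not> E x z}"
  have fM: "finite M" "finite B" unfolding M_def B_def using finH finS by auto
  have MF: "M \<subseteq> {x \<in> F. dH x < t}" using S_clique[OF s] high_adj[OF s] unfolding M_def by force
  have xM: "x \<in> M" unfolding M_def using x no by blast
  have sB: "s \<in> B" unfolding B_def using s no E_sym by blast
  have cM: "card M + dH s + 1 = c"
  proof -
    have "{z \<in> Hc. E s z} = Hc - {s} - M" unfolding M_def using E_irr by blast
    then have "dH s = card (Hc - {s} - M)" unfolding dH_def by simp
    also have "\<dots> = card (Hc - {s}) - card M" by (rule card_Diff_subset) (auto simp: M_def finH)
    also have "card (Hc - {s}) = c - 1" using s SC card_H finH by (simp add: subset_iff)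
    finally have "dH s = c - 1 - card M" .
    moreover have "card M \<le> card (Hc - {s})" using finH by (intro card_mono) (auto simp: M_def)
    ultimately show ?thesis using \<open>card (Hc - {s}) = c - 1\<close> c3 by linarith
  qed
  have cB: "p \<le> card B + dH x"
  proof -
    have "S \<subseteq> B \<union> {z \<in> Hc. E x z}" unfolding B_def using SC by blast
    then have "p \<le> card (B \<union> {z \<in> Hc. E x z})" using fM finH by (intro card_mono) auto
    also have "\<dots> \<le> card B + dH x" unfolding dH_def by (rule card_Un_le)
    finally show ?thesis .
  qed
  have le: "dH s + dH x \<le> c" using closed'[of s x] no x s SC by force
  have SS: "(\<Sum>a\<in>S. dH a) + card (B - {s}) \<le> (p - 1) * (c - 1) + dH s"
  proof -
    have "(\<Sum>a\<in>S - {s}. dH a + (if a \<in> B then 1 else 0)) \<le> (\<Sum>a\<in>S - {s}. c - 1)"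
    proof (rule sum_mono)
      fix a assume a: "a \<in> S - {s}"
      have "dH a + 2 \<le> c" if "a \<in> B"
      proof -
        have "{z \<in> Hc. E a z} \<subseteq> Hc - {a, x}" using that E_irr E_sym unfolding B_def by blast
        then have "dH a \<le> card (Hc - {a, x})" unfolding dH_def using finH by (intro card_mono) auto
        also have "\<dots> = c - 2"
        proof -
          have "a \<noteq> x" using a xF by blast
          then have "{a, x} \<subseteq> Hc" "card {a, x} = 2" using a xF SC by auto
          then show ?thesis using card_Diff_subset[of "{a, x}" Hc] card_H by simp
        qed
        finally show ?thesis using c3 by simp
      qed
      moreover have "dH a + 1 \<le> c" using a SC by (intro dH_less) blast
      ultimately show "dH a + (if a \<in> B then 1 else 0) \<le> c - 1" by auto
    qed
    moreover have "(\<Sum>a\<in>S - {s}. if a \<in> B then 1 else 0 :: nat) = card (B - {s})"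
    proof -
      have "(S - {s}) \<inter> B = B - {s}" unfolding B_def by blast
      then show ?thesis using finS by (simp add: sum.If_cases)
    qed
    moreover have "(\<Sum>a\<in>S. dH a) = dH s + (\<Sum>a\<in>S - {s}. dH a)" by (rule sum.remove[OF finS s])
    moreover have "(\<Sum>a\<in>S - {s}. c - 1) = (p - 1) * (c - 1)" using s finS by simp
    ultimately show ?thesis by (simp only: sum.distrib)
  qed
  have FF: "(\<Sum>a\<in>F. dH a) + card (M - {x}) \<le> t * (c - p - 1) + card Y + dH x"
  proof -
    have "(\<Sum>a\<in>F - {x}. dH a + (if a \<in> M then 1 else 0)) \<le> (\<Sum>a\<in>F - {x}. t + (if a \<in> Y then 1 else 0))"
    proof (rule sum_mono)
      fix a assume a: "a \<in> F - {x}"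
      have "dH a \<le> t + 1" using F_le[of a] a t_c by auto
      then show "dH a + (if a \<in> M then 1 else 0) \<le> t + (if a \<in> Y then 1 else 0)"
        using a MF unfolding Y_def by auto
    qed
    moreover have "(\<Sum>a\<in>F - {x}. if a \<in> M then 1 else 0 :: nat) = card (M - {x})"
    proof -
      have "(F - {x}) \<inter> M = M - {x}" using MF by blast
      then show ?thesis using finF by (simp add: sum.If_cases)
    qed
    moreover have "(\<Sum>a\<in>F - {x}. if a \<in> Y then 1 else 0 :: nat) = card Y"
    proof -
      have "(F - {x}) \<inter> Y = Y" using YF dx unfolding Y_def by auto
      then show ?thesis using finF by (simp add: sum.If_cases)
    qed
    moreover have "(\<Sum>a\<in>F. dH a) = dH x + (\<Sum>a\<in>F - {x}. dH a)" by (rule sum.remove[OF finF xF])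
    moreover have "(\<Sum>a\<in>F - {x}. t) = t * (c - p - 1)" using xF finF card_F by simp
    ultimately show ?thesis by (simp only: sum.distrib)
  qed
  have "card B = card (B - {s}) + 1" "card M = card (M - {x}) + 1"
    using card.remove[OF fM(2) sB] card.remove[OF fM(1) xM] by auto
  then have fin: "(c + 2 - t) * (c + 1 - t) + 2 * ((t - 1) * (t - 2)) + 2 + p \<le>
    (p - 1) * (c - 1) + t * (c - p - 1) + card Y + c + 3"
    using arcs SS FF cB cM le unfolding arcs_sum by linarith
  have Y: "card Y \<le> (if c = 2 * t + 1 then t + 2 - p else 0)"
    using Y_card by (cases "Y = {}") auto
  have "p = t \<or> p + 1 = t" using p_le_t p_ge by linarith
  moreover obtain m where m: "t = m + 3" using t_c(2) by (metis add.commute le_Suc_ex)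
  ultimately consider "p = m + 3" "c = 2 * t" | "p = m + 3" "c = 2 * t + 1" | "p = m + 2" "c = 2 * t" | "p = m + 2" "c = 2 * t + 1"
    using t_c(1) by linarith
  then show False using fin Y unfolding m by cases (auto simp: algebra_simps)
qed

end

end

section \<open>Hamiltonian paths through a minimum partition\<close>

context closed_frame
begin

context
  assumes small: "p \<le> c - t + 1"
    and arcs: "(c + 2 - t) * (c + 1 - t) + 2 * ((t - 1) * (t - 2)) + 2 \<le>
      card {(a, b). a \<in> Hc \<and> b \<in> Hc \<and> E a b}"
begin

lemma dH_F: "x \<in> F \<Longrightarrow> dH x = p + card {z \<in> F. E x z}"
proof -
  assume x: "x \<in> F"
  have "{z \<in> Hc. E x z} = S \<union> {z \<in> F. E x z}" using S_universal[OF small arcs, of _ x] x SC E_sym by blast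
  then have "dH x = card (S \<union> {z \<in> F. E x z})" unfolding dH_def by simp
  also have "\<dots> = p + card {z \<in> F. E x z}" using finS finF by (intro card_Un_disjoint) auto
  finally show ?thesis .
qed

lemma ex_min_parts: "\<exists>Ps. parts E F Ps \<and> (\<forall>Qs. parts E F Qs \<longrightarrow> length Ps \<le> length Qs)"
proof -
  obtain xs where xs: "set xs = F" "distinct xs" using finite_distinct_list[OF finF] by blast
  have cc: "concat (map (\<lambda>x. [x]) xs) = xs" by (induction xs) auto
  then have "parts E F (map (\<lambda>x. [x]) xs)" unfolding parts_def using xs by auto
  then show ?thesis using ex_has_least_nat[of "parts E F" _ length] by blast
qed

context
  fixes Ps
  assumes Ps: "parts E F Ps" and Pmin: "\<And>Qs. parts E F Qs \<Longrightarrow> length Ps \<le> length Qs"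
begin

text \<open>Two adjacent singletons could be merged into one part.\<close>

lemma singles_indep:
  assumes "[a] \<in> set Ps" "[b] \<in> set Ps" shows "\<not> E a b"
proof
  assume ab: "E a b"
  then have ne: "a \<noteq> b" using E_irr by auto
  obtain Qs where Qs: "parts E F ([a] # Qs)" "length Ps = Suc (length Qs)" "set Ps = insert [a] (set Qs)"
    by (rule parts_perm[OF Ps assms(1)])
  have a: "a \<in> F" "parts E (F - {a}) Qs" using Qs(1) unfolding parts_Cons by auto
  have "[b] \<in> set Qs" using assms(2) Qs(3) ne by auto
  then obtain Rs where Rs: "parts E (F - {a}) ([b] # Rs)" "length Qs = Suc (length Rs)"
    using parts_perm[OF a(2)] by metis
  then have b: "b \<in> F" "parts E (F - {a} - {b}) Rs" unfolding parts_Cons by auto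
  moreover have "F - {a} - {b} = F - set [a, b]" by auto
  ultimately have "parts E F ([a, b] # Rs)" unfolding parts_Cons using a(1) ab ne by auto
  then show False using Pmin[of "[a, b] # Rs"] Qs(2) Rs(2) by simp
qed

lemma part_cases:
  assumes "x \<in> F"
  obtains "[x] \<in> set Ps" | y where "y \<in> F" "y \<noteq> x" "E x y" "[x] \<notin> set Ps" "[y] \<notin> set Ps"
proof -
  obtain P where P: "P \<in> set Ps" "x \<in> set P" using assms Ps unfolding parts_def by auto
  obtain Qs where Qs: "parts E F (P # Qs)" "set Ps = insert P (set Qs)" using parts_perm[OF Ps P(1)] by metis
  then have P': "(\<exists>a. P = [a]) \<or> (\<exists>a b. P = [a, b] \<and> E a b)" "set P \<subseteq> F" "distinct P" "parts E (F - set P) Qs"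
    unfolding parts_Cons by auto
  show ?thesis
  proof (cases "\<exists>a. P = [a]")
    case True
    then show ?thesis using that(1) P by auto
  next
    case False
    then obtain a b where ab: "P = [a, b]" "E a b" using P'(1) by blast
    have nin: "[z] \<notin> set Ps" if "z \<in> set P" for z
    proof
      assume "[z] \<in> set Ps"
      then have "[z] \<in> set Qs" using Qs(2) ab by auto
      then have "z \<in> F - set P" by (rule parts_single[OF P'(4)])
      then show False using that by blast
    qed
    show ?thesis
    proof (cases "x = a")
      case True
      then show ?thesis using that(2)[of b] ab P' nin by auto
    next
      case False
      then have "x = b" using P ab by auto
      then show ?thesis using that(2)[of a] ab P' nin E_sym by auto
    qed
  qed
qed

lemma edge_Y: "p = t \<Longrightarrow> a \<in> F \<Longrightarrow> b \<in> F \<Longrightarrow> E a b \<Longrightarrow> a \<in> Y"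
proof -
  assume *: "p = t" "a \<in> F" "b \<in> F" "E a b"
  have "finite {z \<in> F. E a z}" by (rule finite_subset[OF _ finF]) blast
  moreover have "b \<in> {z \<in> F. E a z}" using * by blast
  ultimately have "0 < card {z \<in> F. E a z}" unfolding card_gt_0_iff by blast
  then show ?thesis using dH_F[OF *(2)] * unfolding Y_def by auto
qed

text \<open>More than \<open>t\<close> parts on at most \<open>t + 1\<close> vertices are all
  singletons, so \<open>F\<close> is independent with \<open>t + 1\<close> vertices. But then
  \<open>C\<close> itself follows each vertex of \<open>F\<close> by a different vertex of
  \<open>S\<close>, and \<open>S\<close> has only \<open>t\<close>.\<close>

lemma parts_short: "p = t \<Longrightarrow> length Ps \<le> p"
proof (rule ccontr)
  assume pt: "p = t" and no: "\<not> length Ps \<le> p"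
  note pl = parts_length[OF Ps]
  have c: "c = 2 * t + 1" "length Ps = card F" "card F = t + 1" using no pl(2) card_F pt t_c by auto
  then have fl: "length (filter (\<lambda>P. length P = 1) Ps) = length Ps" using pl(3) by linarith
  have all1: "\<forall>P\<in>set Ps. length P = 1"
  proof (rule ballI, rule ccontr)
    fix P assume "P \<in> set Ps" "length P \<noteq> 1"
    then show False using length_filter_less[of P Ps "\<lambda>P. length P = 1"] fl by simp
  qed
  have "[x] \<in> set Ps" if x: "x \<in> F" for x
  proof -
    obtain P where P: "P \<in> set Ps" "x \<in> set P" using x Ps unfolding parts_def by auto
    have "length P = 1" using all1 P(1) by simp
    then obtain y where "P = [y]" by (auto simp: length_Suc_conv)
    then have "P = [x]" using P(2) by simp
    then show ?thesis using P by simp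
  qed
  then have ind: "\<not> E a b" if "a \<in> F" "b \<in> F" for a b using singles_indep that by blast
  have "F \<subseteq> Cy" unfolding Hc_def by blast
  then have "card ((\<lambda>q. f (q + 1)) ` {q. f q \<in> F}) = t + 1" using card_shift[of F 1] c by simp
  moreover have "(\<lambda>q. f (q + 1)) ` {q. f q \<in> F} \<subseteq> S"
  proof (rule image_subsetI)
    fix q assume "q \<in> {q. f q \<in> F}"
    then have "f (q + 1) \<notin> F" using ind[of "f q" "f (q + 1)"] f_adj[of q] by auto
    then show "f (q + 1) \<in> S" unfolding Hc_def by simp
  qed
  ultimately have "t + 1 \<le> p" using card_mono[OF finS, of "(\<lambda>q. f (q + 1)) ` {q. f q \<in> F}"] by simp
  then show False using pt by simp
qed

text \<open>Twice the number of parts is \<open>card F\<close> plus the number of singletons, so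
  singletons must be few. Those of degree below \<open>t\<close> are limited by \<open>arcs\<close>.
  Any other singleton has a neighbour in \<open>F\<close>; this neighbour lies in a two-vertex part,
  hence has two neighbours in \<open>F\<close> and is in \<open>Y\<close>. The assignment is
  injective because degrees inside \<open>F\<close> are at most
  \<open>c - t - p \<le> 2\<close>.\<close>

lemma parts_short': "p + 1 = t \<Longrightarrow> length Ps + 1 \<le> p"
proof -
  assume pt: "p + 1 = t"
  define I where "I = {a. [a] \<in> set Ps}"
  have IF: "I \<subseteq> F" unfolding I_def using parts_single[OF Ps] by blast
  have fI: "finite I" using IF finF finite_subset by blast
  have "length (filter (\<lambda>P. length P = 1) Ps) = card I"
  proof -
    have "distinct Ps"
    proof (rule ccontr)
      assume "\<not> distinct Ps"
      then obtain xs ys zs P where "Ps = xs @ [P] @ ys @ [P] @ zs" using not_distinct_decomp by blast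
      then have "set P = {}" using Ps unfolding parts_def by auto
      moreover have "P \<noteq> []" using parts_succ[OF Ps, of P] \<open>Ps = _\<close> by simp
      ultimately show False by simp
    qed
    then have "length (filter (\<lambda>P. length P = 1) Ps) = card (set (filter (\<lambda>P. length P = 1) Ps))"
      by (metis distinct_card distinct_filter)
    also have "set (filter (\<lambda>P. length P = 1) Ps) = (\<lambda>a. [a]) ` I"
      unfolding I_def by (auto simp: length_Suc_conv)
    also have "card \<dots> = card I" by (intro card_image) (auto simp: inj_on_def)
    finally show ?thesis .
  qed
  then have count: "card F + card I = 2 * length Ps" using parts_length(3)[OF Ps] by simp
  let ?I0 = "{x \<in> F. dH x < t}" and ?I1 = "{a \<in> I. t \<le> dH a}"
  have nb: "\<exists>z. z \<in> F \<and> E a z" if "a \<in> ?I1" for a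
  proof -
    have "0 < card {z \<in> F. E a z}" using dH_F[of a] that IF pt by force
    then have "{z \<in> F. E a z} \<noteq> {}" by (metis card.empty less_irrefl)
    then show ?thesis by blast
  qed
  define g where "g a = (SOME z. z \<in> F \<and> E a z)" for a
  have g: "g a \<in> F" "E a (g a)" if "a \<in> ?I1" for a
    using someI_ex[OF nb[OF that]] unfolding g_def by auto
  have par: "\<exists>y. y \<in> F \<and> y \<notin> I \<and> E (g a) y" if a: "a \<in> ?I1" for a
  proof -
    have "[g a] \<notin> set Ps" using singles_indep[of a "g a"] g[OF a] a unfolding I_def by blast
    then show ?thesis using part_cases[OF g(1)[OF a]] unfolding I_def by blast
  qed
  have fN: "finite {z \<in> F. E a z}" for a by (rule finite_subset[OF _ finF]) blast
  have deg2: "dH z \<le> p + 2" if "z \<in> F" for z using F_le[OF that] t_c pt by linarith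
  have "inj_on g ?I1"
  proof (rule inj_onI, rule ccontr)
    fix a b assume ab: "a \<in> ?I1" "b \<in> ?I1" "g a = g b" "a \<noteq> b"
    obtain y where y: "y \<in> F" "y \<notin> I" "E (g a) y" using par[OF ab(1)] by blast
    have "{a, b, y} \<subseteq> {z \<in> F. E (g a) z}" using ab g[OF ab(1)] g[OF ab(2)] y IF E_sym by auto
    moreover have "y \<noteq> a" "y \<noteq> b" using ab y by auto
    then have "card {a, b, y} = 3" using ab(4) by simp
    ultimately have "3 \<le> card {z \<in> F. E (g a) z}" using card_mono[OF fN, of "{a, b, y}" "g a"] by simp
    then show False using dH_F[OF g(1)[OF ab(1)]] deg2[OF g(1)[OF ab(1)]] by linarith
  qed
  moreover have "g ` ?I1 \<subseteq> Y"
  proof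
    fix z assume "z \<in> g ` ?I1"
    then obtain a where a: "a \<in> ?I1" "z = g a" by blast
    obtain y where y: "y \<in> F" "y \<notin> I" "E (g a) y" using par[OF a(1)] by blast
    have "{a, y} \<subseteq> {z \<in> F. E (g a) z}" using a g[OF a(1)] y IF E_sym by auto
    moreover have "y \<noteq> a" using a y by auto
    then have "card {a, y} = 2" by simp
    ultimately have "2 \<le> card {z \<in> F. E (g a) z}" using card_mono[OF fN, of "{a, y}" "g a"] by simp
    then show "z \<in> Y" using dH_F[OF g(1)[OF a(1)]] pt g(1)[OF a(1)] a(2) unfolding Y_def by auto
  qed
  ultimately have I1: "card ?I1 \<le> card Y" using card_inj_on_le finY by blast
  have "I \<subseteq> ?I0 \<union> ?I1" using IF by auto
  moreover have "finite ?I0" by (rule finite_subset[OF _ finF]) blast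
  ultimately have "card I \<le> card (?I0 \<union> ?I1)" using fI by (intro card_mono) auto
  also have "\<dots> \<le> card ?I0 + card ?I1" by (rule card_Un_le)
  finally have cI: "card I \<le> card ?I0 + card Y" using I1 by linarith
  have main: "(c + 2 - t) * (c + 1 - t) + 2 * ((t - 1) * (t - 2)) + 2 + card ?I0 \<le> p * (c - 1) + t * (c - p) + card Y"
    using arcs sumF[OF small arcs] sumS[OF small arcs] unfolding arcs_sum by linarith
  have Y: "card Y \<le> (if c = 2 * t + 1 then t + 2 - p else 0)"
    using Y_card by (cases "Y = {}") auto
  obtain m where m: "t = m + 3" using t_c(2) by (metis add.commute le_Suc_ex)
  then have pm: "p = m + 2" using pt by simp
  from t_c(1) show ?thesis
  proof
    assume c: "c = 2 * t"
    have "c + 2 - t = m + 5" "c + 1 - t = m + 4" "t - 1 = m + 2" "t - 2 = m + 1" "c - 1 = 2 * m + 5"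
      "c - p = m + 4" using c m pm by auto
    then have "(m + 5) * (m + 4) + 2 * ((m + 2) * (m + 1)) + 2 + card ?I0 \<le> (m + 2) * (2 * m + 5) + (m + 3) * (m + 4)"
      using main Y c m pm by simp
    then have "4 + card ?I0 \<le> m" by (simp add: algebra_simps)
    then show ?thesis using count cI Y c pm card_F m by simp
  next
    assume c: "c = 2 * t + 1"
    have "c + 2 - t = m + 6" "c + 1 - t = m + 5" "t - 1 = m + 2" "t - 2 = m + 1" "c - 1 = 2 * m + 6"
      "c - p = m + 5" using c m pm by auto
    then have "(m + 6) * (m + 5) + 2 * ((m + 2) * (m + 1)) + 2 + card ?I0 \<le> (m + 2) * (2 * m + 6) + (m + 3) * (m + 5) + card Y"
      using main m pm by simp
    then have "9 + card ?I0 \<le> m + card Y" by (simp add: algebra_simps)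
    moreover have "card Y \<le> 3" using Y c m pm by simp
    ultimately show ?thesis using count cI c pm card_F m by simp
  qed
qed

lemma S_ne: "S \<noteq> {}" "1 \<le> p"
proof -
  show "1 \<le> p" using p_ge[OF small arcs] t_c(2) by linarith
  then show "S \<noteq> {}" by auto
qed

lemma SF: "S \<union> F = Cy" "S \<inter> F = {}" "card S + card F = c"
  using SC card_F unfolding Hc_def by auto

lemma univ: "s \<in> S \<Longrightarrow> z \<in> S \<union> F \<Longrightarrow> s \<noteq> z \<Longrightarrow> E s z"
  using S_universal[OF small arcs, of s z] SC by blast

text \<open>A Hamiltonian path of the cycle's vertices starting in \<open>F\<close> may use as many
  parts as \<open>S\<close> has vertices, so it exists for both values of \<open>p\<close>; no ear
  fits its ends.\<close>

lemma no_link_F: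
  assumes "u \<in> F" "v \<in> Cy" "u \<noteq> v" "1 \<le> b" shows "\<not> linked u v b"
proof
  assume l: "linked u v b"
  have "length Ps \<le> card S" using parts_short parts_short' p_le_t[OF small arcs] p_ge[OF small arcs] by linarith
  then obtain L where L: "gpath E (S \<union> F) u L v" "length L = card S + card F"
    using join_ham_path[OF Ps finS S_ne(1) SF(2) sym univ assms(3,1)] assms(2) SF(1) by auto
  have "length L + b \<le> c"
    by (rule linked_bound[OF l _ assms(2,3)]) (use L(1) SF(1) assms(1) in auto)
  then show False using L(2) SF(3) assms(4) by simp
qed

text \<open>With both ends in \<open>S\<close> more vertices of \<open>S\<close> than parts are
  needed, and this is what the sharper bound for \<open>p + 1 = t\<close> provides.\<close>

lemma no_link_S:
  assumes "p + 1 = t" "u \<in> S" "v \<in> S" "u \<noteq> v" shows "\<not> linked u v 1"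
proof
  assume l: "linked u v 1"
  obtain ss where ss: "set ss = S" "distinct ss" "hd ss = u" "last ss = v" by (rule list_of_ends[OF finS assms(2-4)])
  have lss: "length ss = p" using distinct_card ss by metis
  have uni: "E s z \<and> E z s" if "s \<in> set ss" "z \<in> set ss \<union> F" "s \<noteq> z" for s z
    using univ[of s z] E_sym that ss(1) by simp
  have "\<exists>L. gpath E (set ss \<union> F) (hd ss) L (last ss) \<and> length L = length ss + card F"
    by (rule weave[OF Ps ss(2) _ _ uni]) (use parts_short'[OF assms(1)] lss ss(1) SF(2) in auto)
  then obtain L where L: "gpath E Cy u L v" "length L = c" using ss lss SF by auto
  have "length L + 1 \<le> c"
    by (rule linked_bound[OF l _ _ assms(4) L(1)]) (use assms(2,3) SF(1) in auto)
  then show False using L(2) by simp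
qed

text \<open>For \<open>p = t\<close> there may be as many parts as vertices of \<open>S\<close>.
  Leaving out a singleton makes room at the price of one vertex, so ears with two vertices are still
  excluded. A singleton exists, since otherwise \<open>F\<close> would be contained in
  \<open>Y\<close>, which has at most two vertices.\<close>

lemma no_long_link:
  assumes "p = t" "u \<in> S" "v \<in> S" "u \<noteq> v" shows "\<not> linked u v 2"
proof
  assume l: "linked u v 2"
  have "\<exists>a. [a] \<in> set Ps"
  proof (rule ccontr)
    assume no: "\<not> ?thesis"
    have "F \<subseteq> Y"
    proof
      fix x assume x: "x \<in> F"
      from part_cases[OF x] show "x \<in> Y" by cases (use no edge_Y[OF assms(1) x] in auto)
    qed
    then have "card F \<le> card Y" using finY by (intro card_mono)
    moreover have "card Y \<le> 2" using Y_card(2) assms(1) by (cases "Y = {}") auto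
    ultimately show False using card_F assms(1) t_c by linarith
  qed
  then obtain a where a: "[a] \<in> set Ps" by blast
  obtain Qs where Qs: "parts E F ([a] # Qs)" "length Ps = Suc (length Qs)" using parts_perm[OF Ps a] by metis
  have aF: "a \<in> F" "parts E (F - {a}) Qs" using Qs(1) unfolding parts_Cons by auto
  obtain ss where ss: "set ss = S" "distinct ss" "hd ss = u" "last ss = v" by (rule list_of_ends[OF finS assms(2-4)])
  have lss: "length ss = p" using distinct_card ss by metis
  have uni: "E s z \<and> E z s" if "s \<in> set ss" "z \<in> set ss \<union> (F - {a})" "s \<noteq> z" for s z
    using univ[of s z] E_sym that ss(1) by auto
  have "\<exists>L. gpath E (set ss \<union> (F - {a})) (hd ss) L (last ss) \<and> length L = length ss + card (F - {a})"
    by (rule weave[OF aF(2) ss(2) _ _ uni]) (use parts_short[OF assms(1)] Qs(2) lss ss(1) SF(2) in auto)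
  then obtain L where L: "gpath E (S \<union> (F - {a})) u L v" "length L = p + card (F - {a})" using ss lss by auto
  have "gpath E Cy u L v" by (rule gpath_mono[OF L(1)]) (use SF(1) in blast)
  then have "length L + 2 \<le> c"
    using linked_bound[OF l _ _ assms(4)] assms(2,3) SF(1) by blast
  moreover have "card F = Suc (card (F - {a}))" by (rule card.remove[OF finF aF(1)])
  ultimately show False using L(2) SF(3) by simp
qed

end

text \<open>An ear exists, so \<open>p = t\<close>; ears with two vertices do not, so the outside is
  independent and attached to \<open>S\<close>. Edges inside \<open>F\<close> stay in
  \<open>Y\<close>, and \<open>K\<close> enlarges \<open>S \<union> Y\<close> to the size of the
  clique of \<open>W\<close>.\<close>

lemma dense_structure:
  assumes Out_ne: "Out \<noteq> {}"
  shows "\<exists>K. S \<subseteq> K \<and> K \<subseteq> V \<and> card S = t \<and> card K = c + 1 - t \<and>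
    (\<forall>a\<in>V. \<forall>b\<in>V. E a b \<longrightarrow> a \<in> S \<or> b \<in> S \<or> (a \<in> K \<and> b \<in> K))"
proof -
  obtain Ps where Ps: "parts E F Ps" "\<And>Qs. parts E F Qs \<Longrightarrow> length Ps \<le> length Qs"
    using ex_min_parts by blast
  have att: "f i0 \<in> S \<and> (\<exists>w z. w \<in> component E Out r \<and> z \<in> S \<and> z \<noteq> f i0 \<and>
      linked (f i0) z (card {z \<in> component E Out r. E w z} + 1))"
    if r: "r \<in> Out" "r1 \<in> component E Out r" "E r1 (f i0)" for r r1 i0
  proof -
    obtain w z where w: "w \<in> component E Out r" "z \<in> Cy" "z \<noteq> f i0"
      "linked (f i0) z (card {z \<in> component E Out r. E w z} + 1)" by (rule linked_partner[OF r])
    have "f i0 \<notin> F" using no_link_F[OF Ps _ w(2) w(3)[symmetric]] w(4) by fastforce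
    moreover have "z \<notin> F" using no_link_F[OF Ps _ _ w(3)] linked_sym[OF w(4)] by fastforce
    moreover have "f i0 \<in> Hc" "z \<in> Hc" using w(2) unfolding Hc_def by auto
    ultimately show ?thesis using w by blast
  qed
  have pt: "p = t"
  proof (rule ccontr)
    assume "p \<noteq> t"
    then have pt: "p + 1 = t" using p_le_t[OF small arcs] p_ge[OF small arcs] by linarith
    obtain r where r: "r \<in> Out" using Out_ne by blast
    obtain r1 i0 where e: "r1 \<in> component E Out r" "E r1 (f i0)" using component_port[OF r] by blast
    obtain w z where w: "f i0 \<in> S" "z \<in> S" "z \<noteq> f i0"
      "linked (f i0) z (card {z \<in> component E Out r. E w z} + 1)" using att[OF r e] by blast
    have "linked (f i0) z 1" by (rule linked_mono[OF w(4)]) simp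
    then show False using no_link_S[OF Ps pt w(1,2)] w(3) by auto
  qed
  have Out_indep: "\<not> E a b" if ab: "a \<in> Out" "b \<in> Out" for a b
  proof
    assume e: "E a b"
    let ?R = "component E Out a"
    have aR: "a \<in> ?R" by (rule component_self)
    have bR: "b \<in> ?R" by (rule component_closed[OF ab(1) aR ab(2) e])
    obtain r1 i0 where p: "r1 \<in> ?R" "E r1 (f i0)" using component_port[OF ab(1)] by blast
    obtain w z where w: "f i0 \<in> S" "w \<in> ?R" "z \<in> S" "z \<noteq> f i0" "linked (f i0) z (card {z \<in> ?R. E w z} + 1)"
      using att[OF ab(1) p] by blast
    have "?R \<noteq> {w}" using aR bR e E_irr by auto
    then obtain y where "y \<in> ?R" "E w y"
      using connected_on_component[OF sym ab(1)] w(2) unfolding connected_on_def by blast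
    then have "{z \<in> ?R. E w z} \<noteq> {}" by blast
    moreover have "finite {z \<in> ?R. E w z}" using fin_Out[OF component_subset[OF ab(1)]] by simp
    ultimately have "1 \<le> card {z \<in> ?R. E w z}" by (simp add: Suc_le_eq card_gt_0_iff)
    then have "linked (f i0) z 2" using linked_mono[OF w(5), of 2] by simp
    then show False using no_long_link[OF Ps pt w(1,3)] w(4) by auto
  qed
  have Out_S: "b \<in> S" if ab: "a \<in> Out" "b \<in> V" "E a b" for a b
  proof -
    have "b \<in> Cy"
    proof (rule ccontr)
      assume "b \<notin> Cy"
      then have "b \<in> Out" using ab(2) by simp
      then show False using Out_indep[OF ab(1)] ab(3) by simp
    qed
    then obtain i0 where "b = f i0" by blast
    then show ?thesis using att[OF ab(1) component_self, of i0] ab(3) by simp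
  qed
  have "p + card Y \<le> c + 1 - t"
    using Y_card pt t_c by (cases "Y = {}") auto
  moreover have "card (S \<union> Y) = p + card Y" using finS finY YF by (intro card_Un_disjoint) auto
  moreover have "S \<union> Y \<subseteq> Hc" using SC YF by blast
  moreover have "c + 1 - t \<le> card Hc" using card_H t_c(2) by simp
  ultimately obtain K where K: "S \<union> Y \<subseteq> K" "K \<subseteq> Hc" "card K = c + 1 - t"
    using exists_subset_between[of "S \<union> Y" "c + 1 - t" Hc] finH by auto
  have HV: "Hc \<subseteq> V" unfolding Hc_def by (rule f_V)
  have "a \<in> S \<or> b \<in> S \<or> (a \<in> K \<and> b \<in> K)" if ab: "a \<in> V" "b \<in> V" "E a b" for a b
  proof (cases "a \<in> Hc \<and> b \<in> Hc")
    case True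
    show ?thesis
    proof (rule ccontr)
      assume no: "\<not> ?thesis"
      then have F: "a \<in> F" "b \<in> F" using True by auto
      have "a \<in> Y" "b \<in> Y" using edge_Y[OF Ps pt F ab(3)] edge_Y[OF Ps pt F(2,1) E_sym[OF ab(3)]] by auto
      then show False using no K(1) by blast
    qed
  next
    case False
    then consider "a \<in> Out" | "b \<in> Out" using ab unfolding Hc_def by auto
    then show ?thesis
    proof cases
      case 1
      then show ?thesis using Out_S[OF 1 ab(2,3)] by simp
    next
      case 2
      then show ?thesis using Out_S[OF 2 ab(1) E_sym[OF ab(3)]] by simp
    qed
  qed
  then have edges: "\<forall>a\<in>V. \<forall>b\<in>V. E a b \<longrightarrow> a \<in> S \<or> b \<in> S \<or> (a \<in> K \<and> b \<in> K)" by simp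
  have "S \<subseteq> K" "K \<subseteq> V" using K HV by auto
  then show ?thesis using K(3) pt edges by (intro exI[of _ K] conjI)
qed

end

end

subsection \<open>Paths in closures\<close>

lemma last_take_Suc: "k < length P \<Longrightarrow> last (take (k + 1) P) = P ! k"
  by (simp add: take_Suc_conv_app_nth)

text \<open>The Bondy-Chvatal exchange for paths with fixed ends. Either a common neighbour off the
  path is inserted between \<open>P ! m\<close> and \<open>P ! (m + 1)\<close>, or a crossing pair
  of edges exists and a segment can be reversed.\<close>

lemma reroute:
  fixes E :: "'a \<Rightarrow> 'a \<Rightarrow> bool"
  assumes "finite A" "symp E" "irreflp E" and P: "distinct P" "set P \<subseteq> A" and m: "m + 1 < length P"
    and adj: "\<And>k. k + 1 < length P \<Longrightarrow> k \<noteq> m \<Longrightarrow> E (P ! k) (P ! (k + 1))"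
    and deg: "card A + 1 \<le> card {z \<in> A. E (P ! m) z} + card {z \<in> A. E (P ! (m + 1)) z}"
  shows "\<exists>P'. gpath E A (hd P) P' (last P) \<and> length P \<le> length P'"
proof -
  let ?x = "P ! m" and ?y = "P ! (m + 1)" and ?a = "length P"
  have Esym: "E a b \<Longrightarrow> E b a" for a b using assms(2) by (blast dest: sympD)
  have Eirr: "\<not> E a a" for a using assms(3) by (simp add: irreflpD)
  show ?thesis
  proof (cases "\<exists>w\<in>A - set P. E ?x w \<and> E ?y w")
    case True
    then obtain w where w: "w \<in> A" "w \<notin> set P" "E ?x w" "E ?y w" by blast
    let ?P = "take (m + 1) P @ w # drop (m + 1) P"
    have "successively E (take (m + 1) P)" "successively E (drop (m + 1) P)"
      unfolding successively_conv_nth using adj m by auto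
    moreover have "last (take (m + 1) P) = ?x" using m by (intro last_take_Suc) simp
    moreover have "hd (drop (m + 1) P) = ?y" using m by (simp add: hd_drop_conv_nth)
    ultimately have "successively E ?P" using w Esym by (auto simp: successively_append_iff successively_Cons)
    moreover have "distinct ?P"
    proof -
      have "distinct (take (m + 1) P @ drop (m + 1) P)" using P(1) by simp
      then show ?thesis using w(2) by (auto dest: in_set_takeD in_set_dropD simp del: append_take_drop_id)
    qed
    moreover have "set ?P \<subseteq> A" using w P(2) by (auto dest: in_set_takeD in_set_dropD)
    moreover have "hd ?P = hd P" "last ?P = last P" "?P \<noteq> []" using m by (auto simp: hd_append hd_take)
    ultimately have "gpath E A (hd P) ?P (last P)" unfolding gpath_def by blast
    then show ?thesis using m by (intro exI[of _ ?P]) simp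
  next
    case False
    have fP: "finite (A - set P)" using assms(1) by simp
    let ?N = "\<lambda>z. {w \<in> A. E z w}"
    have split: "card (?N z) = card (?N z \<inter> set P) + card (?N z - set P)" for z
      using assms(1) by (intro card_Int_Diff) simp
    have "(?N ?x - set P) \<inter> (?N ?y - set P) = {}" using False by blast
    then have "card (?N ?x - set P) + card (?N ?y - set P) = card ((?N ?x - set P) \<union> (?N ?y - set P))"
      using assms(1) by (intro card_Un_disjoint[symmetric]) auto
    also have "\<dots> \<le> card (A - set P)" by (rule card_mono[OF fP]) blast
    also have "\<dots> = card A - ?a" using card_Diff_subset[of "set P" A] P distinct_card[OF P(1)] by simp
    finally have "card (?N ?x - set P) + card (?N ?y - set P) \<le> card A - ?a" .
    moreover have "?a \<le> card A" using card_mono[OF assms(1) P(2)] distinct_card[OF P(1)] by simp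
    ultimately have big: "?a + 1 \<le> card (?N ?x \<inter> set P) + card (?N ?y \<inter> set P)"
      using deg split[of ?x] split[of ?y] by linarith
    define I where "I = {i. i + 1 < ?a \<and> E ?x (P ! i)}"
    define J where "J = {i. i + 1 < ?a \<and> E ?y (P ! (i + 1))}"
    have fIJ: "finite I" "finite J" unfolding I_def J_def by (auto intro: finite_subset[of _ "{..<?a}"])
    have "?N ?x \<inter> set P \<subseteq> insert (last P) ((!) P ` I)"
    proof
      fix z assume z: "z \<in> ?N ?x \<inter> set P"
      then obtain i where i: "i < ?a" "z = P ! i" by (auto simp: in_set_conv_nth)
      show "z \<in> insert (last P) ((!) P ` I)"
      proof (cases "i + 1 < ?a")
        case True
        then have "i \<in> I" unfolding I_def using z i by simp
        then show ?thesis using i by blast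
      next
        case False
        then have "i = ?a - 1" using i by simp
        moreover have "P \<noteq> []" using i by auto
        ultimately show ?thesis using i by (simp add: last_conv_nth)
      qed
    qed
    then have "card (?N ?x \<inter> set P) \<le> card (insert (last P) ((!) P ` I))" using fIJ by (intro card_mono) auto
    also have "\<dots> \<le> Suc (card ((!) P ` I))" by (rule card_insert_le_m1) auto
    also have "card ((!) P ` I) \<le> card I" by (rule card_image_le[OF fIJ(1)])
    finally have cI: "card (?N ?x \<inter> set P) \<le> Suc (card I)" by simp
    have "?N ?y \<inter> set P \<subseteq> insert (hd P) ((\<lambda>i. P ! (i + 1)) ` J)"
    proof
      fix z assume z: "z \<in> ?N ?y \<inter> set P"
      then obtain i where i: "i < ?a" "z = P ! i" by (auto simp: in_set_conv_nth)
      show "z \<in> insert (hd P) ((\<lambda>i. P ! (i + 1)) ` J)"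
      proof (cases i)
        case 0
        moreover have "P \<noteq> []" using i by auto
        ultimately show ?thesis using i by (simp add: hd_conv_nth)
      next
        case (Suc j)
        then have "j \<in> J" unfolding J_def using z i by simp
        then show ?thesis using i Suc by auto
      qed
    qed
    then have "card (?N ?y \<inter> set P) \<le> card (insert (hd P) ((\<lambda>i. P ! (i + 1)) ` J))" using fIJ by (intro card_mono) auto
    also have "\<dots> \<le> Suc (card ((\<lambda>i. P ! (i + 1)) ` J))" by (rule card_insert_le_m1) auto
    also have "card ((\<lambda>i. P ! (i + 1)) ` J) \<le> card J" by (rule card_image_le[OF fIJ(2)])
    finally have cJ: "card (?N ?y \<inter> set P) \<le> Suc (card J)" by simp
    \<comment> \<open>Both index sets live among \<open>?a - 2\<close> indices, as \<open>m\<close>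
      is in neither, while each end of the path accounts for at most one uncounted neighbour. So the
      degree sum \<open>card A + 1\<close> just suffices.\<close>
    have "I \<inter> J \<noteq> {}"
    proof
      assume "I \<inter> J = {}"
      then have "card I + card J = card (I \<union> J)" using fIJ by (intro card_Un_disjoint[symmetric]) auto
      also have "\<dots> \<le> card ({..<?a - 1} - {m})"
        using Eirr unfolding I_def J_def by (intro card_mono) auto
      also have "\<dots> = ?a - 2" using m by simp
      finally show False using big cI cJ m by linarith
    qed
    then obtain i where i: "i + 1 < ?a" "E ?x (P ! i)" "E ?y (P ! (i + 1))" unfolding I_def J_def by blast
    have im: "i \<noteq> m" using i(2) Eirr by auto
    \<comment> \<open>Ordering the two indices makes the cases of a crossing before and after the
      missing edge the same reversal.\<close>
    define lo where "lo = min i m"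
    define hi where "hi = max i m"
    have lh: "lo < hi" "hi + 1 < ?a" using im i(1) m unfolding lo_def hi_def by auto
    have e: "E (P ! lo) (P ! hi)" "E (P ! (lo + 1)) (P ! (hi + 1))"
      using i(2,3) Esym unfolding lo_def hi_def by (auto simp: min_def max_def)
    have mid: "m = lo \<or> m = hi" unfolding lo_def hi_def by auto
    let ?A = "take (lo + 1) P" and ?B = "drop (lo + 1) (take (hi + 1) P)" and ?C = "drop (hi + 1) P"
    have cat: "P = ?A @ ?B @ ?C"
    proof -
      have "take (hi + 1) P = take (lo + 1) (take (hi + 1) P) @ ?B" by (rule append_take_drop_id[symmetric])
      moreover have "take (lo + 1) (take (hi + 1) P) = ?A" using lh by (simp add: min_def)
      ultimately show ?thesis by (metis append.assoc append_take_drop_id)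
    qed
    have ne: "?A \<noteq> []" "?B \<noteq> []" "?C \<noteq> []" using lh by auto
    have sA: "successively E ?A" "successively E ?B" "successively E ?C"
      unfolding successively_conv_nth using adj lh mid by auto
    have ends: "last ?A = P ! lo" "hd ?B = P ! (lo + 1)" "last ?B = P ! hi" "hd ?C = P ! (hi + 1)"
    proof -
      show "last ?A = P ! lo" using lh by (intro last_take_Suc) simp
      show "hd ?B = P ! (lo + 1)" "hd ?C = P ! (hi + 1)" using lh by (simp_all add: hd_drop_conv_nth)
      have "last ?B = last (take (hi + 1) P)" using lh by (intro last_drop) simp
      then show "last ?B = P ! hi" using lh last_take_Suc[of hi P] by simp
    qed
    let ?P = "?A @ rev ?B @ ?C"
    have "successively E (rev ?B)" using sA(2) by (auto elim!: successively_mono intro: Esym)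
    then have "successively E ?P"
      using sA e ne ends by (simp add: successively_append_iff hd_rev last_rev del: successively_rev)
    moreover have "distinct (?A @ ?B @ ?C)" using P(1) cat by simp
    then have "distinct ?P" by auto
    moreover have "set (?A @ ?B @ ?C) \<subseteq> A" using P(2) cat by simp
    then have "set ?P \<subseteq> A" by auto
    moreover have "hd ?P = hd P" "last ?P = last P" using ne cat lh by (auto simp: hd_take)
    ultimately have "gpath E A (hd P) ?P (last P)" unfolding gpath_def using ne by blast
    moreover have "length ?P = length P" using lh by simp
    ultimately show ?thesis by (intro exI[of _ ?P]) simp
  qed
qed

text \<open>A path has distinct vertices, hence uses the added edge at most once, so one rerouting
  is enough.\<close>

lemma closure_edge_path:
  fixes E :: "'a \<Rightarrow> 'a \<Rightarrow> bool"
  assumes "finite A" "symp E" "irreflp E"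
    and deg: "card A + 1 \<le> card {z \<in> A. E x z} + card {z \<in> A. E y z}"
    and P: "gpath (\<lambda>a b. E a b \<or> a = x \<and> b = y \<or> a = y \<and> b = x) A u P v"
  shows "\<exists>P'. gpath E A u P' v \<and> length P \<le> length P'"
proof -
  have P': "distinct P" "set P \<subseteq> A" "hd P = u" "last P = v" "P \<noteq> []" using P unfolding gpath_def by auto
  have adj: "E (P ! k) (P ! (k + 1)) \<or> {P ! k, P ! (k + 1)} = {x, y}" if "k + 1 < length P" for k
    using P that unfolding gpath_def successively_conv_nth by auto
  show ?thesis
  proof (cases "\<exists>m. m + 1 < length P \<and> \<not> E (P ! m) (P ! (m + 1))")
    case False
    then have "successively E P" unfolding successively_conv_nth by simp
    then have "gpath E A u P v" using P unfolding gpath_def by blast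
    then show ?thesis by blast
  next
    case True
    then obtain m where m: "m + 1 < length P" "\<not> E (P ! m) (P ! (m + 1))" by blast
    then have xy: "{P ! m, P ! (m + 1)} = {x, y}" using adj by blast
    have "E (P ! k) (P ! (k + 1))" if k: "k + 1 < length P" "k \<noteq> m" for k
    proof (rule ccontr)
      assume "\<not> ?thesis"
      then have "{P ! k, P ! (k + 1)} = {P ! m, P ! (m + 1)}" using adj[OF k(1)] xy by simp
      then have "P ! k = P ! m \<or> P ! k = P ! (m + 1) \<and> P ! (k + 1) = P ! m"
        by (auto simp: doubleton_eq_iff)
      then show False using k m(1) nth_eq_iff_index_eq[OF P'(1)] by auto
    qed
    moreover have "card A + 1 \<le> card {z \<in> A. E (P ! m) z} + card {z \<in> A. E (P ! (m + 1)) z}"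
      using xy deg unfolding doubleton_eq_iff by auto
    ultimately show ?thesis using reroute[OF assms(1-3) P'(1,2) m(1)] P'(3,4) by blast
  qed
qed

subsection \<open>Cycles and closures of pair graphs\<close>

abbreviation adj :: "'a pair_pre_digraph \<Rightarrow> 'a \<Rightarrow> 'a \<Rightarrow> bool" where
  "adj G a b \<equiv> (a, b) \<in> parcs G"

lemma pair_graphD:
  assumes "pair_graph G"
  shows "finite (pverts G)" "finite (parcs G)" "parcs G \<subseteq> pverts G \<times> pverts G"
    "symp (adj G)" "irreflp (adj G)"
proof -
  interpret pair_graph G by fact
  show "finite (pverts G)" "finite (parcs G)" by (rule pair_finite_verts, rule pair_finite_arcs)
  show "parcs G \<subseteq> pverts G \<times> pverts G" using in_arcsD1 in_arcsD2 by auto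
  show "symp (adj G)" using arcs_symmetric by (auto intro: sympI)
  show "irreflp (adj G)" using pair_no_loops by (fastforce intro: irreflpI)
qed

lemma pair_graphI:
  assumes "finite (pverts G)" "parcs G \<subseteq> pverts G \<times> pverts G" "symp (adj G)" "irreflp (adj G)"
  shows "pair_graph G"
proof -
  have "finite (parcs G)" using assms(1,2) by (meson finite_SigmaI finite_subset)
  moreover have "fst e \<noteq> snd e" if "e \<in> parcs G" for e
    using irreflpD[OF assms(4), of "fst e"] that by (metis prod.collapse)
  ultimately show ?thesis using assms(1-3)
    by unfold_locales (auto simp: symmetric_def sym_def dest: sympD)
qed

lemma out_degree_card:
  assumes "parcs G \<subseteq> pverts G \<times> pverts G"
  shows "out_degree (with_proj G) u = card {z \<in> pverts G. adj G u z}"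
proof -
  have "out_arcs (with_proj G) u = Pair u ` {z \<in> pverts G. adj G u z}"
    unfolding out_arcs_def using assms by force
  then show ?thesis unfolding out_degree_def by (simp add: card_image inj_on_def)
qed

lemma closure_step_pair_graph: "closure_step m G H \<Longrightarrow> pair_graph G \<Longrightarrow> pair_graph H"
proof -
  assume s: "closure_step m G H" and G: "pair_graph G"
  obtain x y where xy: "x \<in> pverts G" "y \<in> pverts G" "x \<noteq> y"
    "H = \<lparr>pverts = pverts G, parcs = parcs G \<union> {(x, y), (y, x)}\<rparr>"
    using s unfolding closure_step_def by blast
  note g = pair_graphD[OF G]
  show ?thesis
  proof (rule pair_graphI)
    show "symp (adj H)" by (rule sympI) (use xy(4) sympD[OF g(4)] in auto)
    show "irreflp (adj H)" by (rule irreflpI) (use xy irreflpD[OF g(5)] in auto)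
  qed (use xy g in auto)
qed

lemma closure_steps_pair_graph: "(closure_step m)\<^sup>*\<^sup>* G H \<Longrightarrow> pair_graph G \<Longrightarrow> pair_graph H"
  by (induction rule: rtranclp_induct) (auto intro: closure_step_pair_graph)

lemma closure_paths:
  assumes "(closure_step (card (pverts G) + 1))\<^sup>*\<^sup>* G H" "pair_graph G"
    "gpath (adj H) (pverts G) u P v"
  shows "\<exists>P'. gpath (adj G) (pverts G) u P' v \<and> length P \<le> length P'"
  using assms
proof (induction arbitrary: P rule: rtranclp_induct)
  case base
  then show ?case by blast
next
  case (step H H')
  have H: "pair_graph H" by (rule closure_steps_pair_graph[OF step.hyps(1) step.prems(1)])
  note h = pair_graphD[OF H]
  have V: "pverts H = pverts G" by (rule closure_step_verts[OF step.hyps(1)])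
  obtain x y where xy: "card (pverts G) + 1 \<le> out_degree (with_proj H) x + out_degree (with_proj H) y"
    "parcs H' = parcs H \<union> {(x, y), (y, x)}"
    using step.hyps(2) unfolding closure_step_def by auto
  have "adj H' = (\<lambda>a b. adj H a b \<or> a = x \<and> b = y \<or> a = y \<and> b = x)" using xy(2) by auto
  then have "\<exists>P'. gpath (adj H) (pverts G) u P' v \<and> length P \<le> length P'"
    using closure_edge_path[OF h(1,4,5), of x y u P v] xy(1) step.prems(2)
    unfolding out_degree_card[OF h(3)] V by simp
  then obtain P' where P': "gpath (adj H) (pverts G) u P' v" "length P \<le> length P'" by blast
  show ?case using step.IH[OF step.prems(1) P'(1)] P'(2) by (meson le_trans)
qed

lemma pcas_nth:
  assumes "pcas u p v" "p \<noteq> []"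
  shows "fst (p ! 0) = u" "snd (p ! (length p - 1)) = v"
    "i + 1 < length p \<Longrightarrow> snd (p ! i) = fst (p ! (i + 1))"
proof -
  have "fst (p ! 0) = u \<and> snd (p ! (length p - 1)) = v \<and> (i + 1 < length p \<longrightarrow> snd (p ! i) = fst (p ! (i + 1)))"
    using assms
  proof (induction p arbitrary: u i)
    case (Cons e es)
    show ?case
    proof (cases "es = []")
      case False
      then have IH: "fst (es ! 0) = snd e" "snd (es ! (length es - 1)) = v"
        "j + 1 < length es \<longrightarrow> snd (es ! j) = fst (es ! (j + 1))" for j
        using Cons.IH[of "snd e"] Cons.prems(1) by auto
      then show ?thesis using Cons.prems False IH(3)[of "i - 1"] by (cases i) auto
    qed (use Cons.prems in auto)
  qed simp
  then show "fst (p ! 0) = u" "snd (p ! (length p - 1)) = v"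
    "i + 1 < length p \<Longrightarrow> snd (p ! i) = fst (p ! (i + 1))" by auto
qed

lemma pawalk_verts_pcas: "pcas u p v \<Longrightarrow> pawalk_verts u p = u # map snd p"
  by (induction p arbitrary: u) auto

lemma pcas_zip: "pcas u (zip (u # xs) (xs @ [y])) y"
  by (induction xs arbitrary: u) auto

lemma graph_cycle_iff:
  assumes "pair_graph G"
  shows "graph_cycle G C \<longleftrightarrow> 3 \<le> length C \<and> set C \<subseteq> parcs G \<and> distinct (map snd C) \<and> (\<exists>u. pcas u C u)"
proof -
  have "u \<in> pverts G" if "pcas u C u" "C \<noteq> []" "set C \<subseteq> parcs G" for u
  proof -
    have "C ! 0 \<in> parcs G" using that(2,3) by auto
    then have "fst (C ! 0) \<in> pverts G" using pair_graphD(3)[OF assms] by (auto simp: mem_Times_iff)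
    then show ?thesis using pcas_nth(1)[OF that(1,2)] by simp
  qed
  note start = this
  have "graph_cycle G C \<longleftrightarrow> 3 \<le> length C \<and> (\<exists>u. u \<in> pverts G \<and> set C \<subseteq> parcs G \<and> pcas u C u \<and>
      distinct (tl (pawalk_verts u C)) \<and> C \<noteq> [])"
    unfolding graph_cycle_def pre_digraph.cycle_def pre_digraph.awalk_def cas_with_proj_eq awalk_verts_with_proj_eq
    by auto
  also have "\<dots> \<longleftrightarrow> 3 \<le> length C \<and> set C \<subseteq> parcs G \<and> distinct (map snd C) \<and> (\<exists>u. pcas u C u)"
  proof (intro iffI; elim conjE exE)
    fix u assume "3 \<le> length C" "set C \<subseteq> parcs G" "distinct (map snd C)" "pcas u C u"
    moreover from this have "C \<noteq> []" by auto
    ultimately show "3 \<le> length C \<and> (\<exists>u. u \<in> pverts G \<and> set C \<subseteq> parcs G \<and> pcas u C u \<and>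
      distinct (tl (pawalk_verts u C)) \<and> C \<noteq> [])"
      using start[of u] pawalk_verts_pcas[of u C u] by (intro conjI exI[of _ u]) auto
  qed (auto simp: pawalk_verts_pcas)
  finally show ?thesis .
qed

lemma zip_shift_mem:
  "(a, b) \<in> set (zip P (tl P @ [y])) \<Longrightarrow> a \<in> set P \<and> (b \<in> set P \<or> a = last P \<and> b = y)"
proof (induction P)
  case (Cons x P)
  then show ?case by (cases P) auto
qed simp

lemma zip_shift_adj:
  "successively E P \<Longrightarrow> P \<noteq> [] \<Longrightarrow> E (last P) y \<Longrightarrow> (a, b) \<in> set (zip P (tl P @ [y])) \<Longrightarrow> E a b"
proof (induction P)
  case (Cons x P)
  then show ?case by (cases P) auto
qed simp

lemma graph_cycle_of_list:
  assumes G: "pair_graph G" and vs: "distinct vs" "3 \<le> length vs" "successively (adj G) vs" "adj G (last vs) (hd vs)"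
  shows "graph_cycle G (zip vs (tl vs @ [hd vs]))"
proof -
  obtain x xs where x: "vs = x # xs" using vs(2) by (cases vs) auto
  have len: "length vs = length (tl vs @ [hd vs])" unfolding x by simp
  have "set (zip vs (tl vs @ [hd vs])) \<subseteq> parcs G"
  proof
    fix e assume e: "e \<in> set (zip vs (tl vs @ [hd vs]))"
    obtain a b where ab: "e = (a, b)" by (cases e)
    have "vs \<noteq> []" unfolding x by simp
    then have "adj G a b" using e unfolding ab by (rule zip_shift_adj[OF vs(3) _ vs(4)])
    then show "e \<in> parcs G" unfolding ab .
  qed
  moreover have "map snd (zip vs (tl vs @ [hd vs])) = tl vs @ [hd vs]" by (rule map_snd_zip[OF len])
  moreover have "distinct (tl vs @ [hd vs])" using vs(1) unfolding x by simp
  moreover have "pcas x (zip vs (tl vs @ [hd vs])) x" unfolding x list.sel by (rule pcas_zip)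
  moreover have "3 \<le> length (zip vs (tl vs @ [hd vs]))" using vs(2) unfolding x by simp
  ultimately show ?thesis unfolding graph_cycle_iff[OF G] by (metis (no_types, lifting))
qed

text \<open>Turns the arc list into the periodic indexing of \<open>cycle_frame\<close>. Edges are
  as many as arcs because a cycle of length at least 3 uses no edge in both directions.\<close>

lemma cycle_index:
  assumes G: "pair_graph G" and C: "graph_cycle G C"
  obtains f where "\<forall>i j. f i = f j \<longleftrightarrow> i mod int (length C) = j mod int (length C)"
    "range f = cycle_verts C" "\<forall>i. adj G (f i) (f (i + 1))" "card (cycle_edges C) = length C"
proof -
  let ?c = "length C"
  have c3: "3 \<le> ?c" and sub: "set C \<subseteq> parcs G" and dis: "distinct (map snd C)"
    using C unfolding graph_cycle_iff[OF G] by auto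
  obtain u where u: "pcas u C u" using C unfolding graph_cycle_iff[OF G] by blast
  have ne: "C \<noteq> []" using c3 by auto
  have nxt: "snd (C ! i) = fst (C ! ((i + 1) mod ?c))" if "i < ?c" for i
  proof (cases "i + 1 < ?c")
    case True
    then show ?thesis using pcas_nth(3)[OF u ne True] by simp
  next
    case False
    then have "i = ?c - 1" "i + 1 = ?c" using that by auto
    then show ?thesis using pcas_nth(1,2)[OF u ne] by simp
  qed
  have sinj: "i = j" if "i < ?c" "j < ?c" "snd (C ! i) = snd (C ! j)" for i j
    using nth_eq_iff_index_eq[OF dis, of i j] that by simp
  have prv: "\<exists>j<?c. (j + 1) mod ?c = i \<and> fst (C ! i) = snd (C ! j)" if "i < ?c" for i
  proof (cases i)
    case 0
    have "?c - 1 + 1 = ?c" using c3 by simp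
    then have "(?c - 1 + 1) mod ?c = 0" by simp
    then show ?thesis using nxt[of "?c - 1"] c3 0 by (intro exI[of _ "?c - 1"]) simp
  next
    case (Suc j)
    then show ?thesis using nxt[of j] that by (intro exI[of _ j]) auto
  qed
  have finj: "i = j" if "i < ?c" "j < ?c" "fst (C ! i) = fst (C ! j)" for i j
    using prv[OF that(1)] prv[OF that(2)] sinj that(3) by metis
  define f where "f i = fst (C ! nat (i mod int ?c))" for i
  have lt: "nat (i mod int ?c) < ?c" for i
  proof -
    have "0 < int ?c" using c3 by linarith
    then have "0 \<le> i mod int ?c" "i mod int ?c < int ?c" by (rule pos_mod_sign, rule pos_mod_bound)
    then show ?thesis by linarith
  qed
  have feq: "f i = f j \<longleftrightarrow> i mod int ?c = j mod int ?c" for i j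
  proof
    assume "f i = f j"
    then have "nat (i mod int ?c) = nat (j mod int ?c)" unfolding f_def using finj[OF lt lt] by blast
    moreover have "0 < int ?c" using c3 by linarith
    then have "0 \<le> i mod int ?c" "0 \<le> j mod int ?c" by (rule pos_mod_sign)+
    ultimately show "i mod int ?c = j mod int ?c" by (simp only: eq_nat_nat_iff)
  qed (simp add: f_def)
  have fstep: "C ! nat (i mod int ?c) = (f i, f (i + 1))" for i
  proof -
    have "(nat (i mod int ?c) + 1) mod ?c = nat ((i + 1) mod int ?c)"
    proof -
      have "0 < int ?c" using c3 by linarith
      then have "int (nat (i mod int ?c)) = i mod int ?c" using pos_mod_sign by simp
      then have "int ((nat (i mod int ?c) + 1) mod ?c) = (i mod int ?c + 1) mod int ?c"
        by (simp only: zmod_int of_nat_add of_nat_1)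
      also have "\<dots> = (i + 1) mod int ?c" by (simp add: mod_simps)
      finally show ?thesis by linarith
    qed
    then show ?thesis using nxt[OF lt, of i] unfolding f_def by (simp add: prod_eq_iff)
  qed
  have mem: "(f i, f (i + 1)) \<in> set C" for i using nth_mem[OF lt, of i] unfolding fstep .
  have idx: "e = (f (int i), f (int i + 1))" if "i < ?c" "e = C ! i" for e i
    using fstep[of "int i"] that by simp
  have rng: "range f = cycle_verts C"
  proof
    show "range f \<subseteq> cycle_verts C" unfolding cycle_verts_def using mem by force
    show "cycle_verts C \<subseteq> range f"
    proof
      fix z assume "z \<in> cycle_verts C"
      then obtain e where "e \<in> set C" "z = fst e" unfolding cycle_verts_def by blast
      then obtain i where "i < ?c" "e = C ! i" by (metis in_set_conv_nth)
      then have "e = (f (int i), f (int i + 1))" by (rule idx)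
      then have "z = f (int i)" using \<open>z = fst e\<close> by simp
      then show "z \<in> range f" by (rule range_eqI)
    qed
  qed
  have "inj_on edge_of (set C)"
  proof (rule inj_onI)
    fix e e' assume e: "e \<in> set C" "e' \<in> set C" "edge_of e = edge_of e'"
    obtain i j where i: "i < ?c" "e = C ! i" and j: "j < ?c" "e' = C ! j" using e by (metis in_set_conv_nth)
    have "{f (int i), f (int i + 1)} = {f (int j), f (int j + 1)}"
      using e(3) idx[OF i] idx[OF j] unfolding edge_of_def by simp
    then consider "f (int i) = f (int j)" | "f (int i) = f (int j + 1)" "f (int i + 1) = f (int j)"
      by (auto simp: doubleton_eq_iff)
    then show "e = e'"
    proof cases
      case 1
      then have "i = j" using i j unfolding feq by simp
      then show ?thesis using i j by simp
    next
      case 2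
      \<comment> \<open>Opposite arcs would make the length of the cycle divide 2.\<close>
      then have "int ?c dvd int i - (int j + 1)" "int ?c dvd (int i + 1) - int j"
        unfolding feq mod_eq_dvd_iff by auto
      then have "int ?c dvd ((int i + 1) - int j) - (int i - (int j + 1))" by (rule dvd_diff[rotated])
      then have "int ?c dvd 2" by simp
      then show ?thesis using zdvd_imp_le[of "int ?c" 2] c3 by simp
    qed
  qed
  moreover have "distinct C" using dis by (simp add: distinct_map)
  ultimately have "card (cycle_edges C) = ?c" unfolding cycle_edges_def by (simp add: card_image distinct_card)
  then show ?thesis using that[of f] feq rng mem sub by blast
qed

text \<open>The path followed by the reversed ear is a cycle; only the two edges joining them can
  have exactly one endpoint on \<open>C\<close>.\<close>

lemma locally_maximal_bound:
  assumes G: "pair_graph G" and C: "locally_maximal_cycle G C"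
    and P: "gpath (adj G) (cycle_verts C) u P v" "u \<noteq> v"
    and rs: "rs \<noteq> []" "distinct rs" "set rs \<inter> cycle_verts C = {}" "successively (adj G) rs"
    and e: "adj G u (hd rs)" "adj G (last rs) v"
  shows "length P + length rs \<le> card (cycle_edges C)"
proof (rule ccontr)
  assume long: "\<not> ?thesis"
  note g = pair_graphD[OF G]
  let ?A = "cycle_verts C" and ?R = "rev rs"
  let ?vs = "P @ ?R"
  let ?C = "zip ?vs (tl ?vs @ [hd ?vs])"
  have p: "P \<noteq> []" "hd P = u" "last P = v" "distinct P" "set P \<subseteq> ?A" "successively (adj G) P"
    using P(1) unfolding gpath_def by auto
  have "2 \<le> length P" using p P(2) by (cases P; cases "tl P") auto
  moreover have "1 \<le> length rs" using rs(1) by (cases rs) auto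
  ultimately have l3: "3 \<le> length ?vs" by simp
  have "successively (adj G) ?R" using rs(4) by (auto elim!: successively_mono dest: sympD[OF g(4)])
  moreover have "adj G (last P) (hd ?R)" unfolding p(3) hd_rev by (rule sympD[OF g(4) e(2)])
  ultimately have "successively (adj G) ?vs" using p(6) unfolding successively_append_iff by blast
  moreover have "adj G (last ?vs) (hd ?vs)" using sympD[OF g(4) e(1)] p(1,2) rs(1) by (simp add: last_rev)
  moreover have "distinct ?vs" using p(4,5) rs(2,3) by auto
  ultimately have cyc: "graph_cycle G ?C" using l3 by (intro graph_cycle_of_list[OF G])
  have "length (tl ?vs @ [hd ?vs]) = length ?vs" using p(1) by (cases P) auto
  then have len: "length ?C = length P + length rs" by (simp only: length_zip min.idem length_append length_rev)
  have "card (cycle_edges ?C) = length ?C" by (rule cycle_index[OF G cyc])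
  then have bigger: "card (cycle_edges C) < card (cycle_edges ?C)" using long len by simp
  have split: "?C = zip P (tl P @ [hd ?R]) @ zip ?R (tl ?R @ [hd P])"
  proof -
    obtain x xs where x: "P = x # xs" using p(1) by (cases P) auto
    obtain y ys where y: "?R = y # ys" using rs(1) by (cases ?R) auto
    have "tl ?vs @ [hd ?vs] = (xs @ [y]) @ (ys @ [x])" unfolding x y by simp
    then have "?C = zip ((x # xs) @ (y # ys)) ((xs @ [y]) @ (ys @ [x]))" unfolding x y by simp
    also have "\<dots> = zip (x # xs) (xs @ [y]) @ zip (y # ys) (ys @ [x])" by (rule zip_append) simp
    finally show ?thesis unfolding x y by simp
  qed
  have "cycle_edges ?C \<inter> boundary G ?A \<subseteq> {{last P, hd ?R}, {last ?R, hd P}}"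
  proof
    fix ed assume ed: "ed \<in> cycle_edges ?C \<inter> boundary G ?A"
    then obtain a b where ab: "(a, b) \<in> set ?C" "ed = {a, b}" unfolding cycle_edges_def edge_of_def by force
    have c1: "card ({a, b} \<inter> ?A) = 1" using ed ab unfolding boundary_def by simp
    have mixed: "\<not> (a \<in> ?A \<and> b \<in> ?A)" "\<not> (a \<notin> ?A \<and> b \<notin> ?A)"
    proof -
      have "adj G a b" using cyc ab(1) unfolding graph_cycle_iff[OF G] by blast
      then have "a \<noteq> b" using irreflpD[OF g(5)] by auto
      then show "\<not> (a \<in> ?A \<and> b \<in> ?A)" using c1 by auto
      show "\<not> (a \<notin> ?A \<and> b \<notin> ?A)"
      proof
        assume "a \<notin> ?A \<and> b \<notin> ?A"
        then have "{a, b} \<inter> ?A = {}" by simp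
        then show False using c1 by (simp only: card.empty)
      qed
    qed
    have "(a, b) \<in> set (zip P (tl P @ [hd ?R])) \<or> (a, b) \<in> set (zip ?R (tl ?R @ [hd P]))"
      using ab(1) unfolding split by simp
    then show "ed \<in> {{last P, hd ?R}, {last ?R, hd P}}"
    proof
      assume "(a, b) \<in> set (zip P (tl P @ [hd ?R]))"
      then show ?thesis using zip_shift_mem[of a b P "hd ?R"] mixed p(5) ab(2) by auto
    next
      assume "(a, b) \<in> set (zip ?R (tl ?R @ [hd P]))"
      then have m: "a \<in> set ?R \<and> (b \<in> set ?R \<or> a = last ?R \<and> b = hd P)" by (rule zip_shift_mem)
      have out: "z \<notin> ?A" if "z \<in> set ?R" for z using rs(3) that by auto
      show ?thesis using m out mixed(2) ab(2) by auto
    qed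
  qed
  then have "card (cycle_edges ?C \<inter> boundary G ?A) \<le> card {{last P, hd ?R}, {last ?R, hd P}}"
    by (intro card_mono) auto
  also have "\<dots> \<le> 2" by (simp add: card_insert_if)
  finally show False using C cyc bigger unfolding locally_maximal_cycle_def by blast
qed

lemma card_parcs:
  assumes "pair_graph G" shows "card (parcs G) = 2 * num_edges G"
proof -
  note g = pair_graphD[OF assms]
  have fib: "card {a \<in> parcs G. edge_of a = e} = 2" if "e \<in> edge_of ` parcs G" for e
  proof -
    obtain u v where uv: "adj G u v" "e = {u, v}" using \<open>e \<in> _\<close> unfolding edge_of_def by force
    have vu: "adj G v u" "u \<noteq> v" using uv(1) sympD[OF g(4)] irreflpD[OF g(5)] by auto
    have "{a \<in> parcs G. edge_of a = e} = {(u, v), (v, u)}"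
      using uv vu unfolding edge_of_def by (auto simp: doubleton_eq_iff)
    then show ?thesis using vu(2) by simp
  qed
  have "card (parcs G) = (\<Sum>a\<in>parcs G. 1)" by simp
  also have "\<dots> = (\<Sum>e\<in>edge_of ` parcs G. \<Sum>a\<in>{a \<in> parcs G. edge_of a = e}. 1)"
    by (rule sum.image_gen[OF g(2)])
  also have "\<dots> = (\<Sum>e\<in>edge_of ` parcs G. 2)" using fib by (intro sum.cong) auto
  finally show ?thesis unfolding num_edges_def edges_def by simp
qed

lemma connected_cut:
  assumes "Digraph_Component.connected K" "D \<subseteq> verts K" "D \<noteq> {}" "D \<noteq> verts K"
  shows "\<exists>e\<in>arcs K. tail K e \<in> D \<and> head K e \<notin> D \<or> head K e \<in> D \<and> tail K e \<notin> D"
proof (rule ccontr)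
  assume no: "\<not> ?thesis"
  obtain a b where ab: "a \<in> D" "b \<in> verts K" "b \<notin> D" using assms by blast
  have "verts (with_proj (mk_symmetric K)) = verts K" unfolding mk_symmetric_def by simp
  then have "a \<rightarrow>\<^sup>*\<^bsub>with_proj (mk_symmetric K)\<^esub> b"
    using assms(1,2) ab unfolding Digraph_Component.connected_def strongly_connected_def by auto
  then have "b \<in> D" unfolding reachable_def
  proof (induction rule: rtrancl_on_induct)
    case (step x y)
    then have "(x, y) \<in> parcs (mk_symmetric K)" by simp
    then obtain e where "e \<in> arcs K" "(x, y) = (tail K e, head K e) \<or> (x, y) = (head K e, tail K e)"
      unfolding mk_symmetric_def by auto
    then show ?case using step.IH no by auto
  qed (use ab in simp)
  then show False using ab by simp
qed

lemma two_connected_cut: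
  assumes G: "pair_graph G" "two_connected G" and D: "D \<subseteq> pverts G - {v}" "D \<noteq> {}" "D \<noteq> pverts G - {v}"
  shows "\<exists>a\<in>D. \<exists>b\<in>pverts G - D - {v}. adj G a b"
proof -
  note g = pair_graphD[OF G(1)]
  have "\<exists>e\<in>parcs G. fst e \<noteq> v \<and> snd e \<noteq> v \<and> (fst e \<in> D \<and> snd e \<notin> D \<or> snd e \<in> D \<and> fst e \<notin> D)"
  proof (cases "v \<in> pverts G")
    case True
    let ?K = "pre_digraph.del_vert (with_proj G) v"
    have "Digraph_Component.connected ?K" using G(2) True unfolding two_connected_def by blast
    moreover have "verts ?K = pverts G - {v}" by (simp add: pre_digraph.verts_del_vert)
    ultimately obtain e where "e \<in> arcs ?K" "tail ?K e \<in> D \<and> head ?K e \<notin> D \<or> head ?K e \<in> D \<and> tail ?K e \<notin> D"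
      using connected_cut[of ?K D] D by auto
    then show ?thesis by (intro bexI[of _ e]) (auto simp: pre_digraph.del_vert_simps)
  next
    case False
    then have V: "pverts G - {v} = pverts G" by blast
    have "Digraph_Component.connected (with_proj G)" using G(2) unfolding two_connected_def by blast
    then obtain e where e: "e \<in> parcs G" "fst e \<in> D \<and> snd e \<notin> D \<or> snd e \<in> D \<and> fst e \<notin> D"
      using connected_cut[of "with_proj G" D] D unfolding V by auto
    moreover have "e \<in> pverts G \<times> pverts G" by (rule subsetD[OF g(3) e(1)])
    then have "fst e \<noteq> v" "snd e \<noteq> v" using False unfolding mem_Times_iff by auto
    ultimately show ?thesis by blast
  qed
  then obtain x y where xy: "adj G x y" "x \<noteq> v" "y \<noteq> v" "x \<in> D \<and> y \<notin> D \<or> y \<in> D \<and> x \<notin> D" by auto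
  have "adj G y x" "x \<in> pverts G" "y \<in> pverts G" using xy(1) sympD[OF g(4)] g(3) by auto
  then show ?thesis using xy by blast
qed

section \<open>Transport to graphs on natural numbers, and recognition of the extremal
  graphs\<close>

definition image_graph :: "('a \<Rightarrow> 'b) \<Rightarrow> 'a pair_pre_digraph \<Rightarrow> 'b pair_pre_digraph" where
  "image_graph \<phi> G = \<lparr>pverts = \<phi> ` pverts G, parcs = map_prod \<phi> \<phi> ` parcs G\<rparr>"

lemma image_graph_iso:
  assumes "parcs G \<subseteq> pverts G \<times> pverts G" "inj_on \<phi> (pverts G)"
  shows "digraph_iso (with_proj G) (with_proj (image_graph \<phi> G))"
proof -
  let ?h = "\<lparr>iso_verts = \<phi>, iso_arcs = map_prod \<phi> \<phi>, iso_head = snd, iso_tail = fst\<rparr>"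
  have wf: "wf_digraph (with_proj G)" using assms(1) by unfold_locales auto
  have "inj_on (map_prod \<phi> \<phi>) (parcs G)"
    using map_prod_inj_on[OF assms(2) assms(2)] assms(1) inj_on_subset by blast
  then have "pre_digraph.digraph_isomorphism (with_proj G) ?h"
    unfolding pre_digraph.digraph_isomorphism_def using wf assms(2) by auto
  moreover have "with_proj (image_graph \<phi> G) = app_iso ?h (with_proj G)"
    unfolding image_graph_def app_iso_def with_proj_def by simp
  ultimately show ?thesis unfolding digraph_iso_def by blast
qed

lemma is_W_image:
  assumes W: "is_W n k c G" and inj: "inj_on \<phi> (pverts G)"
  shows "is_W n k c (image_graph \<phi> G)"
proof -
  obtain K S T where K: "finite K" "finite T" "K \<inter> T = {}" "S \<subseteq> K" "card K = c + 1 - k" "card S = k"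
    "card (K \<union> T) = n" "pverts G = K \<union> T"
    "parcs G = {(u, v). u \<noteq> v \<and> (u \<in> K \<and> v \<in> K \<or> u \<in> S \<and> v \<in> T \<or> u \<in> T \<and> v \<in> S)}"
    using W unfolding is_W_def by (elim exE conjE)
  have i: "inj_on \<phi> (K \<union> T)" using inj K(8) by simp
  have iK: "inj_on \<phi> K" "inj_on \<phi> S" by (rule inj_on_subset[OF i]; use K in blast)+
  have eq: "\<phi> a = \<phi> b \<longleftrightarrow> a = b" if "a \<in> K \<union> T" "b \<in> K \<union> T" for a b
    using inj_on_eq_iff[OF i that] .
  have "map_prod \<phi> \<phi> ` parcs G = {(u, v). u \<noteq> v \<and> (u \<in> \<phi> ` K \<and> v \<in> \<phi> ` K \<or> u \<in> \<phi> ` S \<and> v \<in> \<phi> ` T \<or> u \<in> \<phi> ` T \<and> v \<in> \<phi> ` S)}"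
    (is "?L = ?R")
  proof
    show "?L \<subseteq> ?R"
    proof
      fix e assume "e \<in> ?L"
      then obtain a b where ab: "e = (\<phi> a, \<phi> b)" "a \<noteq> b" "a \<in> K \<and> b \<in> K \<or> a \<in> S \<and> b \<in> T \<or> a \<in> T \<and> b \<in> S"
        unfolding K(9) by auto
      then have "\<phi> a \<noteq> \<phi> b" using eq[of a b] K(4) by blast
      then show "e \<in> ?R" using ab by blast
    qed
    show "?R \<subseteq> ?L"
    proof (rule subsetI, elim CollectE case_prodE conjE)
      fix e u v assume e: "e = (u, v)" "u \<noteq> v" "u \<in> \<phi> ` K \<and> v \<in> \<phi> ` K \<or> u \<in> \<phi> ` S \<and> v \<in> \<phi> ` T \<or> u \<in> \<phi> ` T \<and> v \<in> \<phi> ` S"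
      then obtain a b where ab: "u = \<phi> a" "v = \<phi> b" "a \<in> K \<and> b \<in> K \<or> a \<in> S \<and> b \<in> T \<or> a \<in> T \<and> b \<in> S"
        by blast
      then have "(a, b) \<in> parcs G" unfolding K(9) using e(2) by auto
      then show "e \<in> ?L" using ab e(1) by force
    qed
  qed
  moreover have "\<phi> ` K \<inter> \<phi> ` T = {}" using inj_on_image_Int[OF i, of K T] K(3) by auto
  moreover have "card (\<phi> ` K \<union> \<phi> ` T) = n" using card_image[OF i] K(7) by (simp add: image_Un)
  moreover have "card (\<phi> ` K) = c + 1 - k" "card (\<phi> ` S) = k"
    using card_image[OF iK(1)] card_image[OF iK(2)] K(5,6) by simp_all
  ultimately show ?thesis unfolding is_W_def image_graph_def pair_pre_digraph.simps
    by (intro exI[of _ "\<phi> ` K"] exI[of _ "\<phi> ` S"] exI[of _ "\<phi> ` T"] conjI finite_imageI[OF K(1)]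
      finite_imageI[OF K(2)] image_mono[OF K(4)]) (simp_all only: K(8) image_Un)
qed

text \<open>The strict inequality yields at least one small clique, which puts \<open>x\<close> and
  \<open>y\<close> into \<open>A 0\<close>; injectivity on the vertices then keeps their images
  distinct.\<close>

lemma is_Z_image:
  assumes Z: "is_Z n k c G" and inj: "inj_on \<phi> (pverts G)" and n: "c + 1 - k < n"
  shows "is_Z n k c (image_graph \<phi> G)"
proof -
  obtain A t x y where A: "2 \<le> k" "c + 1 - k \<le> n" "t * (k - 1) = n - (c + 1 - k)" "x \<noteq> y"
     "\<forall>i\<le>t. finite (A i)" "card (A 0) = c + 1 - k" "\<forall>i\<in>{1..t}. card (A i) = k + 1"
     "\<forall>i\<le>t. \<forall>j\<le>t. i \<noteq> j \<longrightarrow> A i \<inter> A j = {x, y}"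
     "pverts G = (\<Union>i\<le>t. A i)"
     "parcs G = {(u, v). u \<noteq> v \<and> (\<exists>i\<le>t. u \<in> A i \<and> v \<in> A i)}"
    using Z unfolding is_Z_def by (elim exE conjE)
  have i: "inj_on \<phi> (\<Union>i\<le>t. A i)" using inj A(9) by simp
  have sub: "A j \<subseteq> (\<Union>i\<le>t. A i)" if "j \<le> t" for j using that by blast
  have iA: "inj_on \<phi> (A j)" if "j \<le> t" for j by (rule inj_on_subset[OF i sub[OF that]])
  have eq: "\<phi> a = \<phi> b \<longleftrightarrow> a = b" if "a \<in> (\<Union>i\<le>t. A i)" "b \<in> (\<Union>i\<le>t. A i)" for a b
    using inj_on_eq_iff[OF i that] .
  have int: "\<phi> ` A a \<inter> \<phi> ` A b = {\<phi> x, \<phi> y}" if ab: "a \<le> t" "b \<le> t" "a \<noteq> b" for a b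
  proof -
    have "\<phi> ` A a \<inter> \<phi> ` A b = \<phi> ` (A a \<inter> A b)" using inj_on_image_Int[OF i sub[OF ab(1)] sub[OF ab(2)]] by simp
    also have "A a \<inter> A b = {x, y}" using A(8) ab by blast
    finally show ?thesis by simp
  qed
  have arcs: "map_prod \<phi> \<phi> ` parcs G = {(u, v). u \<noteq> v \<and> (\<exists>i\<le>t. u \<in> \<phi> ` A i \<and> v \<in> \<phi> ` A i)}" (is "?L = ?R")
  proof
    show "?L \<subseteq> ?R"
    proof
      fix e assume "e \<in> ?L"
      then obtain a b j where ab: "e = (\<phi> a, \<phi> b)" "a \<noteq> b" "j \<le> t" "a \<in> A j" "b \<in> A j"
        unfolding A(10) by auto
      then have "\<phi> a \<noteq> \<phi> b" using eq[of a b] by blast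
      then show "e \<in> ?R" using ab by blast
    qed
    show "?R \<subseteq> ?L"
    proof (rule subsetI, elim CollectE case_prodE conjE exE)
      fix e u v j assume e: "e = (u, v)" "u \<noteq> v" "j \<le> t" "u \<in> \<phi> ` A j" "v \<in> \<phi> ` A j"
      then obtain a b where ab: "u = \<phi> a" "v = \<phi> b" "a \<in> A j" "b \<in> A j" by blast
      then have "(a, b) \<in> parcs G" unfolding A(10) using e(2,3) by auto
      then show "e \<in> ?L" using ab e(1) by force
    qed
  qed
  have "0 < t" using A(3) n by (cases t) auto
  then have "A 0 \<inter> A t = {x, y}" using A(8) by auto
  then have "x \<in> A 0" "y \<in> A 0" by blast+
  then have xy: "\<phi> x \<noteq> \<phi> y" using inj_on_eq_iff[OF iA[of 0]] A(4) by simp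
  have "\<forall>i\<le>t. finite (\<phi> ` A i)" "card (\<phi> ` A 0) = c + 1 - k" "\<forall>i\<in>{1..t}. card (\<phi> ` A i) = k + 1"
    using A(5-7) card_image[OF iA] by simp_all
  moreover have "\<phi> ` pverts G = (\<Union>i\<le>t. \<phi> ` A i)" unfolding A(9) by (rule image_UN)
  moreover have "\<forall>i\<le>t. \<forall>j\<le>t. i \<noteq> j \<longrightarrow> \<phi> ` A i \<inter> \<phi> ` A j = {\<phi> x, \<phi> y}" using int by simp
  ultimately show ?thesis unfolding is_Z_def image_graph_def pair_pre_digraph.simps
    by (intro exI[of _ "\<lambda>i. \<phi> ` A i"] exI[of _ t] exI[of _ "\<phi> x"] exI[of _ "\<phi> y"] conjI A(1-3) xy arcs)
qed

lemma two_choose: "2 * (m choose 2) = m * (m - 1)"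
  by (cases m) (auto simp: choose_two)

lemma two_f_fun:
  assumes "d \<le> c + 1" "c < n"
  shows "2 * f_fun n d c = (c + 1 - d) * (c - d) + 2 * d * (n + d - c - 1)"
  unfolding f_fun_def distrib_left two_choose by simp

text \<open>Twice \<open>f_fun\<close> is a quadratic polynomial in its second argument with leading
  coefficient 3, so on an interval it is largest at an end. It is evaluated over the integers to
  avoid truncated subtraction.\<close>

lemma f_fun_convex:
  assumes "a \<le> d" "d \<le> b" "b \<le> c" "c < n"
  shows "f_fun n d c \<le> max (f_fun n a c) (f_fun n b c)"
proof -
  define F where "F x = (int c + 1 - x) * (int c - x) + 2 * x * (int n + x - int c - 1)" for x
  have F: "int (2 * f_fun n x c) = F (int x)" if "x \<le> c" for x
  proof -
    have e: "int (c + 1 - x) = int c + 1 - int x" "int (c - x) = int c - int x"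
      "int (n + x - c - 1) = int n + int x - int c - 1" using that assms(4) by auto
    have "2 * f_fun n x c = (c + 1 - x) * (c - x) + 2 * x * (n + x - c - 1)"
      by (rule two_f_fun) (use that assms(4) in auto)
    then show ?thesis unfolding F_def by (simp only: of_nat_add of_nat_mult e of_nat_numeral)
  qed
  define A B D where "A = int a" and "B = int b" and "D = int d"
  have ab: "A \<le> D" "D \<le> B" unfolding A_def B_def D_def using assms by auto
  let ?\<beta> = "2 * int n - 4 * int c - 3"
  \<comment> \<open>The second factor is the secant slope between \<open>x\<close> and
    \<open>D\<close>; that it grows with \<open>x\<close> is the convexity used.\<close>
  have d1: "F D - F x = (D - x) * (3 * (D + x) + ?\<beta>)" for x
    unfolding F_def by (simp add: algebra_simps)
  have "F D \<le> F A \<or> F D \<le> F B"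
  proof (rule ccontr)
    assume "\<not> ?thesis"
    then have "0 < (D - A) * (3 * (D + A) + ?\<beta>)" "0 < (D - B) * (3 * (D + B) + ?\<beta>)"
      using d1[of A] d1[of B] by linarith+
    then have "0 < 3 * (D + A) + ?\<beta>" "3 * (D + B) + ?\<beta> < 0"
      using ab by (auto simp: zero_less_mult_iff)
    moreover have "3 * (D + A) \<le> 3 * (D + B)" using order_trans[OF ab] by simp
    ultimately have "0 < 3 * (D + B) + ?\<beta>" by (meson add_right_mono less_le_trans)
    then show False using \<open>3 * (D + B) + ?\<beta> < 0\<close> by (meson less_asym)
  qed
  then have "int (2 * f_fun n d c) \<le> int (2 * f_fun n a c) \<or> int (2 * f_fun n d c) \<le> int (2 * f_fun n b c)"
    using F[of d] F[of a] F[of b] assms unfolding A_def B_def D_def by auto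
  then show ?thesis by auto
qed

lemma is_W_of_structure:
  assumes "finite V" "card V = n" "Q \<subseteq> V" "S \<subseteq> Q" "card Q = c + 1 - k" "card S = k"
    "parcs G \<subseteq> V \<times> V" "pverts G = V"
    "\<forall>a\<in>V. \<forall>b\<in>V. adj G a b \<longleftrightarrow> a \<noteq> b \<and> (a \<in> Q \<and> b \<in> Q \<or> a \<in> S \<and> b \<notin> Q \<or> a \<notin> Q \<and> b \<in> S)"
  shows "is_W n k c G"
proof -
  have "parcs G = {(u, v). u \<noteq> v \<and> (u \<in> Q \<and> v \<in> Q \<or> u \<in> S \<and> v \<in> V - Q \<or> u \<in> V - Q \<and> v \<in> S)}" (is "_ = ?R")
  proof (rule equalityI; rule subsetI)
    fix e assume e: "e \<in> parcs G"
    obtain a b where ab: "e = (a, b)" by (cases e)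
    have "a \<in> V" "b \<in> V" using e assms(7) ab by auto
    then show "e \<in> ?R" using assms(9) e ab by auto
  next
    fix e assume e: "e \<in> ?R"
    obtain a b where ab: "e = (a, b)" by (cases e)
    have "a \<in> V" "b \<in> V" using e assms(3,4) ab by auto
    then show "e \<in> parcs G" using assms(9) e ab by auto
  qed
  moreover have QV: "Q \<union> (V - Q) = V" using assms(3) by blast
  moreover have "finite Q" by (rule finite_subset[OF assms(3,1)])
  moreover have "finite (V - Q)" using assms(1) by simp
  moreover have "Q \<inter> (V - Q) = {}" by blast
  moreover have "card (Q \<union> (V - Q)) = n" "pverts G = Q \<union> (V - Q)" unfolding QV by (fact assms)+
  ultimately show ?thesis unfolding is_W_def
    by (intro exI[of _ Q] exI[of _ S] exI[of _ "V - Q"] conjI assms(4-6))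
qed

text \<open>The set given for \<open>w\<close> must be the closed neighbourhood of \<open>w\<close>
  within \<open>V - Q\<close>, so it is unique. These sets partition \<open>V - Q\<close>; with
  \<open>u\<close> and \<open>v\<close> added they are the small cliques.\<close>

lemma is_Z_of_structure:
  assumes V: "finite V" "card V = n" "Q \<subseteq> V" "card Q = c + 1 - k" "2 \<le> k"
    and G: "parcs G \<subseteq> V \<times> V" "pverts G = V" "symp (adj G)" "irreflp (adj G)"
    and Q: "\<And>a b. a \<in> Q \<Longrightarrow> b \<in> Q \<Longrightarrow> a \<noteq> b \<Longrightarrow> adj G a b"
    and uv: "u \<in> Q" "v \<in> Q" "u \<noteq> v"
    and K: "\<forall>w\<in>V - Q. \<exists>K. K \<subseteq> V - Q \<and> w \<in> K \<and> card K + 1 = k \<and>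
      (\<forall>a\<in>K. \<forall>b\<in>V. adj G a b \<longleftrightarrow> a \<noteq> b \<and> b \<in> K \<union> {u, v})"
  shows "is_Z n k c G"
proof -
  define B where "B w = {z \<in> V - Q. z = w \<or> adj G w z}" for w
  have B: "B w \<subseteq> V - Q" "w \<in> B w" "card (B w) + 1 = k"
    "\<And>a b. a \<in> B w \<Longrightarrow> b \<in> V \<Longrightarrow> adj G a b \<longleftrightarrow> a \<noteq> b \<and> b \<in> B w \<union> {u, v}" "\<And>a. a \<in> B w \<Longrightarrow> B a = B w"
    if w: "w \<in> V - Q" for w
  proof -
    obtain L where L: "L \<subseteq> V - Q" "w \<in> L" "card L + 1 = k"
      "\<forall>a\<in>L. \<forall>b\<in>V. adj G a b \<longleftrightarrow> a \<noteq> b \<and> b \<in> L \<union> {u, v}" using K w by blast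
    have LB: "B a = L" if "a \<in> L" for a unfolding B_def using L that uv by auto
    then show "B w \<subseteq> V - Q" "w \<in> B w" "card (B w) + 1 = k" using L by auto
    show "adj G a b \<longleftrightarrow> a \<noteq> b \<and> b \<in> B w \<union> {u, v}" if "a \<in> B w" "b \<in> V" for a b
      using L(2,4) that LB by simp
    show "B a = B w" if "a \<in> B w" for a using LB L(2) that by simp
  qed
  let ?F = "B ` (V - Q)"
  have fin: "finite ?F" using V(1) by simp
  have finB: "finite X" if "X \<in> ?F" for X using that B(1) V(1) finite_subset by (metis finite_Diff imageE)
  have disj: "X \<inter> X' = {}" if XX: "X \<in> ?F" "X' \<in> ?F" "X \<noteq> X'" for X X'
  proof (rule ccontr)
    assume "X \<inter> X' \<noteq> {}"
    then obtain z where z: "z \<in> X" "z \<in> X'" by blast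
    obtain w w' where w: "w \<in> V - Q" "X = B w" "w' \<in> V - Q" "X' = B w'" using XX(1,2) by blast
    then show False using B(5)[OF w(1), of z] B(5)[OF w(3), of z] z XX(3) by simp
  qed
  have un: "\<Union> ?F = V - Q" using B(1,2) by blast
  define t where "t = card ?F"
  obtain h where h: "bij_betw h {1..t} ?F" using ex_bij_betw_nat_finite_1[OF fin] unfolding t_def by blast
  have hF: "h i \<in> ?F" if "i \<in> {1..t}" for i using bij_betwE[OF h] that by blast
  have hinj: "h i \<noteq> h j" if "i \<in> {1..t}" "j \<in> {1..t}" "i \<noteq> j" for i j
    using inj_onD[OF bij_betw_imp_inj_on[OF h], of i j] that by blast
  have cB: "card X = k - 1" if "X \<in> ?F" for X using that B(3) by fastforce
  have hQ: "h i \<subseteq> V - Q" if "i \<in> {1..t}" for i using hF[OF that] un by blast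
  define A where "A i = (if i = 0 then Q else h i \<union> {u, v})" for i
  have A0: "A 0 = Q" and Ai: "\<And>i. i \<in> {1..t} \<Longrightarrow> A i = h i \<union> {u, v}" unfolding A_def by auto
  have idx: "i = 0 \<or> i \<in> {1..t}" if "i \<le> t" for i using that by auto
  have fQ: "finite Q" using V(1,3) finite_subset by blast
  have cV: "card (V - Q) = n - (c + 1 - k)" using card_Diff_subset[OF fQ V(3)] V(2,4) by simp
  have "card (\<Union> ?F) = (\<Sum>X\<in>?F. card X)" by (rule card_Union_disjoint) (use finB disj in \<open>auto simp: pairwise_def disjnt_def\<close>)
  also have "\<dots> = t * (k - 1)" using cB unfolding t_def by simp
  finally have tk: "t * (k - 1) = n - (c + 1 - k)" using un cV by simp
  have le: "c + 1 - k \<le> n" using card_mono[OF V(1,3)] V(2,4) by simp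
  have finA: "\<forall>i\<le>t. finite (A i)"
  proof (intro allI impI)
    fix i assume "i \<le> t"
    then show "finite (A i)" using idx[of i] A0 Ai[of i] fQ finB[OF hF] by auto
  qed
  have cA: "\<forall>i\<in>{1..t}. card (A i) = k + 1"
  proof
    fix i assume i: "i \<in> {1..t}"
    have "card (h i \<union> {u, v}) = card (h i) + card {u, v}"
      using finB[OF hF[OF i]] hQ[OF i] uv by (intro card_Un_disjoint) auto
    then show "card (A i) = k + 1" using Ai[OF i] cB[OF hF[OF i]] uv(3) V(5) by simp
  qed
  have int: "\<forall>i\<le>t. \<forall>j\<le>t. i \<noteq> j \<longrightarrow> A i \<inter> A j = {u, v}"
  proof (intro allI impI)
    fix i j assume ij: "i \<le> t" "j \<le> t" "i \<noteq> j"
    consider "i = 0" "j \<in> {1..t}" | "j = 0" "i \<in> {1..t}" | "i \<in> {1..t}" "j \<in> {1..t}"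
      using idx[OF ij(1)] idx[OF ij(2)] ij(3) by blast
    then show "A i \<inter> A j = {u, v}"
    proof cases
      case 1
      then show ?thesis using A0 Ai[of j] hQ[of j] uv by auto
    next
      case 2
      then show ?thesis using A0 Ai[of i] hQ[of i] uv by auto
    next
      case 3
      then have "h i \<inter> h j = {}" using disj[OF hF hF] hinj ij(3) by blast
      then show ?thesis using Ai[OF 3(1)] Ai[OF 3(2)] by auto
    qed
  qed
  have im: "h ` {1..t} = ?F" using h by (simp add: bij_betw_def)
  have verts: "V = (\<Union>i\<le>t. A i)"
  proof (rule equalityI; rule subsetI)
    fix z assume z: "z \<in> V"
    show "z \<in> (\<Union>i\<le>t. A i)"
    proof (cases "z \<in> Q")
      case True
      then show ?thesis using A0 by blast
    next
      case False
      then have "z \<in> \<Union> (h ` {1..t})" using un im z by blast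
      then obtain i where "i \<in> {1..t}" "z \<in> h i" by blast
      then show ?thesis using Ai[of i] by auto
    qed
  next
    fix z assume "z \<in> (\<Union>i\<le>t. A i)"
    then obtain i where i: "i \<le> t" "z \<in> A i" by blast
    then show "z \<in> V" using idx[OF i(1)] A0 Ai[of i] hQ[of i] uv V(3) by auto
  qed
  have uvV: "u \<in> V" "v \<in> V" using uv V(3) by blast+
  have arcs: "parcs G = {(a, b). a \<noteq> b \<and> (\<exists>i\<le>t. a \<in> A i \<and> b \<in> A i)}" (is "_ = ?R")
  proof (rule equalityI; rule subsetI)
    fix e assume e: "e \<in> parcs G"
    obtain a b where ab: "e = (a, b)" by (cases e)
    have abV: "a \<in> V" "b \<in> V" "adj G a b" "adj G b a" using e G(1) ab sympD[OF G(3)] by auto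
    have "a \<noteq> b" using abV(3) irreflpD[OF G(4)] by auto
    have low: "\<exists>i\<le>t. x \<in> A i \<and> y \<in> A i" if x: "x \<in> V - Q" "y \<in> V" "adj G x y" for x y
    proof -
      have "B x \<in> h ` {1..t}" using im x(1) by blast
      then obtain i where i: "i \<in> {1..t}" "h i = B x" by auto
      have "y \<in> B x \<union> {u, v}" using B(4)[OF x(1) B(2)[OF x(1)] x(2)] x(3) by blast
      then have "x \<in> A i" "y \<in> A i" using Ai[OF i(1)] i(2) B(2)[OF x(1)] by auto
      then show ?thesis using i(1) by auto
    qed
    have "\<exists>i\<le>t. a \<in> A i \<and> b \<in> A i"
    proof (cases "a \<in> Q \<and> b \<in> Q")
      case True
      then show ?thesis using A0 by (intro exI[of _ 0]) simp
    next
      case False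
      then show ?thesis using low[of a b] low[of b a] abV by auto
    qed
    then show "e \<in> ?R" using ab \<open>a \<noteq> b\<close> by simp
  next
    fix e assume e: "e \<in> ?R"
    obtain a b where ab: "e = (a, b)" by (cases e)
    obtain i where i: "i \<le> t" "a \<in> A i" "b \<in> A i" and ne: "a \<noteq> b" using e ab by auto
    have abV: "a \<in> V" "b \<in> V" using verts i by auto
    from idx[OF i(1)] have "adj G a b"
    proof
      assume "i = 0"
      then show ?thesis using Q i A0 ne by simp
    next
      assume it: "i \<in> {1..t}"
      obtain w where w: "w \<in> V - Q" "h i = B w" using hF[OF it] by blast
      have mem: "a \<in> B w \<union> {u, v}" "b \<in> B w \<union> {u, v}" using i Ai[OF it] w(2) by auto
      show ?thesis
      proof (cases "a \<in> B w")
        case True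
        then show ?thesis using B(4)[OF w(1) True abV(2)] mem ne by simp
      next
        case aF: False
        show ?thesis
        proof (cases "b \<in> B w")
          case True
          then have "adj G b a" using B(4)[OF w(1) True abV(1)] mem ne by simp
          then show ?thesis by (rule sympD[OF G(3)])
        next
          case False
          then show ?thesis using Q[of a b] mem aF uv ne by auto
        qed
      qed
    qed
    then show "e \<in> parcs G" using ab by simp
  qed
  show ?thesis unfolding is_Z_def G(2)
    by (intro exI[of _ A] exI[of _ t] exI[of _ u] exI[of _ v] conjI V(5) le tk uv(3) finA cA int verts arcs)
      (simp only: A0 V(4))
qed

lemma iso_to_subgraph_image:
  assumes "parcs G \<subseteq> parcs W" "pverts G = pverts W" "parcs W \<subseteq> pverts W \<times> pverts W" "inj_on \<phi> (pverts W)"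
  shows "iso_to_subgraph G (image_graph \<phi> W)"
proof -
  have G: "parcs G \<subseteq> pverts G \<times> pverts G" using assms(1-3) by auto
  have "digraph_iso (with_proj G) (with_proj (image_graph \<phi> G))"
    by (rule image_graph_iso[OF G]) (simp add: assms(2,4))
  moreover have wf: "wf_digraph (with_proj (image_graph \<phi> K))" if K: "parcs K \<subseteq> pverts K \<times> pverts K" for K :: "'a pair_pre_digraph"
  proof -
    have "map_prod \<phi> \<phi> ` parcs K \<subseteq> map_prod \<phi> \<phi> ` (pverts K \<times> pverts K)" by (rule image_mono[OF K])
    also have "\<dots> = \<phi> ` pverts K \<times> \<phi> ` pverts K" by (rule map_prod_surj_on[OF refl refl])
    finally have sub: "parcs (image_graph \<phi> K) \<subseteq> pverts (image_graph \<phi> K) \<times> pverts (image_graph \<phi> K)"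
      unfolding image_graph_def by simp
    show ?thesis
    proof
      fix e assume "e \<in> arcs (with_proj (image_graph \<phi> K))"
      then have "e \<in> pverts (image_graph \<phi> K) \<times> pverts (image_graph \<phi> K)" using subsetD[OF sub] by simp
      then show "tail (with_proj (image_graph \<phi> K)) e \<in> verts (with_proj (image_graph \<phi> K))"
        "head (with_proj (image_graph \<phi> K)) e \<in> verts (with_proj (image_graph \<phi> K))"
        by (simp_all add: mem_Times_iff)
    qed
  qed
  moreover have "subgraph (with_proj (image_graph \<phi> G)) (with_proj (image_graph \<phi> W))"
    unfolding subgraph_def compatible_def with_proj_simps
    using wf[OF G] wf[OF assms(3)] image_mono[OF assms(1), of "map_prod \<phi> \<phi>"] assms(2)
    by (simp add: image_graph_def)
  ultimately show ?thesis unfolding iso_to_subgraph_def by blast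
qed

lemma locally_maximal_closed_frame:
  fixes G :: "'a pair_pre_digraph"
  assumes G: "pair_graph G" "two_connected G" and C: "locally_maximal_cycle G C"
    and c: "card (cycle_edges C) = c" "6 \<le> c"
  obtains f where "closed_frame (adj (C_closure G C)) (pverts G) f c" "range f = cycle_verts C"
    "parcs G \<subseteq> parcs (C_closure G C)" "pverts (C_closure G C) = pverts G" "pair_graph (C_closure G C)"
    "parcs (induced G (cycle_verts C)) \<subseteq> parcs G \<inter> cycle_verts C \<times> cycle_verts C"
    "finite (cycle_verts C)"
proof -
  note g = pair_graphD[OF G(1)]
  define A where "A = cycle_verts C"
  define H0 where "H0 = induced G A"
  define H where "H = m_closure (c + 1) H0"
  define K where "K = C_closure G C"
  have cyc: "graph_cycle G C" using C unfolding locally_maximal_cycle_def by blast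
  obtain f where f0: "\<forall>i j. f i = f j \<longleftrightarrow> i mod int (length C) = j mod int (length C)"
    "range f = cycle_verts C" "\<forall>i. adj G (f i) (f (i + 1))" "card (cycle_edges C) = length C"
    by (rule cycle_index[OF G(1) cyc])
  note f = f0(1)[rule_format] f0(2) f0(3)[rule_format] f0(4)
  have lc: "length C = c" using f(4) c(1) by simp
  have fA: "range f = A" using f(2) unfolding A_def .
  have AV: "A \<subseteq> pverts G" unfolding fA[symmetric] using f(3) g(3) by auto
  have finA: "finite A" by (rule finite_subset[OF AV g(1)])
  have cA: "card A = c"
  proof -
    have "A = f ` {0..<int c}"
    proof (rule equalityI; rule subsetI)
      fix z assume "z \<in> A"
      then obtain i where i: "z = f i" unfolding fA[symmetric] by blast
      have "f i = f (i mod int c)" unfolding f(1) lc by simp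
      moreover have "i mod int c \<in> {0..<int c}" using c(2) by auto
      ultimately show "z \<in> f ` {0..<int c}" using i by blast
    next
      fix z assume "z \<in> f ` {0..<int c}"
      then show "z \<in> A" unfolding fA[symmetric] by blast
    qed
    moreover have "inj_on f {0..<int c}" by (rule inj_onI) (simp add: f(1) lc)
    ultimately show ?thesis by (simp add: card_image)
  qed
  have H0: "pair_graph H0" "pverts H0 = A" "parcs H0 = {e \<in> parcs G. fst e \<in> A \<and> snd e \<in> A}"
    unfolding H0_def using pair_graph_induced[OF G(1) finA] by (auto simp: induced_def)
  have mc: "is_m_closure (c + 1) H0 H" unfolding H_def by (rule is_m_closure_m_closure[OF H0(1)])
  then have st: "(closure_step (c + 1))\<^sup>*\<^sup>* H0 H" and no: "\<And>H'. \<not> closure_step (c + 1) H H'"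
    unfolding is_m_closure_def by auto
  have H: "pair_graph H" by (rule closure_steps_pair_graph[OF st H0(1)])
  note h = pair_graphD[OF H]
  have HA: "pverts H = A" using closure_step_verts[OF st] H0(2) by simp
  have HH: "parcs H0 \<subseteq> parcs H" by (rule closure_step_mono[OF st])
  have K: "pverts K = pverts G" "parcs K = (parcs G - parcs H0) \<union> parcs H"
    unfolding K_def C_closure_def c(1) H_def H0_def A_def by simp_all
  have HAA: "parcs H \<subseteq> A \<times> A" using h(3) unfolding HA .
  have Kin: "adj K a b \<longleftrightarrow> adj H a b" if "a \<in> A" "b \<in> A" for a b
    unfolding K(2) H0(3) using that HH H0(3) by auto
  have Kout: "adj K a b \<longleftrightarrow> adj G a b" if "\<not> (a \<in> A \<and> b \<in> A)" for a b
    unfolding K(2) H0(3) using that HAA by auto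
  have GK: "parcs G \<subseteq> parcs K" unfolding K(2) using HH by blast
  have KG: "pair_graph K"
  proof (rule pair_graphI)
    show "finite (pverts K)" using g(1) K(1) by simp
    show "parcs K \<subseteq> pverts K \<times> pverts K" unfolding K using g(3) HAA AV by blast
    show "symp (adj K)"
    proof (rule sympI)
      fix a b assume ab: "adj K a b"
      show "adj K b a"
      proof (cases "a \<in> A \<and> b \<in> A")
        case True
        then show ?thesis using Kin[of a b] Kin[of b a] ab sympD[OF h(4)] by blast
      next
        case False
        then show ?thesis using Kout[of a b] Kout[of b a] ab sympD[OF g(4)] by blast
      qed
    qed
    show "irreflp (adj K)"
    proof (rule irreflpI)
      fix a
      show "\<not> adj K a a"
        using Kin[of a a] Kout[of a a] irreflpD[OF g(5), of a] irreflpD[OF h(5), of a] by (cases "a \<in> A") auto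
    qed
  qed
  note k = pair_graphD[OF KG]
  have "closed_frame (adj K) (pverts G) f c"
  proof (unfold_locales, unfold fA)
    show "finite (pverts G)" by (rule g(1))
    show "symp (adj K)" "irreflp (adj K)" by (rule k(4), rule k(5))
    show "3 \<le> c" "6 \<le> c" using c(2) by auto
    show "f i = f j \<longleftrightarrow> i mod int c = j mod int c" for i j using f(1)[of i j] lc by simp
    show "A \<subseteq> pverts G" by (rule AV)
    show "adj K (f i) (f (i + 1))" for i by (rule subsetD[OF GK f(3)])
    show "\<exists>a\<in>D. \<exists>b\<in>pverts G - D - {v}. adj K a b"
      if D: "D \<subseteq> pverts G - {v}" "D \<noteq> {}" "D \<noteq> pverts G - {v}" for D v
    proof -
      obtain a b where "a \<in> D" "b \<in> pverts G - D - {v}" "adj G a b" using two_connected_cut[OF G D] by blast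
      then show ?thesis using subsetD[OF GK] by blast
    qed
    \<comment> \<open>Only \<open>P\<close> can use edges of the closure. The ear and its two end
      edges are not inside \<open>A\<close>, so they belong to \<open>G\<close> and survive the
      replacement of \<open>P\<close> by a path of \<open>G\<close> that is at least as
      long.\<close>
    show "length P + length rs \<le> c"
      if uv: "u \<in> A" "v \<in> A" "u \<noteq> v" and P: "gpath (adj K) A u P v"
        and rs: "rs \<noteq> []" "distinct rs" "set rs \<subseteq> pverts G - A" "successively (adj K) rs"
          "adj K u (hd rs)" "adj K (last rs) v" for u v P rs
    proof -
      have p: "P \<noteq> []" "hd P = u" "last P = v" "distinct P" "set P \<subseteq> A" "successively (adj K) P"
        using P unfolding gpath_def by simp_all
      have "successively (adj H) P"
        using p(6) by (rule successively_mono) (use Kin p(5) in blast)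
      then have PH: "gpath (adj H) (pverts H0) u P v" unfolding gpath_def H0(2) using p by simp
      have st': "(closure_step (card (pverts H0) + 1))\<^sup>*\<^sup>* H0 H" using st unfolding H0(2) cA .
      obtain P' where P': "gpath (adj H0) (pverts H0) u P' v" "length P \<le> length P'"
        using closure_paths[OF st' H0(1) PH] by blast
      have p': "P' \<noteq> []" "hd P' = u" "last P' = v" "distinct P'" "set P' \<subseteq> A" "successively (adj H0) P'"
        using P'(1) unfolding gpath_def H0(2) by simp_all
      have "successively (adj G) P'" using p'(6) by (rule successively_mono) (simp add: H0(3))
      then have PG: "gpath (adj G) (cycle_verts C) u P' v" unfolding gpath_def A_def[symmetric] using p' by simp
      have out: "z \<notin> A" if "z \<in> set rs" for z using rs(3) that by blast
      have hl: "hd rs \<notin> A" "last rs \<notin> A" using out rs(1) by simp_all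
      have "successively (adj G) rs"
        using rs(4) by (rule successively_mono) (use Kout out in blast)
      moreover have "adj G u (hd rs)" "adj G (last rs) v" using rs(5,6) Kout hl by blast+
      moreover have "set rs \<inter> cycle_verts C = {}" using out unfolding A_def by blast
      ultimately have "length P' + length rs \<le> c"
        using locally_maximal_bound[OF G(1) C PG uv(3) rs(1,2)] c(1) by simp
      then show ?thesis using P'(2) by linarith
    qed
    show "adj K a b"
      if ab: "a \<in> A" "b \<in> A" "a \<noteq> b" "c + 1 \<le> card {z \<in> A. adj K a z} + card {z \<in> A. adj K b z}" for a b
    proof (rule ccontr)
      assume "\<not> adj K a b"
      then have nab: "\<not> adj H a b" using Kin ab by blast
      have "{z \<in> A. adj K x z} = {z \<in> A. adj H x z}" if "x \<in> A" for x using Kin that by blast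
      then have "c + 1 \<le> out_degree (with_proj H) a + out_degree (with_proj H) b"
        using ab unfolding out_degree_card[OF h(3)] HA by simp
      then have "closure_step (c + 1) H \<lparr>pverts = pverts H, parcs = parcs H \<union> {(a, b), (b, a)}\<rparr>"
        unfolding closure_step_def using ab nab HA by blast
      then show False using no by blast
    qed
  qed
  moreover have "parcs H0 \<subseteq> parcs G \<inter> A \<times> A" unfolding H0(3) by auto
  ultimately show ?thesis
    using that[of f] fA GK K(1) KG finA unfolding K_def A_def H0_def by blast
qed

theorem theorem4p1:
  fixes G :: "'a pair_pre_digraph" and C :: "('a \<times> 'a) awalk" and n k c :: nat
  assumes "pair_graph G" and "card (pverts G) = n"
    and "two_connected G"
    and "min_degree G \<ge> k"
    and "locally_maximal_cycle G C"
    and "card (cycle_edges C) = c"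
    and "c \<in> {6..n - 1}"
    and "num_edges G > max (f_fun n (k + 1) c) (f_fun n (c div 2 - 1) c)"
    and "num_edges (induced G (cycle_verts C)) > h_fun (c + 1) (c div 2 - 1)"
  shows "(\<exists>W :: nat pair_pre_digraph. is_W n (c div 2) c W \<and> iso_to_subgraph G W) \<or>
    (\<exists>W :: nat pair_pre_digraph. is_W n k c W \<and>
       digraph_iso (with_proj (C_closure G C)) (with_proj W)) \<or>
    (\<exists>Z :: nat pair_pre_digraph. is_Z n k c Z \<and>
       digraph_iso (with_proj (C_closure G C)) (with_proj Z))"
proof -
  define V where "V = pverts G"
  define K where "K = C_closure G C"
  have c: "6 \<le> c" "c < n" using assms(7) by auto
  obtain f where f: "closed_frame (adj K) V f c" "range f = cycle_verts C"
    "parcs G \<subseteq> parcs K" "pverts K = V" "pair_graph K"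
    "parcs (induced G (cycle_verts C)) \<subseteq> parcs G \<inter> cycle_verts C \<times> cycle_verts C" "finite (cycle_verts C)"
    using locally_maximal_closed_frame[OF assms(1,3,5,6) c(1)] unfolding K_def V_def by metis
  interpret CF: closed_frame "adj K" V f c by (rule f(1))
  note g = pair_graphD[OF assms(1)] and k = pair_graphD[OF f(5)]
  have kV: "parcs K \<subseteq> V \<times> V" using k(3) f(4) by simp
  have n: "card V = n" using assms(2) unfolding V_def .
  obtain \<phi> :: "'a \<Rightarrow> nat" where \<phi>: "inj_on \<phi> V" using finite_imp_inj_to_nat_seg[OF CF.finV] by blast
  have Out_ne: "V - range f \<noteq> {}"
  proof
    assume "V - range f = {}"
    then have "card V \<le> card (range f)" by (intro card_mono[OF CF.finCy]) simp
    then show False using n c(2) CF.card_Cy by linarith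
  qed
  have deg: "k \<le> card {z \<in> V. adj K v z}" if v: "v \<in> V" for v
  proof -
    have "k \<le> out_degree (with_proj G) v"
      using assms(4) g(1) v unfolding min_degree_def V_def
      by (meson Min_le finite_imageI imageI le_trans)
    also have "\<dots> = card {z \<in> V. adj G v z}" unfolding V_def by (rule out_degree_card[OF g(3)])
    also have "\<dots> \<le> card {z \<in> V. adj K v z}"
      by (rule card_mono) (use CF.finV subsetD[OF f(3)] in auto)
    finally show ?thesis .
  qed
  have "card (parcs G) \<le> card (parcs K)" by (rule card_mono[OF k(2) f(3)])
  then have eG: "2 * num_edges G \<le> card (parcs K)" using card_parcs[OF assms(1)] by simp
  have t: "CF.t = c div 2" by (rule CF.t_def)
  have t3: "3 \<le> CF.t" by (rule CF.t_c(2))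
  show ?thesis
  \<comment> \<open>Above this size \<open>d = c + 1 - card CF.S\<close> is at most
    \<open>CF.t - 1\<close>, the range in which the edge hypothesis on \<open>G\<close> controls
    \<open>f_fun n d c\<close>.\<close>
  proof (cases "card CF.S \<le> c - CF.t + 1")
    case True
    have H0: "pair_graph (induced G (cycle_verts C))" by (rule pair_graph_induced[OF assms(1) f(7)])
    have "parcs (induced G (cycle_verts C)) \<subseteq> {(a, b). a \<in> CF.Hc \<and> b \<in> CF.Hc \<and> adj K a b}"
      using f(3,6) unfolding CF.Hc_def f(2) by auto
    moreover have "finite {(a, b). a \<in> CF.Hc \<and> b \<in> CF.Hc \<and> adj K a b}"
      by (rule finite_subset[OF _ k(2)]) auto
    ultimately have "card (parcs (induced G (cycle_verts C))) \<le> card {(a, b). a \<in> CF.Hc \<and> b \<in> CF.Hc \<and> adj K a b}"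
      by (rule card_mono[rotated])
    then have "2 * h_fun (c + 1) (CF.t - 1) + 2 \<le> card {(a, b). a \<in> CF.Hc \<and> b \<in> CF.Hc \<and> adj K a b}"
      using card_parcs[OF H0] assms(9) unfolding t by linarith
    moreover have "2 * h_fun (c + 1) (CF.t - 1) = (c + 2 - CF.t) * (c + 1 - CF.t) + 2 * ((CF.t - 1) * (CF.t - 2))"
    proof -
      have "c + 1 - (CF.t - 1) = c + 2 - CF.t" "c + 2 - CF.t - 1 = c + 1 - CF.t" "CF.t - 1 - 1 = CF.t - 2"
        using t3 CF.t_c(1) by linarith+
      then show ?thesis unfolding h_fun_def distrib_left two_choose by simp
    qed
    ultimately have arcs: "(c + 2 - CF.t) * (c + 1 - CF.t) + 2 * ((CF.t - 1) * (CF.t - 2)) + 2 \<le>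
      card {(a, b). a \<in> CF.Hc \<and> b \<in> CF.Hc \<and> adj K a b}" by simp
    obtain L where L: "CF.S \<subseteq> L" "L \<subseteq> V" "card CF.S = CF.t" "card L = c + 1 - CF.t"
      and edges: "\<forall>a\<in>V. \<forall>b\<in>V. adj K a b \<longrightarrow> a \<in> CF.S \<or> b \<in> CF.S \<or> (a \<in> L \<and> b \<in> L)"
      using CF.dense_structure[OF True arcs Out_ne] by blast
    define W where "W = \<lparr>pverts = V, parcs = {(a, b). a \<in> V \<and> b \<in> V \<and> a \<noteq> b \<and>
      (a \<in> L \<and> b \<in> L \<or> a \<in> CF.S \<and> b \<notin> L \<or> a \<notin> L \<and> b \<in> CF.S)}\<rparr>"
    have W: "pverts W = V" "parcs W \<subseteq> V \<times> V" unfolding W_def by auto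
    have "is_W n CF.t c W"
      by (rule is_W_of_structure[OF CF.finV n L(2,1,4,3) W(2,1)]) (simp add: W_def)
    then have "is_W n CF.t c (image_graph \<phi> W)" by (rule is_W_image) (simp add: W(1) \<phi>)
    moreover have "parcs G \<subseteq> parcs W"
    proof
      fix e assume e: "e \<in> parcs G"
      obtain a b where ab: "e = (a, b)" by (cases e)
      have abV: "a \<in> V" "b \<in> V" "adj K a b" using e ab g(3) f(3) unfolding V_def by auto
      have "a \<noteq> b" using irreflpD[OF k(5)] abV(3) by auto
      then show "e \<in> parcs W" unfolding W_def ab using abV edges L(1) by auto
    qed
    then have "iso_to_subgraph G (image_graph \<phi> W)"
      by (rule iso_to_subgraph_image) (use W \<phi> in \<open>simp_all add: V_def\<close>)
    ultimately show ?thesis unfolding t by blast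
  next
    case False
    define d where "d = c + 1 - card CF.S"
    have big: "c - CF.t + 2 \<le> card CF.S" using False by linarith
    interpret QF: clique_frame "adj K" V f c CF.S d unfolding d_def by (rule CF.big_clique_frame(1)[OF big])
    have Xdeg: "card {z \<in> range f. adj K x z} \<le> d" if "x \<in> range f - CF.S" for x
      using CF.big_clique_frame(2)[OF big, of x] that unfolding CF.Hc_def d_def by simp
    have dt: "d \<le> CF.t - 1" using QF.cardQ big CF.t_c by linarith
    have cS: "card CF.S = c + 1 - d" using QF.cardQ by simp
    \<comment> \<open>The low degree vertex for the whole outside of \<open>C\<close>: its full
      degree is at most \<open>d\<close>, so \<open>k \<le> d\<close>.\<close>
    obtain w where w: "w \<in> V - range f" "card {z \<in> (V - range f) \<union> range f. adj K w z} \<le> d"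
      using QF.low_degree_vertex[OF order_refl Out_ne] by blast
    have "(V - range f) \<union> range f = V" using CF.f_V by blast
    then have kd: "k \<le> d" using w deg[of w] by simp
    have d1: "1 \<le> d" using QF.cardX by linarith
    have "{(a, b). a \<in> V \<and> b \<in> V \<and> adj K a b} = parcs K" using kV by auto
    then have "card (parcs K) \<le> card CF.S * (card CF.S - 1) + 2 * d * (d - 1) + 2 * d * (card V - c)"
      using QF.arcs_bound[OF Xdeg] by simp
    also have "\<dots> = 2 * f_fun n d c"
    proof -
      have "n + d - c - 1 = (d - 1) + (n - c)" using d1 c(2) by simp
      moreover have "c + 1 - d - 1 = c - d" by simp
      moreover have "2 * f_fun n d c = (c + 1 - d) * (c - d) + 2 * d * (n + d - c - 1)"
        by (rule two_f_fun) (use QF.d_small c(2) in auto)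
      ultimately show ?thesis unfolding cS n by (simp add: distrib_left)
    qed
    finally have ef: "num_edges G \<le> f_fun n d c" using eG by linarith
    \<comment> \<open>Otherwise \<open>d\<close> lies between \<open>k + 1\<close> and
      \<open>CF.t - 1\<close>, and convexity bounds the number of edges by the maximum in the
      hypothesis.\<close>
    have "k = d"
    proof (rule ccontr)
      assume "k \<noteq> d"
      then have "k + 1 \<le> d" using kd by simp
      then have "f_fun n d c \<le> max (f_fun n (k + 1) c) (f_fun n (CF.t - 1) c)"
        by (rule f_fun_convex) (use dt CF.t_c c(2) in auto)
      then show False using ef assms(8) unfolding t by linarith
    qed
    note deg' = deg[unfolded \<open>k = d\<close>]
    have d2: "2 \<le> k" using QF.two_le_d[OF deg' Out_ne] \<open>k = d\<close> by simp
    have SV: "CF.S \<subseteq> V" using QF.QC CF.f_V by blast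
    have iso: "digraph_iso (with_proj K) (with_proj (image_graph \<phi> K))"
      by (rule image_graph_iso[OF k(3)]) (simp add: f(4) \<phi>)
    show ?thesis
    \<comment> \<open>Two consecutive cycle vertices outside the clique decide between
      \<open>Z\<close> and \<open>W\<close>. For \<open>d = 2\<close> only one vertex is outside the
      clique, so this value falls under \<open>W\<close>.\<close>
    proof (cases "\<exists>q. f q \<in> range f - CF.S \<and> f (q + 1) \<in> range f - CF.S")
      case True
      then obtain q where q: "f q \<in> range f - CF.S" "f (q + 1) \<in> range f - CF.S" by blast
      obtain u v where uv: "u \<in> CF.S" "v \<in> CF.S" "u \<noteq> v" "\<forall>w\<in>V - CF.S. \<exists>L. L \<subseteq> V - CF.S \<and> w \<in> L \<and> card L + 1 = d \<and>
        (\<forall>a\<in>L. \<forall>b\<in>V. adj K a b \<longleftrightarrow> a \<noteq> b \<and> b \<in> L \<union> {u, v})"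
        using QF.Z_case[OF deg' Out_ne q] by blast
      have "is_Z n k c K"
        by (rule is_Z_of_structure[OF CF.finV n SV _ d2 kV f(4) k(4,5) QF.Qclique uv(1-3)])
          (use uv(4) cS \<open>k = d\<close> in simp_all)
      moreover have "c + 1 - k < n" using c(2) d2 by linarith
      ultimately have "is_Z n k c (image_graph \<phi> K)"
        by (intro is_Z_image) (simp_all add: f(4) \<phi>)
      then show ?thesis using iso unfolding K_def by blast
    next
      case False
      then have "\<And>q. f q \<in> range f - CF.S \<Longrightarrow> f (q + 1) \<notin> range f - CF.S" by blast
      then obtain S where S: "S \<subseteq> CF.S" "card S = d" "\<forall>a\<in>V. \<forall>b\<in>V. adj K a b \<longleftrightarrow>
        a \<noteq> b \<and> (a \<in> CF.S \<and> b \<in> CF.S \<or> a \<in> S \<and> b \<notin> CF.S \<or> a \<notin> CF.S \<and> b \<in> S)"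
        using QF.W_case[OF deg' Out_ne] by blast
      have "is_W n k c K"
        by (rule is_W_of_structure[OF CF.finV n SV S(1) _ _ kV f(4) S(3)]) (use cS S(2) \<open>k = d\<close> in simp_all)
      then have "is_W n k c (image_graph \<phi> K)"
        by (rule is_W_image) (use f(4) \<phi> in simp)
      then show ?thesis using iso unfolding K_def by blast
    qed
  qed
qed

end
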